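(* Fix $\theta\in\Theta$. Let $P$ be the transition kernel of the joint process $H_t=(X_t,Z_t,S_t,\tilde S_t,\tilde{\tilde S}_t,\eta_t)$ described in the context, let $\rho$ be the initial distribution of $H_0$, and let $\mu^\theta_t:=(P^t)^\vee\rho$ be the distribution of $H_t$ (so $\mu_0^\theta=\rho$). If $q^2:=L_\wp^2+\bar L^2<1$, then there exist a stationary distribution $\mu^\theta$, i.e. $P^\vee\mu^\theta=\mu^\theta$, and a constant $C'>0$ such that for all $t\ge 0$ $$\mathrm{Wass}_2(\mu^\theta_t,\mu^\theta)\le C'q^t,$$ and in particular $\mathrm{Wass}_2(\mu^\theta_t,\mu^\theta)\to0$ as $t\to\infty$.
   Context: Norms: $\|\cdot\|_{\max}$ is the largest absolute value of the entries of a vector/array; $\mathrm{Wass}_2$ is the 2-Wasserstein distance with respect to $\|\cdot\|_{\max}$ on probability measures with finite second moment. Data. Fix positive integers $d,N,d_Z$. $(X_t,Z_t)_{t\ge0}$ is a time-homogeneous Markov chain in $\mathbb{R}^d\times\mathbb{R}^{d_Z}$ with transition kernel $\wp$; $(\eta_t)$ are i.i.d. real random variables with law $\mu_\eta$ (finite second moment), independent of $(X_t,Z_t)$. Assumptions: $\mathrm{Wass}_2(\wp(w,\cdot),\wp(\tilde w,\cdot))\le L_\wp\|w-\tilde w\|_{\max}$ for all $w,\tilde w\in\mathbb{R}^{d+d_Z}$ with $L_\wp<1$; the chain stays in the cube: $\|(X_t,Z_t)\|_{\max}\le1$ for all $t$ (for $w\in[-1,1]^{d+d_Z}$, $\wp(w,[-1,1]^{d+d_Z})=1$).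 Network. Parameters $\theta=(A,W,B,c)\in\Theta=\mathbb{R}^{N\times d}\times\mathbb{R}^{N\times N}\times\mathbb{R}^N\times\mathbb{R}$. $\sigma(y)=1/(1+e^{-y})$. $\phi:\mathbb{R}\to\mathbb{R}$ is infinitely differentiable, bounded with bounded derivatives, applied entrywise; $|\phi|\le C_\phi<4$, $|\phi'|\le C_{\phi'}$, $|\phi''|\le C_{\phi''}$. $A^{k,:}$ is the $k$-th row of $A$. Constants. $M_\phi=1+\frac{C_\phi}{4-C_\phi}$, $m=\min(N,d)$, $L_0=\max\big(\frac{3C_{\phi'}}{m}(\frac{C_\phi M_\phi}{10}+\frac14),\frac{3C_\phi}{4}\big)$, $L_2=\max\big(\frac{C_{\phi''}}{m},\frac{C_{\phi'}^2}{Nd(4-C_\phi)}\big)$, $T_1=\frac{M_\phi C_{\phi'}^2}{5m^2}+\frac{C_\phi M_\phi^2C_{\phi'}^2}{8m^2}+\frac{C_{\phi''}}{4m}+\frac{C_\phi}{10}\Big(L_2+\frac{C_\phi}{1-C_\phi/4}\big(\frac{C_{\phi'}^2M_\phi^2}{10m^2}+\frac14L_2\big)\Big)$, $T_2=\frac{C_\phi M_\phi C_{\phi'}}{5m}+\frac{C_{\phi'}}{4N}$, $L_1=\max(4T_1,4T_2,C_\phi)$, $\bar L=\max(L_0,L_1)$. The map $F=F^\theta$. Let $u=(x,z)$, $v=(s,\tilde s,\tilde{\tilde s})$ with $s\in\mathbb{R}^N$, $\tilde s$ having entries $\tilde s^{\diamondsuit,k}$ and $\tilde{\tilde s}$ having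 entries $\tilde{\tilde s}^{\diamondsuit,\heartsuit,k}$, where $\diamondsuit,\heartsuit$ range over (labels of) entries of $A$ and $W$ — the pairs being of type $(A,A)$, $(W,A)$, $(W,W)$ — and $k=1,\dots,N$. Put $a_k=\frac1d\langle\phi(A^{k,:}),x\rangle+\frac1N\langle\phi(W^{k,:}),s\rangle$, $p^k_{A^{ij}}=\frac1d\delta_{ik}\phi'(A^{ij})x^j+\frac1N\sum_\ell\phi(W^{k\ell})\tilde s^{A^{ij},\ell}$, $p^k_{W^{ij}}=\frac1N\delta_{ik}\phi'(W^{ij})s^j+\frac1N\sum_\ell\phi(W^{k\ell})\tilde s^{W^{ij},\ell}$, $r^k_{A^{nm},A^{ij}}=\frac1d\delta_{ik}\delta_{(i,j)=(n,m)}\phi''(A^{ij})x^j+\frac1N\sum_\ell\phi(W^{k\ell})\tilde{\tilde s}^{A^{nm},A^{ij},\ell}$, $r^k_{W^{nm},A^{ij}}=\frac1N\delta_{kn}\phi'(W^{nm})\tilde s^{A^{ij},m}+\frac1N\sum_\ell\phi(W^{k\ell})\tilde{\tilde s}^{W^{nm},A^{ij},\ell}$, $r^k_{W^{nm},W^{ij}}=\frac1N\delta_{ik}\delta_{(i,j)=(n,m)}\phi''(W^{ij})s^j+\frac1N\sum_\ell\phi(W^{k\ell})\tilde{\tilde s}^{W^{nm},W^{ij},\ell}$. Then $F_{S,k}=\sigma(a_k)$, $F_{\diamondsuit,k}=\sigma'(a_k)p^k_\diamondsuit$, $F_{\diamondsuit,\heartsuit,k}=\sigma''(a_k)p^k_\diamondsuit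 p^k_\heartsuit+\sigma'(a_k)r^k_{\diamondsuit,\heartsuit}$. Joint process. With $U_t=(X_t,Z_t)$, $V_t=(S_t,\tilde S_t,\tilde{\tilde S}_t)$, $V_{t+1}=F^\theta(U_t,V_t)$, the process $H_t=(U_t,V_t,\eta_t)$ is Markov with kernel $P((u,v,\eta),\cdot)=\wp(u,\cdot)\otimes\delta_{F^\theta(u,v)}\otimes\mu_\eta$. $P^t$ is the $t$-step kernel and $(P^t)^\vee\rho(\cdot)=\int P^t(h,\cdot)\rho(dh)$. The coordinates $(U_t,V_t)$ live in the hyper-rectangle $\mathcal{R}$: $x,z$ entries in $[-1,1]$; $s$ entries in $[0,1]$; $|\tilde s^{A^{ij},k}|\le\frac{C_{\phi'}}{d(4-C_\phi)}$; $|\tilde s^{W^{ij},k}|\le\frac{C_{\phi'}}{N(4-C_\phi)}$; the $AA$, $WA$, $WW$ entries of $\tilde{\tilde s}$ bounded in absolute value by $\frac{a_{AA}}{1-C_\phi/4}$, $\frac{a_{WA}}{1-C_\phi/4}$, $\frac{a_{WW}}{1-C_\phi/4}$, where $a_{AA}=\frac{C_{\phi'}^2M_\phi^2}{10d^2}+\frac{C_{\phi''}}{4d}$, $a_{WA}=\frac{C_{\phi'}^2M_\phi^2}{10Nd}+\frac{C_{\phi'}^2}{4Nd(4-C_\phi)}$, $a_{WW}=\frac{C_{\phi'}^2M_\phi^2}{10N^2}+\frac{C_{\phi''}}{4N}$. The initial distribution $\rho$ is a probability measure on $\mathcal{R}\times\mathbb{R}$ with finite second moment. *)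

theory Defs
  imports "HOL-Probability.Probability"
begin

section \<open>The 2-Wasserstein distance for the max-norm\<close>

text \<open>
  The max-norm is the library's \<^const>\<open>infnorm\<close>: on (nested) products and arrays of
  reals it is the largest absolute value of a real entry.
\<close>

definition second_moment :: "'a::euclidean_space measure \<Rightarrow> ennreal" where
  "second_moment M = (\<integral>\<^sup>+ x. ennreal ((infnorm x)\<^sup>2) \<partial>M)"

definition P2 :: "'a::euclidean_space measure set" where
  "P2 = {M. prob_space M \<and> sets M = sets borel \<and> second_moment M < \<infinity>}"

definition couplings :: "'a measure \<Rightarrow> 'b measure \<Rightarrow> ('a \<times> 'b) measure set" where
  "couplings M N =
    {\<gamma>. sets \<gamma> = sets (M \<Otimes>\<^sub>M N) \<and> distr \<gamma> M fst = M \<and> distr \<gamma> N snd = N}"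

definition ennreal_sqrt :: "ennreal \<Rightarrow> ennreal" where
  "ennreal_sqrt c = (if c = \<infinity> then \<infinity> else ennreal (sqrt (enn2real c)))"

text \<open>
  Extended-valued, so that no junk value arises for an infinite optimal cost;
  it is finite on \<^const>\<open>P2\<close>.
\<close>

definition Wass2 :: "'a::euclidean_space measure \<Rightarrow> 'a measure \<Rightarrow> ennreal" where
  "Wass2 M N =
    ennreal_sqrt (INF \<gamma>\<in>couplings M N. \<integral>\<^sup>+ (x, y). ennreal ((infnorm (x - y))\<^sup>2) \<partial>\<gamma>)"

section \<open>Markov kernels\<close>

primrec kernel_pow ::
  "('a::topological_space \<Rightarrow> 'a measure) \<Rightarrow> nat \<Rightarrow> 'a \<Rightarrow> 'a measure" where
  "kernel_pow K 0 h = return borel h"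
| "kernel_pow K (Suc t) h = K h \<bind> kernel_pow K t"

definition kernel_adjoint :: "('a \<Rightarrow> 'a measure) \<Rightarrow> 'a measure \<Rightarrow> 'a measure" where
  "kernel_adjoint K \<rho> = \<rho> \<bind> K"

section \<open>Parameters and states\<close>

text \<open>
  Index types: 'd for the input coordinates, 'z for the coordinates of Z, 'n for the N hidden units.
  A parameter is (A, W, B, c), with A an N x d and W an N x N matrix.
  In a V-state, the components are s, then the first-order arrays indexed by A-labels and
  W-labels, then the second-order arrays for the label pairs AA, WA and WW.  The label of A^{ij}
  resp. W^{ij} is the pair (i,j); the innermost index is the unit k.
\<close>

type_synonym ('n, 'd) param = "(real^'d^'n) \<times> (real^'n^'n) \<times> (real^'n) \<times> real"

type_synonym ('d, 'z) ustate = "(real^'d) \<times> (real^'z)"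

type_synonym ('n, 'd) vstate =
  "(real^'n) \<times>
   ((real^'n^('n \<times> 'd)) \<times> (real^'n^('n \<times> 'n))) \<times>
   ((real^'n^('n \<times> 'd)^('n \<times> 'd)) \<times> (real^'n^('n \<times> 'd)^('n \<times> 'n)) \<times> (real^'n^('n \<times> 'n)^('n \<times> 'n)))"

type_synonym ('n, 'd, 'z) hstate = "('d, 'z) ustate \<times> ('n, 'd) vstate \<times> real"

section \<open>The recursion map\<close>

definition sigmoid :: "real \<Rightarrow> real" where
  "sigmoid y = 1 / (1 + exp (- y))"

fun preact :: "(real \<Rightarrow> real) \<Rightarrow> ('n::finite, 'd::finite) param \<Rightarrow> real^'d \<Rightarrow> real^'n \<Rightarrow> 'n \<Rightarrow> real" where
  "preact \<phi> (A, W, B, c) x s k =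
     (1 / real CARD('d)) * ((\<chi> j. \<phi> (A $ k $ j)) \<bullet> x) + (1 / real CARD('n)) * ((\<chi> l. \<phi> (W $ k $ l)) \<bullet> s)"

fun p_A :: "(real \<Rightarrow> real) \<Rightarrow> ('n::finite, 'd::finite) param \<Rightarrow> real^'d \<Rightarrow> real^'n^('n \<times> 'd)
    \<Rightarrow> 'n \<times> 'd \<Rightarrow> 'n \<Rightarrow> real" where
  "p_A \<phi> (A, W, B, c) x sA (i, j) k =
     (1 / real CARD('d)) * of_bool (i = k) * deriv \<phi> (A $ i $ j) * x $ j
     + (1 / real CARD('n)) * (\<Sum>l\<in>UNIV. \<phi> (W $ k $ l) * sA $ (i, j) $ l)"

fun p_W :: "(real \<Rightarrow> real) \<Rightarrow> ('n::finite, 'd::finite) param \<Rightarrow> real^'n \<Rightarrow> real^'n^('n \<times> 'n)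
    \<Rightarrow> 'n \<times> 'n \<Rightarrow> 'n \<Rightarrow> real" where
  "p_W \<phi> (A, W, B, c) s sW (i, j) k =
     (1 / real CARD('n)) * of_bool (i = k) * deriv \<phi> (W $ i $ j) * s $ j
     + (1 / real CARD('n)) * (\<Sum>l\<in>UNIV. \<phi> (W $ k $ l) * sW $ (i, j) $ l)"

fun r_AA :: "(real \<Rightarrow> real) \<Rightarrow> ('n::finite, 'd::finite) param \<Rightarrow> real^'d
    \<Rightarrow> real^'n^('n \<times> 'd)^('n \<times> 'd) \<Rightarrow> 'n \<times> 'd \<Rightarrow> 'n \<times> 'd \<Rightarrow> 'n \<Rightarrow> real" where
  "r_AA \<phi> (A, W, B, c) x sAA (n, m) (i, j) k =
     (1 / real CARD('d)) * of_bool (i = k) * of_bool ((i, j) = (n, m)) * deriv (deriv \<phi>) (A $ i $ j) * x $ j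
     + (1 / real CARD('n)) * (\<Sum>l\<in>UNIV. \<phi> (W $ k $ l) * sAA $ (n, m) $ (i, j) $ l)"

fun r_WA :: "(real \<Rightarrow> real) \<Rightarrow> ('n::finite, 'd::finite) param \<Rightarrow> real^'n^('n \<times> 'd)
    \<Rightarrow> real^'n^('n \<times> 'd)^('n \<times> 'n) \<Rightarrow> 'n \<times> 'n \<Rightarrow> 'n \<times> 'd \<Rightarrow> 'n \<Rightarrow> real" where
  "r_WA \<phi> (A, W, B, c) sA sWA (n, m) (i, j) k =
     (1 / real CARD('n)) * of_bool (k = n) * deriv \<phi> (W $ n $ m) * sA $ (i, j) $ m
     + (1 / real CARD('n)) * (\<Sum>l\<in>UNIV. \<phi> (W $ k $ l) * sWA $ (n, m) $ (i, j) $ l)"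

fun r_WW :: "(real \<Rightarrow> real) \<Rightarrow> ('n::finite, 'd::finite) param \<Rightarrow> real^'n
    \<Rightarrow> real^'n^('n \<times> 'n)^('n \<times> 'n) \<Rightarrow> 'n \<times> 'n \<Rightarrow> 'n \<times> 'n \<Rightarrow> 'n \<Rightarrow> real" where
  "r_WW \<phi> (A, W, B, c) s sWW (n, m) (i, j) k =
     (1 / real CARD('n)) * of_bool (i = k) * of_bool ((i, j) = (n, m)) * deriv (deriv \<phi>) (W $ i $ j) * s $ j
     + (1 / real CARD('n)) * (\<Sum>l\<in>UNIV. \<phi> (W $ k $ l) * sWW $ (n, m) $ (i, j) $ l)"

fun F_map :: "(real \<Rightarrow> real) \<Rightarrow> ('n::finite, 'd::finite) param \<Rightarrow> ('d, 'z::finite) ustate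
    \<Rightarrow> ('n, 'd) vstate \<Rightarrow> ('n, 'd) vstate" where
  "F_map \<phi> \<theta> (x, z) (s, (sA, sW), (sAA, sWA, sWW)) =
    (let a = preact \<phi> \<theta> x s;
         pA = p_A \<phi> \<theta> x sA;
         pW = p_W \<phi> \<theta> s sW;
         \<sigma>1 = deriv sigmoid;
         \<sigma>2 = deriv (deriv sigmoid)
     in ((\<chi> k. sigmoid (a k)),
         ((\<chi> \<alpha> k. \<sigma>1 (a k) * pA \<alpha> k),
          (\<chi> \<alpha> k. \<sigma>1 (a k) * pW \<alpha> k)),
         ((\<chi> \<alpha> \<beta> k. \<sigma>2 (a k) * pA \<alpha> k * pA \<beta> k + \<sigma>1 (a k) * r_AA \<phi> \<theta> x sAA \<alpha> \<beta> k),
          (\<chi> \<alpha> \<beta> k. \<sigma>2 (a k) * pW \<alpha> k * pA \<beta> k + \<sigma>1 (a k) * r_WA \<phi> \<theta> sA sWA \<alpha> \<beta> k),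
          (\<chi> \<alpha> \<beta> k. \<sigma>2 (a k) * pW \<alpha> k * pW \<beta> k + \<sigma>1 (a k) * r_WW \<phi> \<theta> s sWW \<alpha> \<beta> k))))"

section \<open>The joint kernel\<close>

definition joint_kernel :: "(real \<Rightarrow> real) \<Rightarrow> ('n::finite, 'd::finite) param
    \<Rightarrow> (('d, 'z::finite) ustate \<Rightarrow> ('d, 'z) ustate measure) \<Rightarrow> real measure
    \<Rightarrow> ('n, 'd, 'z) hstate \<Rightarrow> ('n, 'd, 'z) hstate measure" where
  "joint_kernel \<phi> \<theta> \<kappa> \<nu> = (\<lambda>(u, v, \<eta>). \<kappa> u \<Otimes>\<^sub>M (return borel (F_map \<phi> \<theta> u v) \<Otimes>\<^sub>M \<nu>))"

section \<open>Constants and the hyper-rectangle\<close>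

text \<open>
  The real arguments C, C', C'' are the bounds of the activation and of its first two derivatives.
\<close>

definition M_phi :: "real \<Rightarrow> real" where
  "M_phi C = 1 + C / (4 - C)"

definition m_min :: "nat \<Rightarrow> nat \<Rightarrow> real" where
  "m_min N d = real (min N d)"

definition L0 :: "nat \<Rightarrow> nat \<Rightarrow> real \<Rightarrow> real \<Rightarrow> real" where
  "L0 N d C C' = max (3 * C' / m_min N d * (C * M_phi C / 10 + 1/4)) (3 * C / 4)"

definition L2 :: "nat \<Rightarrow> nat \<Rightarrow> real \<Rightarrow> real \<Rightarrow> real \<Rightarrow> real" where
  "L2 N d C C' C'' = max (C'' / m_min N d) (C'\<^sup>2 / (real N * real d * (4 - C)))"

definition T1 :: "nat \<Rightarrow> nat \<Rightarrow> real \<Rightarrow> real \<Rightarrow> real \<Rightarrow> real" where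
  "T1 N d C C' C'' =
     M_phi C * C'\<^sup>2 / (5 * (m_min N d)\<^sup>2)
     + C * (M_phi C)\<^sup>2 * C'\<^sup>2 / (8 * (m_min N d)\<^sup>2)
     + C'' / (4 * m_min N d)
     + C / 10 * (L2 N d C C' C''
         + C / (1 - C/4) * (C'\<^sup>2 * (M_phi C)\<^sup>2 / (10 * (m_min N d)\<^sup>2) + 1/4 * L2 N d C C' C''))"

definition T2 :: "nat \<Rightarrow> nat \<Rightarrow> real \<Rightarrow> real \<Rightarrow> real" where
  "T2 N d C C' = C * M_phi C * C' / (5 * m_min N d) + C' / (4 * real N)"

definition L1 :: "nat \<Rightarrow> nat \<Rightarrow> real \<Rightarrow> real \<Rightarrow> real \<Rightarrow> real" where
  "L1 N d C C' C'' = Max {4 * T1 N d C C' C'', 4 * T2 N d C C', C}"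

definition L_bar :: "nat \<Rightarrow> nat \<Rightarrow> real \<Rightarrow> real \<Rightarrow> real \<Rightarrow> real" where
  "L_bar N d C C' C'' = max (L0 N d C C') (L1 N d C C' C'')"

definition a_AA :: "nat \<Rightarrow> real \<Rightarrow> real \<Rightarrow> real \<Rightarrow> real" where
  "a_AA d C C' C'' = C'\<^sup>2 * (M_phi C)\<^sup>2 / (10 * (real d)\<^sup>2) + C'' / (4 * real d)"

definition a_WA :: "nat \<Rightarrow> nat \<Rightarrow> real \<Rightarrow> real \<Rightarrow> real" where
  "a_WA N d C C' =
     C'\<^sup>2 * (M_phi C)\<^sup>2 / (10 * real N * real d) + C'\<^sup>2 / (4 * real N * real d * (4 - C))"

definition a_WW :: "nat \<Rightarrow> real \<Rightarrow> real \<Rightarrow> real \<Rightarrow> real" where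
  "a_WW N C C' C'' = C'\<^sup>2 * (M_phi C)\<^sup>2 / (10 * (real N)\<^sup>2) + C'' / (4 * real N)"

definition u_cube :: "('d::finite, 'z::finite) ustate set" where
  "u_cube = {(x, z). (\<forall>j. x $ j \<in> {-1..1}) \<and> (\<forall>j. z $ j \<in> {-1..1})}"

definition v_box :: "real \<Rightarrow> real \<Rightarrow> real \<Rightarrow> ('n::finite, 'd::finite) vstate set" where
  "v_box C C' C'' =
    {(s, (sA, sW), (sAA, sWA, sWW)).
       (\<forall>k. s $ k \<in> {0..1}) \<and>
       (\<forall>\<alpha> k. \<bar>sA $ \<alpha> $ k\<bar> \<le> C' / (real CARD('d) * (4 - C))) \<and>
       (\<forall>\<alpha> k. \<bar>sW $ \<alpha> $ k\<bar> \<le> C' / (real CARD('n) * (4 - C))) \<and>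
       (\<forall>\<alpha> \<beta> k. \<bar>sAA $ \<alpha> $ \<beta> $ k\<bar> \<le> a_AA CARD('d) C C' C'' / (1 - C/4)) \<and>
       (\<forall>\<alpha> \<beta> k. \<bar>sWA $ \<alpha> $ \<beta> $ k\<bar> \<le> a_WA CARD('n) CARD('d) C C' / (1 - C/4)) \<and>
       (\<forall>\<alpha> \<beta> k. \<bar>sWW $ \<alpha> $ \<beta> $ k\<bar> \<le> a_WW CARD('n) C C' C'' / (1 - C/4))}"

definition state_space ::
  "real \<Rightarrow> real \<Rightarrow> real \<Rightarrow> ('n::finite, 'd::finite, 'z::finite) hstate set" where
  "state_space C C' C'' = u_cube \<times> v_box C C' C'' \<times> UNIV"

end

theory Submission
  imports Defs
begin

text \<open>
  On the compact box of (u,v)-states the kernel \<kappa>(u) x \<delta>_{F(u,v)} is a Wasserstein contraction with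
  factor q: an almost optimal coupling of the \<kappa>-parts costs L^2 times the squared distance, the
  deterministic parts add L_bar^2 times the squared distance.  The contraction passes from Dirac masses
  to arbitrary initial couplings by quantizing the coupling to finitely many points and taking a weak
  limit, so no measurable selection of couplings is needed.  Weak compactness in dimension n is reduced
  to Helly's theorem on the line by a space-filling curve with a measurable right inverse.  The
  iterates of the kernel have a weak limit point, which is stationary because consecutive iterates get
  close; the noise is independent of everything else and is coupled to itself.  Since the stationary law
  is fixed by the kernel, applying the contraction t times to one coupling with finite cost gives the
  rate, without the triangle inequality for the Wasserstein distance.
\<close>

text \<open>Banach's fixed point theorem in the Wasserstein space would ask for completeness of that
  distance and for its triangle inequality, hence for gluing of couplings. Compactness takes the
  place of completeness, but the noise coordinate ranges over the whole real line. It is therefore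
  split off: contraction and weak limits live on the (u,v)-box, and \<open>attach_noise\<close>
  restores the last coordinate without adding cost. Transport cost becomes weak information through
  (E X)^2 \<le> E X^2: by \<open>coupling_integral_diff\<close> it bounds the difference of the
  integrals of a Lipschitz function. This is why limits are identified by Lipschitz test functions.
  \<open>L_bar\<close> is a Lipschitz constant of the recursion on the box in the max-norm. It rests
  on the bounds 1/4, 1/10 and 1/8 for the first three derivatives of the sigmoid, and on the box
  radii, which bound the factors of the products in F.\<close>

section \<open>Weak sequential compactness on compact sets\<close>

text \<open>
  The clamped cosine has period 2, vanishes on the first third of [0,1] and equals 1 on the last one,
  so it reads off the digits of ternary expansions whose digits are all 0 or 2.
\<close>

definition bump :: "real \<Rightarrow> real" where
  "bump t = max 0 (min 1 (1/2 - cos (pi * t)))"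

lemma continuous_on_bump: "continuous_on UNIV bump"
  unfolding bump_def by (intro continuous_intros)

lemma bump_range: "0 \<le> bump t" "bump t \<le> 1"
  by (auto simp: bump_def)

lemma bump_periodic: "bump (2 * of_int n + t) = bump t"
proof -
  have "cos (pi * (2 * of_int n + t)) = cos (pi * t + 2 * of_int n * pi)"
    by (simp add: algebra_simps)
  also have "\<dots> = cos (pi * t)"
    unfolding cos_add using sin_int_2pin[of n] cos_int_2pin[of n]
    by (simp add: mult.commute mult.left_commute)
  finally show ?thesis by (simp add: bump_def)
qed

text \<open>The thirds come from the cosine: it equals 1/2 at pi/3 and -1/2 at 2 pi/3, which is
  where 1/2 - cos(pi t) passes the clamping levels 0 and 1.\<close>

lemma bump_eq_0: assumes "0 \<le> t" "t \<le> 1/3" shows "bump t = 0"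
proof -
  have "cos (pi/3) \<le> cos (pi * t)"
    using assms by (intro cos_monotone_0_pi_le) auto
  then show ?thesis by (auto simp: bump_def cos_60)
qed

lemma bump_eq_1: assumes "2/3 \<le> t" "t \<le> 1" shows "bump t = 1"
proof -
  have "cos (pi * t) \<le> cos (2 * pi / 3)"
    using assms by (intro cos_monotone_0_pi_le) auto
  then show ?thesis by (auto simp: bump_def cos_120)
qed

text \<open>For c with values 0 and 1 this is the point of the Cantor set with ternary digits
  \<open>2 * c i\<close>. The gap between the digits 0 and 2 is what lets a continuous function read
  them off.\<close>

definition ternary :: "(nat \<Rightarrow> real) \<Rightarrow> real" where
  "ternary c = (\<Sum>i. 2 * c i / 3 ^ Suc i)"

lemma summable_ternary:
  assumes "\<And>i. c i \<in> {0, 1::real}"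
  shows "summable (\<lambda>i. 2 * c i / 3 ^ Suc i)"
proof (rule summable_comparison_test')
  show "summable (\<lambda>i. 2 * (1/3::real) ^ Suc i)"
    by (intro summable_mult summable_Suc_iff[THEN iffD2] summable_geometric) auto
  show "norm (2 * c i / 3 ^ Suc i) \<le> 2 * (1/3) ^ Suc i" if "0 \<le> i" for i
    using assms[of i] by (auto simp: power_divide)
qed

lemma ternary_range:
  assumes "\<And>i. c i \<in> {0, 1::real}"
  shows "0 \<le> ternary c" "ternary c \<le> 1"
proof -
  show "0 \<le> ternary c"
    unfolding ternary_def using assms
    by (intro suminf_nonneg summable_ternary) (force simp: le_less)+
  have s: "(\<lambda>i. 2/3 * (1/3::real) ^ i) sums (2/3 * (1 / (1 - 1/3)))"
    by (intro sums_mult geometric_sums) auto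
  have "ternary c \<le> (\<Sum>i. 2/3 * (1/3::real) ^ i)"
    unfolding ternary_def
  proof (intro suminf_le summable_ternary assms)
    show "2 * c n / 3 ^ Suc n \<le> 2/3 * (1/3) ^ n" for n
      using assms[of n] by (auto simp: field_simps)
    show "summable (\<lambda>i. 2/3 * (1/3::real) ^ i)" using s by (rule sums_summable)
  qed
  also have "\<dots> = 1" using sums_unique[OF s] by simp
  finally show "ternary c \<le> 1" .
qed

text \<open>Multiplication by 3^j shifts the expansion. The digits before position j contribute an
  even integer, which the period 2 removes; the digits after it contribute r \<le> 1/3, so that 2
  c_j / 3 + r lies in the first or in the last third of the unit interval.\<close>

lemma bump_ternary:
  assumes c: "\<And>i. c i \<in> {0, 1::real}"
  shows "bump (3 ^ j * ternary c) = c j"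
proof -
  define r where "r = ternary (\<lambda>i. c (i + Suc j)) / 3"
  have r: "0 \<le> r" "r \<le> 1/3"
    using ternary_range[of "\<lambda>i. c (i + Suc j)"] c by (auto simp: r_def)
  \<comment> \<open>Half of the even integer formed by the first j digits.\<close>
  define n :: int where "n = (\<Sum>i<j. (if c i = 1 then 3 ^ (j - Suc i) else 0))"
  have sm: "summable (\<lambda>i. 2 * c i / 3 ^ Suc i)" by (intro summable_ternary c)
  have "ternary c = (\<Sum>i. 2 * c (i + Suc j) / 3 ^ Suc (i + Suc j)) + (\<Sum>i<Suc j. 2 * c i / 3 ^ Suc i)"
    unfolding ternary_def by (rule suminf_split_initial_segment[OF sm])
  also have "(\<Sum>i. 2 * c (i + Suc j) / 3 ^ Suc (i + Suc j)) = ternary (\<lambda>i. c (i + Suc j)) / 3 ^ Suc j"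
    unfolding ternary_def
    by (subst suminf_divide[OF summable_ternary[where c="\<lambda>i. c (i + Suc j)", OF c], symmetric])
       (simp add: power_add field_simps)
  finally have "3 ^ j * ternary c = r + (\<Sum>i<j. 3 ^ j * (2 * c i / 3 ^ Suc i)) + 2 * c j / 3"
    by (simp add: r_def field_simps sum_distrib_left)
  also have "(\<Sum>i<j. 3 ^ j * (2 * c i / 3 ^ Suc i)) = 2 * of_int n"
    unfolding n_def of_int_sum sum_distrib_left
  proof (intro sum.cong refl)
    fix i assume i: "i \<in> {..<j}"
    then have "(3::real) ^ j = 3 ^ (j - Suc i) * 3 ^ Suc i"
      by (subst power_add[symmetric]) auto
    then show "3 ^ j * (2 * c i / 3 ^ Suc i) = 2 * of_int (if c i = 1 then 3 ^ (j - Suc i) else 0)"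
      using c[of i] by auto
  qed
  finally have "bump (3 ^ j * ternary c) = bump (2 * of_int n + (2 * c j / 3 + r))"
    by (simp add: algebra_simps)
  also have "\<dots> = bump (2 * c j / 3 + r)" by (rule bump_periodic)
  also have "\<dots> = c j"
    using c[of j] r by (auto simp: bump_eq_0 bump_eq_1)
  finally show ?thesis .
qed

section \<open>Binary expansions with Borel measurable digits\<close>

definition bindigit :: "nat \<Rightarrow> real \<Rightarrow> real" where
  "bindigit k y = of_int (\<lfloor>2 ^ Suc k * y\<rfloor> - 2 * \<lfloor>2 ^ k * y\<rfloor>)"

lemma bindigit_01: "bindigit k y \<in> {0, 1}"
proof -
  have "\<lfloor>2 ^ Suc k * y\<rfloor> - 2 * \<lfloor>2 ^ k * y\<rfloor> = 0 \<or> \<lfloor>2 ^ Suc k * y\<rfloor> - 2 * \<lfloor>2 ^ k * y\<rfloor> = 1"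
    by (simp add: mult.assoc) linarith
  then show ?thesis unfolding bindigit_def by auto
qed

text \<open>The partial sums telescope to floor(2^n y) / 2^n, which is at most y and at least y -
  2^-n. The telescope starts at floor(y), which vanishes because y lies in [0,1).\<close>

lemma bindigit_sums:
  assumes "0 \<le> y" "y < 1"
  shows "(\<lambda>k. bindigit k y / 2 ^ Suc k) sums y"
proof -
  have "(\<Sum>k<n. bindigit k y / 2 ^ Suc k) = of_int \<lfloor>2 ^ n * y\<rfloor> / 2 ^ n" for n
  proof (induction n)
    case 0
    then show ?case using assms by (simp add: floor_eq_iff)
  next
    case (Suc n)
    then show ?case by (simp add: bindigit_def field_simps)
  qed
  moreover have "(\<lambda>n. of_int \<lfloor>2 ^ n * y\<rfloor> / 2 ^ n) \<longlonglongrightarrow> y"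
  proof (rule tendsto_sandwich)
    show "\<forall>\<^sub>F n in sequentially. y - (1/2) ^ n \<le> of_int \<lfloor>2 ^ n * y\<rfloor> / 2 ^ n"
    proof (intro always_eventually allI)
      fix n :: nat
      have "(2 ^ n * y - 1) / 2 ^ n \<le> of_int \<lfloor>2 ^ n * y\<rfloor> / 2 ^ n"
        by (intro divide_right_mono) (linarith, simp)
      then show "y - (1/2) ^ n \<le> of_int \<lfloor>2 ^ n * y\<rfloor> / 2 ^ n"
        by (simp add: diff_divide_distrib power_divide)
    qed
    show "\<forall>\<^sub>F n in sequentially. of_int \<lfloor>2 ^ n * y\<rfloor> / 2 ^ n \<le> y"
    proof (intro always_eventually allI)
      fix n :: nat
      have "of_int \<lfloor>2 ^ n * y\<rfloor> \<le> 2 ^ n * y" by linarith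
      then show "of_int \<lfloor>2 ^ n * y\<rfloor> / 2 ^ n \<le> y" by (simp add: field_simps)
    qed
    have "(\<lambda>n. y - (1/2) ^ n) \<longlonglongrightarrow> y - 0"
      by (intro tendsto_intros LIMSEQ_power_zero) auto
    then show "(\<lambda>n. y - (1/2) ^ n) \<longlonglongrightarrow> y" by simp
  qed simp
  ultimately show ?thesis unfolding sums_def by simp
qed

lemma measurable_bindigit [measurable]: "bindigit k \<in> borel_measurable borel"
  unfolding bindigit_def by measurable

text \<open>Schoenberg's space-filling curve in arbitrary dimension, with a measurable right inverse.\<close>

lemma space_filling_curve:
  fixes R :: real
  assumes "0 < R"
  obtains g :: "real \<Rightarrow> 'a::euclidean_space" and D :: "'a \<Rightarrow> real"
  where "continuous_on UNIV g" "D \<in> borel_measurable borel"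
    "\<And>x. D x \<in> {0..1}" "\<And>x. (\<And>b. b \<in> Basis \<Longrightarrow> \<bar>x \<bullet> b\<bar> < R) \<Longrightarrow> g (D x) = x"
proof -
  define ix where "ix = (\<lambda>b. to_nat_on (Basis::'a set) b)"
  \<comment> \<open>One digit sequence carries the binary digits of all coordinates, interleaved by
    the pairing function: digit k of coordinate b sits at position
    \<open>prod_encode (ix b, k)\<close>. The map \<open>g\<close> then rescales [0,1] to
    [-R,R].\<close>
  define co where "co = (\<lambda>t b. \<Sum>k. bump (3 ^ prod_encode (ix b, k) * t) / 2 ^ Suc k)"
  define g :: "real \<Rightarrow> 'a" where "g = (\<lambda>t. \<Sum>b\<in>Basis. (R * (2 * co t b - 1)) *\<^sub>R b)"
  define dg where "dg = (\<lambda>(x::'a) i. case prod_decode i of (n, k) \<Rightarrow>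
     bindigit k (((x \<bullet> from_nat_into Basis n) / R + 1) / 2))"
  define D where "D = (\<lambda>x. ternary (dg x))"
  have dg01: "dg x i \<in> {0,1}" for x i
    unfolding dg_def by (metis (mono_tags, lifting) bindigit_01 case_prod_beta)
  have "continuous_on UNIV (\<lambda>t. co t b)" for b
    unfolding co_def
  proof (rule uniform_limit_theorem[OF _ Weierstrass_m_test])
    show "\<forall>\<^sub>F n in sequentially. continuous_on UNIV
      (\<lambda>t. \<Sum>k<n. bump (3 ^ prod_encode (ix b, k) * t) / 2 ^ Suc k)"
      by (intro always_eventually allI continuous_intros continuous_on_compose2[OF continuous_on_bump]) auto
    show "norm (bump (3 ^ prod_encode (ix b, k) * t) / 2 ^ Suc k) \<le> (1/2) ^ Suc k" for k t
      using bump_range[of "3 ^ prod_encode (ix b, k) * t"] by (simp add: power_divide divide_right_mono)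
    show "summable (\<lambda>k. (1/2::real) ^ Suc k)"
      by (intro summable_Suc_iff[THEN iffD2] summable_geometric) auto
  qed simp
  then have "continuous_on UNIV g"
    unfolding g_def by (intro continuous_intros) auto
  moreover have "D \<in> borel_measurable borel"
  proof -
    have [measurable]: "(\<lambda>x. dg x i) \<in> borel_measurable borel" for i
      unfolding dg_def by (cases "prod_decode i") simp
    show ?thesis unfolding D_def ternary_def by measurable
  qed
  moreover have "D x \<in> {0..1}" for x
    unfolding D_def using ternary_range[of "dg x", OF dg01] by auto
  moreover have "g (D x) = x" if x: "\<And>b. b \<in> Basis \<Longrightarrow> \<bar>x \<bullet> b\<bar> < R" for x
  proof -
    have "co (D x) b = ((x \<bullet> b) / R + 1) / 2" if b: "b \<in> Basis" for b
    proof -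
      have "from_nat_into Basis (ix b) = b"
        unfolding ix_def using b by (simp add: countable_finite)
      then have "co (D x) b = (\<Sum>k. bindigit k (((x \<bullet> b) / R + 1) / 2) / 2 ^ Suc k)"
        unfolding co_def D_def bump_ternary[of "dg x", OF dg01] by (simp add: dg_def)
      \<comment> \<open>The strict bound R on the coordinates puts the rescaled coordinate into
        [0,1), as \<open>bindigit_sums\<close> demands.\<close>
      also have "\<dots> = ((x \<bullet> b) / R + 1) / 2"
        using x[OF b] assms
        by (intro sums_unique[symmetric] bindigit_sums) (auto simp: field_simps abs_less_iff)
      finally show ?thesis .
    qed
    then have "g (D x) = (\<Sum>b\<in>Basis. (x \<bullet> b) *\<^sub>R b)"
      unfolding g_def using assms by (intro sum.cong) (auto simp: field_simps)
    then show ?thesis by (simp add: euclidean_representation)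
  qed
  ultimately show ?thesis using that by blast
qed

text \<open>Only the curve has to be continuous: weak convergence on the line is tested with f
  composed with g, and the merely measurable \<open>D\<close> enters through
  \<open>g (D x) = x\<close> on S alone.\<close>

lemma compact_prob_weak_subsequence:
  fixes M :: "nat \<Rightarrow> 'a::euclidean_space measure"
  assumes S: "compact S" and M: "\<And>n. M n \<in> space (prob_algebra borel)"
    and ae: "\<And>n. AE x in M n. x \<in> S"
  obtains r L where "strict_mono r" "L \<in> space (prob_algebra borel)" "AE x in L. x \<in> S"
    "\<And>f :: 'a \<Rightarrow> real. continuous_on S f \<Longrightarrow> f \<in> borel_measurable borel \<Longrightarrow>
        (\<lambda>n. \<integral>x. f x \<partial>M (r n)) \<longlonglongrightarrow> (\<integral>x. f x \<partial>L)"
proof -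
  obtain R where R: "0 < R" "\<And>x. x \<in> S \<Longrightarrow> norm x < R"
    using compact_imp_bounded[OF S] bounded_pos_less by metis
  obtain g :: "real \<Rightarrow> 'a" and D where g: "continuous_on UNIV g" and D[measurable]: "D \<in> borel_measurable borel"
    and D01: "\<And>x. D x \<in> {0..1}" and gD: "\<And>x. (\<And>b. b \<in> Basis \<Longrightarrow> \<bar>x \<bullet> b\<bar> < R) \<Longrightarrow> g (D x) = x"
    using space_filling_curve[OF R(1), where 'a='a] by metis
  have gDS: "g (D x) = x" if "x \<in> S" for x
    using R(2)[OF that] by (intro gD) (meson Basis_le_norm le_less_trans)
  have [measurable]: "g \<in> borel_measurable borel"
    using g by (rule borel_measurable_continuous_onI)
  have sets_M [measurable_cong]: "sets (M n) = sets borel" for n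
    using M[of n] by (simp add: space_prob_algebra)
  have prob_M: "prob_space (M n)" for n
    using M[of n] by (simp add: space_prob_algebra)
  define N where "N = (\<lambda>n. distr (M n) borel D)"
  have N: "real_distribution (N n)" for n
    unfolding N_def real_distribution_def real_distribution_axioms_def
    using prob_space.prob_space_distr[OF prob_M[of n], of D borel] by simp
  have "tight N"
    unfolding tight_def
  proof (intro conjI allI impI)
    show "real_distribution (N n)" for n by (rule N)
    fix \<epsilon> :: real assume e: "0 < \<epsilon>"
    \<comment> \<open>All laws live on [0,1], so one interval serves for tightness. It is open on
      the left and has to start below 0.\<close>
    have "measure (N n) {- 1<..1} = 1" for n
    proof -
      interpret prob_space "M n" by (rule prob_M)
      have "D -` {- 1<..1} \<inter> space (M n) = space (M n)"
        using D01 by force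
      then show ?thesis unfolding N_def by (simp add: measure_distr prob_space)
    qed
    then show "\<exists>a b. a < b \<and> (\<forall>n. 1 - \<epsilon> < measure (N n) {a<..b})"
      using e by (intro exI[of _ "-1"] exI[of _ 1]) auto
  qed
  from tight_imp_convergent_subsubsequence[OF this strict_mono_id]
  obtain r L' where r: "strict_mono r" and L': "real_distribution L'" and conv: "weak_conv_m (N \<circ> r) L'"
    by (auto simp: comp_def)
  interpret L': real_distribution L' by (rule L')
  define L where "L = distr L' borel g"
  have L: "L \<in> space (prob_algebra borel)"
    unfolding L_def space_prob_algebra by (auto intro!: L'.prob_space_distr)
  have lim: "(\<lambda>n. \<integral>x. f x \<partial>M (r n)) \<longlonglongrightarrow> (\<integral>x. f x \<partial>L)"
    if f: "continuous_on UNIV f" and B: "\<And>x. \<bar>f x\<bar> \<le> B" for f :: "'a \<Rightarrow> real" and B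
  proof -
    have [measurable]: "f \<in> borel_measurable borel" using f by (rule borel_measurable_continuous_onI)
    have c: "continuous_on UNIV (\<lambda>x. f (g x))"
      by (rule continuous_on_compose2[OF f g]) auto
    have "(\<lambda>n. \<integral>x. f (g x) \<partial>(N \<circ> r) n) \<longlonglongrightarrow> (\<integral>x. f (g x) \<partial>L')"
      using c B N L' conv
      by (intro weak_conv_imp_integral_bdd_continuous_conv[where B=B])
         (auto simp: continuous_on_eq_continuous_at comp_def)
    moreover have "(\<integral>x. f (g x) \<partial>(N \<circ> r) n) = (\<integral>x. f x \<partial>M (r n))" for n
    proof -
      have "(\<integral>x. f (g x) \<partial>(N \<circ> r) n) = (\<integral>x. f (g (D x)) \<partial>M (r n))"
        unfolding N_def by (simp add: integral_distr)
      also have "\<dots> = (\<integral>x. f x \<partial>M (r n))"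
        using ae[of "r n"] by (intro integral_cong_AE) (auto simp: gDS)
      finally show ?thesis .
    qed
    moreover have "(\<integral>x. f (g x) \<partial>L') = (\<integral>x. f x \<partial>L)"
      unfolding L_def by (simp add: integral_distr)
    ultimately show ?thesis by simp
  qed
  have pL: "prob_space L" using L by (simp add: space_prob_algebra)
  interpret L: prob_space L by (rule pL)
  have sL [measurable_cong]: "sets L = sets borel" by (simp add: L_def)
  have aeL: "AE x in L. x \<in> S"
  proof (cases "S = {}")
    case True
    then have "False" using ae[of 0] prob_space.AE_False[OF prob_M[of 0]] by simp
    then show ?thesis ..
  next
    case False
    \<comment> \<open>A bounded continuous function vanishing exactly on the closed set S. The empty
      set is treated apart because \<open>infdist\<close> to it is 0 by convention.\<close>
    define f where "f = (\<lambda>x. min 1 (infdist x S))"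
    have cf: "continuous_on UNIV f" unfolding f_def by (intro continuous_intros)
    have [measurable]: "f \<in> borel_measurable borel" using cf by (rule borel_measurable_continuous_onI)
    have f0: "f x \<ge> 0" "f x \<le> 1" for x by (auto simp: f_def infdist_nonneg)
    have fS: "f x = 0" if "x \<in> S" for x using that by (simp add: f_def)
    have "(\<integral>x. f x \<partial>M (r n)) = 0" for n
    proof -
      have "(\<integral>x. f x \<partial>M (r n)) = (\<integral>x. 0 \<partial>M (r n))"
        using ae[of "r n"] fS by (intro integral_cong_AE) (auto elim!: AE_mp)
      then show ?thesis by simp
    qed
    moreover have "(\<lambda>n. \<integral>x. f x \<partial>M (r n)) \<longlonglongrightarrow> (\<integral>x. f x \<partial>L)"
      using cf f0 by (intro lim[of f 1]) auto
    ultimately have "(\<integral>x. f x \<partial>L) = 0"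
      by (simp add: LIMSEQ_const_iff)
    moreover have "integrable L f"
      using f0 by (intro L.integrable_const_bound[of _ 1]) auto
    ultimately have "AE x in L. f x = 0"
      using f0 by (subst integral_nonneg_eq_0_iff_AE[symmetric]) auto
    then show ?thesis
      by eventually_elim (use False compact_imp_closed[OF S] in \<open>auto simp: f_def min_def in_closed_iff_infdist_zero split: if_splits\<close>)
  qed
  have "(\<lambda>n. \<integral>x. f x \<partial>M (r n)) \<longlonglongrightarrow> (\<integral>x. f x \<partial>L)"
    if f: "continuous_on S f" and [measurable]: "f \<in> borel_measurable borel" for f :: "'a \<Rightarrow> real"
  proof -
    obtain B where B: "0 \<le> B" "\<And>x. x \<in> S \<Longrightarrow> norm (f x) \<le> B"
      by (rule continuous_on_compact_bound[OF S f]) blast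
    \<comment> \<open>All the measures and their limit are carried by S, so f may be exchanged for a
      bounded continuous extension.\<close>
    obtain h where h: "continuous_on UNIV h" "\<And>x. x \<in> S \<Longrightarrow> h x = f x" "\<And>x. norm (h x) \<le> B"
      using Tietze[OF f _ B(1), of UNIV] B(2) compact_imp_closed[OF S] by auto
    have [measurable]: "h \<in> borel_measurable borel" using h(1) by (rule borel_measurable_continuous_onI)
    have "(\<lambda>n. \<integral>x. h x \<partial>M (r n)) \<longlonglongrightarrow> (\<integral>x. h x \<partial>L)"
      using h(3) by (intro lim[of h B] h(1)) auto
    moreover have "(\<integral>x. h x \<partial>M (r n)) = (\<integral>x. f x \<partial>M (r n))" for n
      using ae[of "r n"] h(2) by (intro integral_cong_AE) (auto elim!: AE_mp)
    moreover have "(\<integral>x. h x \<partial>L) = (\<integral>x. f x \<partial>L)"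
      using aeL h(2) by (intro integral_cong_AE) (auto elim!: AE_mp)
    ultimately show ?thesis by simp
  qed
  with that r L aeL show ?thesis by blast
qed

section \<open>Borel probability measures, couplings and transport cost\<close>

abbreviation borel_prob :: "'a::topological_space measure set" where
  "borel_prob \<equiv> space (prob_algebra borel)"

lemma borel_probD:
  assumes "M \<in> borel_prob"
  shows "prob_space M" "sets M = sets borel"
  using assms by (auto simp: space_prob_algebra)

lemma borel_prob_distr:
  assumes "M \<in> borel_prob" "f \<in> borel_measurable borel"
  shows "distr M borel f \<in> borel_prob"
  using assms
  by (auto simp: space_prob_algebra intro!: prob_space.prob_space_distr cong: measurable_cong_sets)

lemma borel_prob_bind:
  assumes "M \<in> borel_prob" "K \<in> borel \<rightarrow>\<^sub>M prob_algebra borel"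
  shows "M \<bind> K \<in> borel_prob"
  using prob_space_bind'[OF assms] sets_bind'[OF assms] by (simp add: space_prob_algebra)

lemma AE_borel_prob_bind:
  assumes "M \<in> borel_prob" "K \<in> borel \<rightarrow>\<^sub>M prob_algebra borel" "Measurable.pred borel P"
  shows "(AE x in M \<bind> K. P x) \<longleftrightarrow> (AE x in M. AE y in K x. P y)"
  using assms borel_probD[OF assms(1)]
  by (intro AE_bind[where B=borel] measurable_prob_algebraD) (auto cong: measurable_cong_sets)

lemma nn_integral_borel_prob_bind:
  assumes "M \<in> borel_prob" "K \<in> borel \<rightarrow>\<^sub>M prob_algebra borel" "f \<in> borel_measurable borel"
  shows "(\<integral>\<^sup>+x. f x \<partial>(M \<bind> K)) = (\<integral>\<^sup>+x. \<integral>\<^sup>+y. f y \<partial>K x \<partial>M)"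
  using assms borel_probD[OF assms(1)]
  by (intro nn_integral_bind[where B=borel] measurable_prob_algebraD) (auto cong: measurable_cong_sets)

lemma integral_borel_prob_bind:
  fixes f :: "'a::topological_space \<Rightarrow> real"
  assumes "M \<in> borel_prob" "K \<in> borel \<rightarrow>\<^sub>M prob_algebra borel" "f \<in> borel_measurable borel"
    and "\<And>x. \<bar>f x\<bar> \<le> B"
  shows "(\<integral>x. f x \<partial>(M \<bind> K)) = (\<integral>x. \<integral>y. f y \<partial>K x \<partial>M)"
proof (rule integral_bind[where K=borel and B=B and B'=1])
  note M = borel_probD[OF assms(1)]
  have K: "K x \<in> borel_prob" for x
    using measurable_space[OF assms(2), of x] by simp
  show "K \<in> M \<rightarrow>\<^sub>M subprob_algebra borel"
    using measurable_prob_algebraD[OF assms(2)] M by (auto cong: measurable_cong_sets)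
  show "finite_measure M" using M(1) by (simp add: prob_space_def)
  show "AE x in M. emeasure (K x) (space (K x)) \<le> ennreal 1"
    using prob_space.emeasure_space_1[OF borel_probD(1)[OF K]] by simp
qed (use assms in auto)

lemma measurable_integral_kernel:
  fixes f :: "'a::topological_space \<Rightarrow> real"
  assumes "K \<in> M \<rightarrow>\<^sub>M prob_algebra borel" "f \<in> borel_measurable borel"
  shows "(\<lambda>x. \<integral>y. f y \<partial>K x) \<in> borel_measurable M"
  using measurable_compose[OF measurable_prob_algebraD[OF assms(1)] integral_measurable_subprob_algebra[OF assms(2)]] .

lemma distr_borel_prob_bind:
  assumes "M \<in> borel_prob" "K \<in> borel \<rightarrow>\<^sub>M prob_algebra borel" "f \<in> borel_measurable borel"
  shows "distr (M \<bind> K) borel f = M \<bind> (\<lambda>x. distr (K x) borel f)"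
  using assms borel_probD[OF assms(1)] prob_space.not_empty
  by (intro distr_bind[where K=borel] measurable_prob_algebraD) (auto cong: measurable_cong_sets)

lemma bind_distr_borel_prob:
  assumes "M \<in> borel_prob" "K \<in> borel \<rightarrow>\<^sub>M prob_algebra borel" "f \<in> borel_measurable borel"
  shows "distr M borel f \<bind> K = M \<bind> (\<lambda>x. K (f x))"
  using assms borel_probD[OF assms(1)] prob_space.not_empty
  by (intro bind_distr[where K=borel] measurable_prob_algebraD) (auto cong: measurable_cong_sets)

text \<open>The indicator of a nonempty closed set C is the pointwise limit of the Lipschitz
  functions max 0 (1 - n dist(x,C)), and the closed sets form an intersection-stable generator.
  Lipschitz test functions are the ones whose integrals transport cost controls.\<close>

lemma borel_prob_eqI_lipschitz:
  fixes M N :: "'a::euclidean_space measure"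
  assumes M: "M \<in> borel_prob" and N: "N \<in> borel_prob"
    and eq: "\<And>(f :: 'a \<Rightarrow> real) L. L-lipschitz_on UNIV f \<Longrightarrow> (\<And>x. 0 \<le> f x \<and> f x \<le> 1) \<Longrightarrow>
      (\<integral>x. f x \<partial>M) = (\<integral>x. f x \<partial>N)"
  shows "M = N"
proof -
  note [measurable_cong] = borel_probD(2)[OF M] borel_probD(2)[OF N]
  interpret M: prob_space M by (rule borel_probD[OF M])
  interpret N: prob_space N by (rule borel_probD[OF N])
  have closed: "measure M C = measure N C" if C: "closed C" for C
  proof (cases "C = {}")
    case False
    define f where "f = (\<lambda>n x. max 0 (1 - real n * infdist x C))"
    have fl: "(real n)-lipschitz_on UNIV (f n)" for n
    proof (rule lipschitz_onI)
      fix x y :: 'a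
      have "\<bar>real n * infdist x C - real n * infdist y C\<bar> \<le> real n * dist x y"
        unfolding right_diff_distrib[symmetric] abs_mult
        using infdist_triangle_abs[of x C y] by (intro mult_mono) auto
      then show "dist (f n x) (f n y) \<le> real n * dist x y"
        unfolding f_def dist_real_def by linarith
    qed simp
    have f01: "0 \<le> f n x \<and> f n x \<le> 1" for n x
      by (auto simp: f_def infdist_nonneg)
    have meas: "f n \<in> borel_measurable borel" for n
      using lipschitz_on_continuous_on[OF fl] by (rule borel_measurable_continuous_onI)
    have lim: "(\<lambda>n. f n x) \<longlonglongrightarrow> indicator C x" for x
    proof (cases "x \<in> C")
      case True
      then show ?thesis by (simp add: f_def)
    next
      case x: False
      then have "infdist x C \<noteq> 0" using C False in_closed_iff_infdist_zero by blast
      then have pos: "infdist x C > 0" using infdist_nonneg[of x C] by linarith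
      obtain n0 :: nat where "1 / infdist x C \<le> real n0" using real_arch_simple by blast
      then have n0: "1 \<le> real n0 * infdist x C" using pos by (simp add: field_simps)
      have "f n x = 0" if "n \<ge> n0" for n
      proof -
        have "real n0 * infdist x C \<le> real n * infdist x C"
          using pos that by (intro mult_right_mono) auto
        then show ?thesis unfolding f_def using n0 by linarith
      qed
      then show ?thesis using x by (intro tendsto_eventually eventually_sequentiallyI[of n0]) auto
    qed
    have C': "C \<in> sets borel" using C by simp
    have conv: "(\<lambda>n. \<integral>x. f n x \<partial>Q) \<longlonglongrightarrow> measure Q C" if Q: "Q \<in> borel_prob" for Q :: "'a measure"
    proof -
      interpret Q: prob_space Q by (rule borel_probD[OF Q])
      note [measurable_cong] = borel_probD(2)[OF Q]
      have "(\<lambda>n. \<integral>x. f n x \<partial>Q) \<longlonglongrightarrow> (\<integral>x. indicator C x \<partial>Q)"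
        using lim f01 meas C'
        by (intro integral_dominated_convergence[where w="\<lambda>_. 1"]) (auto intro!: AE_I2)
      then show ?thesis using C' borel_probD(2)[OF Q] by simp
    qed
    have "(\<lambda>n. \<integral>x. f n x \<partial>M) = (\<lambda>n. \<integral>x. f n x \<partial>N)"
      using eq[OF fl f01] by simp
    then show ?thesis using LIMSEQ_unique[OF conv[OF M]] conv[OF N] by simp
  qed simp
  show ?thesis
  proof (rule measure_eqI_generator_eq[where E="Collect closed" and \<Omega>=UNIV and A="\<lambda>_. UNIV"])
    show "Int_stable (Collect (closed :: 'a set \<Rightarrow> bool))" by (auto simp: Int_stable_def)
    show "sets M = sigma_sets UNIV (Collect closed)" "sets N = sigma_sets UNIV (Collect closed)"
      using borel_probD(2)[OF M] borel_probD(2)[OF N] by (simp_all add: borel_eq_closed)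
    show "emeasure M X = emeasure N X" if "X \<in> Collect closed" for X
      using closed that by (simp add: M.emeasure_eq_measure N.emeasure_eq_measure)
  qed auto
qed

section \<open>Quadratic transport cost and its control of integrals\<close>

definition transport_cost :: "('a::euclidean_space \<times> 'a) measure \<Rightarrow> ennreal" where
  "transport_cost \<gamma> = (\<integral>\<^sup>+ (x, y). ennreal ((infnorm (x - y))\<^sup>2) \<partial>\<gamma>)"

lemma Wass2_eq: "Wass2 M N = ennreal_sqrt (INF \<gamma>\<in>couplings M N. transport_cost \<gamma>)"
  by (simp add: Wass2_def transport_cost_def)

lemma ennreal_sqrt_le_iff:
  assumes "0 \<le> a"
  shows "ennreal_sqrt c \<le> ennreal a \<longleftrightarrow> c \<le> ennreal (a\<^sup>2)"
proof (cases c)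
  case (real r)
  then show ?thesis
    using assms real_sqrt_le_iff[of r "a\<^sup>2"]
    by (auto simp: ennreal_sqrt_def ennreal_le_iff)
qed (use assms in \<open>auto simp: ennreal_sqrt_def top_unique\<close>)

lemma Wass2_leI:
  assumes "\<gamma> \<in> couplings M N" "transport_cost \<gamma> \<le> ennreal (a\<^sup>2)" "0 \<le> a"
  shows "Wass2 M N \<le> ennreal a"
  unfolding Wass2_eq ennreal_sqrt_le_iff[OF assms(3)]
  using assms by (intro INF_lower2) auto

text \<open>The slack e stands in for an optimal coupling, since a coupling with cost below any
  number above the infimum exists by definition.\<close>

lemma Wass2_le_coupling:
  assumes "Wass2 M N \<le> ennreal a" "0 \<le> a" "0 < e"
  obtains \<gamma> where "\<gamma> \<in> couplings M N" "transport_cost \<gamma> \<le> ennreal (a\<^sup>2 + e)"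
proof -
  have "(INF \<gamma>\<in>couplings M N. transport_cost \<gamma>) \<le> ennreal (a\<^sup>2)"
    using assms(1) unfolding Wass2_eq ennreal_sqrt_le_iff[OF assms(2)] .
  also have "\<dots> < ennreal (a\<^sup>2 + e)" using assms by (intro ennreal_lessI add_nonneg_pos) auto
  finally show ?thesis using that by (auto simp: INF_less_iff intro: less_imp_le)
qed

text \<open>In second countable spaces the product of the Borel sigma-algebras is the Borel
  sigma-algebra of the product, and a marginal of total mass 1 forces the coupling to have mass
  1.\<close>

lemma couplings_iff:
  fixes M :: "'a::second_countable_topology measure" and N :: "'b::second_countable_topology measure"
  assumes "M \<in> borel_prob" "N \<in> borel_prob"
  shows "\<gamma> \<in> couplings M N \<longleftrightarrow> \<gamma> \<in> borel_prob \<and> distr \<gamma> borel fst = M \<and> distr \<gamma> borel snd = N"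
proof -
  note s = borel_probD(2)[OF assms(1)] borel_probD(2)[OF assms(2)]
  have "sets (M \<Otimes>\<^sub>M N) = sets borel"
    using sets_pair_measure_cong[OF s] unfolding borel_prod .
  moreover have "distr \<gamma> M fst = distr \<gamma> borel fst" "distr \<gamma> N snd = distr \<gamma> borel snd"
    using s by (auto intro!: distr_cong)
  moreover have "prob_space \<gamma>" if "sets \<gamma> = sets borel" "distr \<gamma> borel fst = M"
  proof (rule prob_space_distrD)
    show "prob_space (distr \<gamma> borel fst)" using that borel_probD(1)[OF assms(1)] by simp
    show "fst \<in> \<gamma> \<rightarrow>\<^sub>M borel"
      using that(1) by (subst measurable_cong_sets[OF that(1) refl]) (auto simp: borel_prod[symmetric])
  qed
  ultimately show ?thesis
    unfolding couplings_def by (auto simp: space_prob_algebra)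
qed

lemma measurable_fst_snd_borel [measurable]:
  "fst \<in> borel_measurable (borel :: ('a::second_countable_topology \<times> 'b::second_countable_topology) measure)"
  "snd \<in> borel_measurable (borel :: ('a::second_countable_topology \<times> 'b::second_countable_topology) measure)"
  by (auto simp: borel_prod[symmetric])

lemma measurable_Pair_borel:
  fixes f :: "_ \<Rightarrow> 'a::second_countable_topology" and g :: "_ \<Rightarrow> 'b::second_countable_topology"
  assumes "f \<in> borel_measurable M" "g \<in> borel_measurable M"
  shows "(\<lambda>x. (f x, g x)) \<in> borel_measurable M"
  using assms unfolding borel_prod[symmetric] by simp

lemma continuous_cost: "continuous_on S (\<lambda>z. (infnorm (fst z - snd z))\<^sup>2)"
  by (intro continuous_intros)

lemma measurable_cost [measurable]: "(\<lambda>z. infnorm (fst z - snd z)) \<in> borel_measurable borel"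
  by (intro borel_measurable_continuous_onI continuous_intros)

lemma transport_cost_eq: "transport_cost \<gamma> = (\<integral>\<^sup>+ z. ennreal ((infnorm (fst z - snd z))\<^sup>2) \<partial>\<gamma>)"
  unfolding transport_cost_def by (intro nn_integral_cong) auto

text \<open>Under the coupling the difference is the mean of X = f(fst) - f(snd). Nonnegativity of
  the variance gives (E X)^2 \<le> E X^2, and X^2 is at most \<Lambda>^2 times the integrand of the
  cost.\<close>

lemma coupling_integral_diff:
  fixes M N :: "'a::euclidean_space measure" and f :: "'a \<Rightarrow> real"
  assumes M: "M \<in> borel_prob" and N: "N \<in> borel_prob" and g: "\<gamma> \<in> couplings M N"
    and f[measurable]: "f \<in> borel_measurable borel" and B: "\<And>x. \<bar>f x\<bar> \<le> B"
    and L: "\<And>x y. \<bar>f x - f y\<bar> \<le> \<Lambda> * infnorm (x - y)"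
    and r: "transport_cost \<gamma> \<le> ennreal r" "0 \<le> r"
  shows "((\<integral>x. f x \<partial>M) - (\<integral>x. f x \<partial>N))\<^sup>2 \<le> \<Lambda>\<^sup>2 * r"
proof -
  have g': "\<gamma> \<in> borel_prob" "distr \<gamma> borel fst = M" "distr \<gamma> borel snd = N"
    using g couplings_iff[OF M N] by auto
  interpret prob_space \<gamma> by (rule borel_probD[OF g'(1)])
  note [measurable_cong] = borel_probD(2)[OF g'(1)]
  define X where "X = (\<lambda>z. f (fst z) - f (snd z))"
  have [measurable]: "X \<in> borel_measurable \<gamma>" unfolding X_def by measurable
  have Bb: "\<bar>X z\<bar> \<le> 2 * B" for z
    unfolding X_def using B[of "fst z"] B[of "snd z"] by linarith
  have iX: "integrable \<gamma> X" by (rule integrable_const_bound[of _ "2 * B"]) (auto simp: Bb)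
  have iX2: "integrable \<gamma> (\<lambda>z. (X z)\<^sup>2)"
  proof (rule integrable_const_bound[of _ "(2 * B)\<^sup>2"])
    show "AE x in \<gamma>. norm ((X x)\<^sup>2) \<le> (2 * B)\<^sup>2"
      using power_mono[OF Bb, where n=2] by auto
  qed simp
  have "(\<integral>x. f x \<partial>M) = (\<integral>z. f (fst z) \<partial>\<gamma>)" "(\<integral>x. f x \<partial>N) = (\<integral>z. f (snd z) \<partial>\<gamma>)"
    unfolding g'(2,3)[symmetric] by (subst integral_distr; simp)+
  moreover have "integrable \<gamma> (\<lambda>z. f (fst z))" "integrable \<gamma> (\<lambda>z. f (snd z))"
    by (rule integrable_const_bound[of _ B]; simp add: B)+
  ultimately have "(\<integral>x. f x \<partial>M) - (\<integral>x. f x \<partial>N) = expectation X"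
    unfolding X_def by simp
  then have "((\<integral>x. f x \<partial>M) - (\<integral>x. f x \<partial>N))\<^sup>2 \<le> expectation (\<lambda>z. (X z)\<^sup>2)"
    using variance_positive[of X] variance_eq[OF iX iX2] by simp
  also have "\<dots> \<le> \<Lambda>\<^sup>2 * r"
  proof -
    have "ennreal (expectation (\<lambda>z. (X z)\<^sup>2)) = (\<integral>\<^sup>+ z. ennreal ((X z)\<^sup>2) \<partial>\<gamma>)"
      by (rule nn_integral_eq_integral[symmetric, OF iX2]) simp
    also have "\<dots> \<le> (\<integral>\<^sup>+ z. ennreal (\<Lambda>\<^sup>2) * ennreal ((infnorm (fst z - snd z))\<^sup>2) \<partial>\<gamma>)"
    proof (intro nn_integral_mono)
      fix z
      have "(X z)\<^sup>2 \<le> (\<Lambda> * infnorm (fst z - snd z))\<^sup>2"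
        unfolding X_def using L[of "fst z" "snd z"] power_mono[of "\<bar>f (fst z) - f (snd z)\<bar>" _ 2] by simp
      then show "ennreal ((X z)\<^sup>2) \<le> ennreal (\<Lambda>\<^sup>2) * ennreal ((infnorm (fst z - snd z))\<^sup>2)"
        by (simp add: ennreal_mult[symmetric] power_mult_distrib)
    qed
    also have "\<dots> = ennreal (\<Lambda>\<^sup>2) * transport_cost \<gamma>"
      unfolding transport_cost_eq by (intro nn_integral_cmult) measurable
    also have "\<dots> \<le> ennreal (\<Lambda>\<^sup>2) * ennreal r" by (intro mult_left_mono r) simp
    also have "\<dots> = ennreal (\<Lambda>\<^sup>2 * r)" using r(2) by (simp add: ennreal_mult)
    finally show ?thesis using r(2) by (simp add: ennreal_le_iff)
  qed
  finally show ?thesis .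
qed

text \<open>Test functions are Lipschitz for the Euclidean norm while the cost is measured in the
  max-norm; the square root of the dimension converts between them.\<close>

lemma lipschitz_infnorm:
  fixes f :: "'a::euclidean_space \<Rightarrow> real"
  assumes "L-lipschitz_on UNIV f"
  shows "\<bar>f x - f y\<bar> \<le> (L * sqrt DIM('a)) * infnorm (x - y)"
proof -
  have "\<bar>f x - f y\<bar> \<le> L * norm (x - y)"
    using lipschitz_onD[OF assms, of x y] by (simp add: dist_norm)
  also have "\<dots> \<le> L * (sqrt DIM('a) * infnorm (x - y))"
    using norm_le_infnorm[of "x - y"] lipschitz_on_nonneg[OF assms] by (intro mult_left_mono) auto
  finally show ?thesis by simp
qed

text \<open>The map sends each point to the centre of a ball of a finite e-net that contains it; the
  induction lets each added ball override the earlier choices. The codomain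
  \<open>count_space A\<close> matters: every function of \<open>r z\<close>, even one obtained by
  choice, is then measurable.\<close>

lemma finite_quantizer:
  fixes T :: "'a::{metric_space,second_countable_topology} set"
  assumes T: "compact T" "T \<noteq> {}" and e: "0 < e"
  obtains r A where "finite A" "A \<subseteq> T" "r \<in> borel \<rightarrow>\<^sub>M count_space A" "\<And>z. z \<in> T \<Longrightarrow> dist z (r z) < e"
proof -
  obtain A where A: "A \<subseteq> T" "finite A" "T \<subseteq> (\<Union>x\<in>A. ball x e)"
    using compactE_image[OF T(1), of T "\<lambda>x. ball x e"] e by force
  have "\<exists>r. (\<forall>z. r z \<in> A) \<and> r \<in> borel \<rightarrow>\<^sub>M count_space UNIV \<and> (\<forall>z\<in>(\<Union>x\<in>A. ball x e). dist z (r z) < e)"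
    if "finite A" "A \<noteq> {}" for A :: "'a set"
    using that
  proof (induction rule: finite_ne_induct)
    case (singleton x)
    then show ?case by (intro exI[of _ "\<lambda>_. x"]) (auto simp: dist_commute)
  next
    case (insert x A)
    then obtain r where r: "\<forall>z. r z \<in> A" "r \<in> borel \<rightarrow>\<^sub>M count_space UNIV"
      "\<forall>z\<in>(\<Union>x\<in>A. ball x e). dist z (r z) < e" by auto
    note [measurable] = r(2)
    have "(\<lambda>z. if dist x z < e then x else r z) \<in> borel \<rightarrow>\<^sub>M count_space UNIV"
      by measurable
    with r show ?case
      by (intro exI[of _ "\<lambda>z. if dist x z < e then x else r z"]) (auto simp: dist_commute)
  qed
  moreover have "A \<noteq> {}" using A T by auto
  ultimately obtain r where r: "\<forall>z. r z \<in> A" "r \<in> borel \<rightarrow>\<^sub>M count_space UNIV"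
    "\<forall>z\<in>(\<Union>x\<in>A. ball x e). dist z (r z) < e" using A(2) by metis
  have "r \<in> borel \<rightarrow>\<^sub>M count_space A"
    using r(1) measurable_sets[OF r(2)]
    by (subst measurable_count_space_eq2[OF A(2)]) auto
  with that[OF A(2,1)] r A(3) show ?thesis by blast
qed

section \<open>Contractive kernels act on couplings\<close>

lemma AE_coupling_Times:
  fixes M N :: "'a::second_countable_topology measure"
  assumes M: "M \<in> borel_prob" and N: "N \<in> borel_prob" and g: "\<gamma> \<in> couplings M N"
    and "AE x in M. x \<in> S" "AE x in N. x \<in> S" and S: "S \<in> sets borel"
  shows "AE z in \<gamma>. z \<in> S \<times> S"
proof -
  have g': "\<gamma> \<in> borel_prob" "distr \<gamma> borel fst = M" "distr \<gamma> borel snd = N"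
    using g couplings_iff[OF M N] by auto
  note [measurable_cong] = borel_probD(2)[OF g'(1)]
  have "AE z in \<gamma>. fst z \<in> S" "AE z in \<gamma>. snd z \<in> S"
    using assms(4,5) S unfolding g'(2,3)[symmetric] by (auto simp: AE_distr_iff)
  then show ?thesis by eventually_elim auto
qed

lemma field_le_mult_epsilon:
  fixes x y c :: real
  assumes "0 \<le> c" "\<And>e. 0 < e \<Longrightarrow> x \<le> y + c * e"
  shows "x \<le> y"
proof (rule field_le_epsilon)
  fix d :: real assume d: "0 < d"
  \<comment> \<open>Division by c + 1 because c may be 0.\<close>
  have "x \<le> y + c * (d / (c + 1))" using assms d by (intro assms(2)) auto
  also have "c * (d / (c + 1)) \<le> d" using assms(1) d by (simp add: field_simps)
  finally show "x \<le> y + d" by simp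
qed

text \<open>Invariance and contraction are local to the compact set. A single step makes sense for
  every factor q; the bound q < 1 first enters when a stationary law is constructed.\<close>

locale wass_contraction =
  fixes K :: "'a::euclidean_space \<Rightarrow> 'a measure" and S :: "'a set" and q :: real
  assumes kernel: "K \<in> borel \<rightarrow>\<^sub>M prob_algebra borel"
    and compact: "compact S"
    and invariant: "w \<in> S \<Longrightarrow> AE x in K w. x \<in> S"
    and q_nonneg: "0 \<le> q"
    and contraction: "w \<in> S \<Longrightarrow> w' \<in> S \<Longrightarrow> Wass2 (K w) (K w') \<le> ennreal (q * infnorm (w - w'))"
begin

lemma kernel_prob: "K w \<in> borel_prob"
  using measurable_space[OF kernel, of w] by simp

lemma S_borel: "S \<in> sets borel"
  using compact by (simp add: compact_imp_closed)

lemma AE_bind_S: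
  assumes M: "M \<in> borel_prob" and ae: "AE x in M. x \<in> S"
  shows "AE x in M \<bind> K. x \<in> S"
  using ae S_borel invariant by (subst AE_borel_prob_bind[OF M kernel]) (auto elim!: AE_mp)

lemma near_optimal_coupling:
  assumes "w \<in> S" "w' \<in> S" "0 < e"
  obtains \<pi> where "\<pi> \<in> couplings (K w) (K w')"
    "transport_cost \<pi> \<le> ennreal (q\<^sup>2 * (infnorm (w - w'))\<^sup>2 + e)"
  using Wass2_le_coupling[OF contraction[OF assms(1,2)] _ assms(3)] q_nonneg infnorm_pos_le[of "w - w'"]
  by (auto simp: power_mult_distrib)

text \<open>A Feller property on S for Lipschitz f, which allows weak limits to pass through the
  kernel. It follows from near-optimal couplings of \<open>K w\<close> and \<open>K w'\<close> with
  the slack e tending to 0.\<close>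

lemma continuous_kernel_integral:
  fixes f :: "'a \<Rightarrow> real"
  assumes L: "L-lipschitz_on UNIV f" and f01: "\<And>x. 0 \<le> f x \<and> f x \<le> 1"
  shows "continuous_on S (\<lambda>w. \<integral>x. f x \<partial>K w)"
proof -
  define \<Lambda> where "\<Lambda> = L * sqrt DIM('a)"
  have [simp]: "0 \<le> \<Lambda>" using lipschitz_on_nonneg[OF L] by (simp add: \<Lambda>_def)
  have meas: "f \<in> borel_measurable borel"
    using lipschitz_on_continuous_on[OF L] by (rule borel_measurable_continuous_onI)
  have *: "\<bar>(\<integral>x. f x \<partial>K w) - (\<integral>x. f x \<partial>K w')\<bar> \<le> \<Lambda> * q * infnorm (w - w')"
    if w: "w \<in> S" "w' \<in> S" for w w'
  proof -
    have "((\<integral>x. f x \<partial>K w) - (\<integral>x. f x \<partial>K w'))\<^sup>2 \<le> (\<Lambda> * q * infnorm (w - w'))\<^sup>2"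
    proof (rule field_le_mult_epsilon[of "\<Lambda>\<^sup>2"])
      fix e :: real assume e: "0 < e"
      obtain \<pi> where p: "\<pi> \<in> couplings (K w) (K w')"
        "transport_cost \<pi> \<le> ennreal (q\<^sup>2 * (infnorm (w - w'))\<^sup>2 + e)"
        using near_optimal_coupling[OF w e] .
      have "((\<integral>x. f x \<partial>K w) - (\<integral>x. f x \<partial>K w'))\<^sup>2 \<le> \<Lambda>\<^sup>2 * (q\<^sup>2 * (infnorm (w - w'))\<^sup>2 + e)"
        using lipschitz_infnorm[OF L] f01 e
        by (intro coupling_integral_diff[OF kernel_prob kernel_prob p(1) meas _ _ p(2), of 1])
           (auto simp: \<Lambda>_def abs_le_iff)
      then show "((\<integral>x. f x \<partial>K w) - (\<integral>x. f x \<partial>K w'))\<^sup>2 \<le> (\<Lambda> * q * infnorm (w - w'))\<^sup>2 + \<Lambda>\<^sup>2 * e"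
        by (simp add: algebra_simps power_mult_distrib)
    qed simp
    then show ?thesis
      using q_nonneg infnorm_pos_le[of "w - w'"] by (subst (asm) abs_le_square_iff[symmetric]) (simp add: abs_mult)
  qed
  have "(\<Lambda> * q)-lipschitz_on S (\<lambda>w. \<integral>x. f x \<partial>K w)"
  proof (rule lipschitz_onI)
    fix x y assume "x \<in> S" "y \<in> S"
    then have "\<bar>(\<integral>z. f z \<partial>K x) - (\<integral>z. f z \<partial>K y)\<bar> \<le> \<Lambda> * q * infnorm (x - y)" by (rule *)
    also have "\<dots> \<le> \<Lambda> * q * norm (x - y)"
      using q_nonneg infnorm_le_norm by (intro mult_left_mono) auto
    finally show "dist (\<integral>z. f z \<partial>K x) (\<integral>z. f z \<partial>K y) \<le> \<Lambda> * q * dist x y"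
      by (simp add: dist_norm)
  qed (use q_nonneg in simp)
  then show ?thesis by (rule lipschitz_on_continuous_on)
qed

text \<open>
  Near-optimal couplings of the kernels are available at finitely many pairs of points, so the coupling
  \<gamma> is first quantized; a weak limit of the resulting couplings avoids any measurable selection.
\<close>

lemma coupling_step:
  assumes M: "M \<in> borel_prob" and N: "N \<in> borel_prob" and g: "\<gamma> \<in> couplings M N"
    and aeM: "AE x in M. x \<in> S" and aeN: "AE x in N. x \<in> S"
  obtains \<gamma>' where "\<gamma>' \<in> couplings (M \<bind> K) (N \<bind> K)"
    "transport_cost \<gamma>' \<le> ennreal (q\<^sup>2) * transport_cost \<gamma>"
proof -
  have g': "\<gamma> \<in> borel_prob" "distr \<gamma> borel fst = M" "distr \<gamma> borel snd = N"
    using g couplings_iff[OF M N] by auto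
  note [measurable_cong] = borel_probD(2)[OF g'(1)]
  interpret \<gamma>: prob_space \<gamma> by (rule borel_probD[OF g'(1)])
  let ?T = "S \<times> S"
  let ?c = "\<lambda>z :: 'a \<times> 'a. (infnorm (fst z - snd z))\<^sup>2"
  have T: "compact ?T" using compact by (intro compact_Times)
  have T_borel: "?T \<in> sets borel" using T by (simp add: compact_imp_closed)
  have aeT: "AE z in \<gamma>. z \<in> ?T"
    by (rule AE_coupling_Times[OF M N g aeM aeN S_borel])
  have "?T \<noteq> {}"
  proof
    assume "?T = {}"
    with aeT show False using \<gamma>.AE_False by simp
  qed
  \<comment> \<open>The same null sequence serves as mesh of the quantization and as slack of the
    near-optimal couplings.\<close>
  define e where "e = (\<lambda>n. 1 / real (Suc n))"
  have e: "0 < e n" for n by (simp add: e_def)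
  have e0: "e \<longlonglongrightarrow> 0" unfolding e_def by (rule LIMSEQ_Suc[OF lim_1_over_n])
  have "\<exists>r A. finite A \<and> A \<subseteq> ?T \<and> r \<in> borel \<rightarrow>\<^sub>M count_space A \<and> (\<forall>z\<in>?T. dist z (r z) < e n)" for n
    using finite_quantizer[OF T \<open>?T \<noteq> {}\<close> e[of n]] by metis
  then obtain r A where rA: "\<And>n. finite (A n)" "\<And>n. A n \<subseteq> ?T" "\<And>n. r n \<in> borel \<rightarrow>\<^sub>M count_space (A n)"
    "\<And>n z. z \<in> ?T \<Longrightarrow> dist z (r n z) < e n" by metis
  have rT: "r n z \<in> ?T" for n z
    using measurable_space[OF rA(3)[of n], of z] rA(2)[of n] by auto
  have r_meas: "r n \<in> borel_measurable borel" for n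
    using measurable_compose[OF rA(3), of "\<lambda>x. x" n borel] by simp
  have r_lim: "(\<lambda>n. r n z) \<longlonglongrightarrow> z" if "z \<in> ?T" for z
  proof (rule tendstoI)
    fix d :: real assume "0 < d"
    then have "\<forall>\<^sub>F n in sequentially. e n < d" using order_tendstoD(2)[OF e0] by blast
    then show "\<forall>\<^sub>F n in sequentially. dist (r n z) z < d"
      by eventually_elim (use rA(4)[OF that] in \<open>force simp: dist_commute intro: less_trans\<close>)
  qed
  define good where "good = (\<lambda>n z \<pi>. \<pi> \<in> couplings (K (fst z)) (K (snd z)) \<and>
    transport_cost \<pi> \<le> ennreal (q\<^sup>2 * ?c z + e n))"
  have good_ex: "\<exists>\<pi>. good n z \<pi>" if "z \<in> ?T" for n z
  proof -
    have "fst z \<in> S" "snd z \<in> S" using that by auto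
    then show ?thesis
      using near_optimal_coupling[of "fst z" "snd z" "e n"] e[of n] unfolding good_def by blast
  qed
  define \<pi> where "\<pi> = (\<lambda>n z. SOME \<pi>. good n z \<pi>)"
  have good_\<pi>: "good n z (\<pi> n z)" if "z \<in> ?T" for n z
    unfolding \<pi>_def by (rule someI_ex[OF good_ex[OF that]])
  have \<pi>: "\<And>n z. z \<in> ?T \<Longrightarrow> \<pi> n z \<in> couplings (K (fst z)) (K (snd z))"
    "\<And>n z. z \<in> ?T \<Longrightarrow> transport_cost (\<pi> n z) \<le> ennreal (q\<^sup>2 * ?c z + e n)"
    using good_\<pi> unfolding good_def by blast+
  have \<pi>': "\<pi> n z \<in> borel_prob" "distr (\<pi> n z) borel fst = K (fst z)" "distr (\<pi> n z) borel snd = K (snd z)"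
    if "z \<in> ?T" for n z
    using \<pi>(1)[OF that, of n] couplings_iff[OF kernel_prob kernel_prob] by auto
  \<comment> \<open>The choice \<pi> need not be measurable; composed with the finitely valued
    \<open>r n\<close> it is a kernel.\<close>
  define Q where "Q = (\<lambda>n z. \<pi> n (r n z))"
  have Q: "Q n \<in> borel \<rightarrow>\<^sub>M prob_algebra borel" for n
    unfolding Q_def
    by (rule measurable_compose[OF rA(3)]) (unfold measurable_count_space_eq1, use rA(2) \<pi>'(1) in blast)
  have Q_prob: "Q n z \<in> borel_prob" for n z unfolding Q_def by (rule \<pi>'(1)[OF rT])
  \<comment> \<open>The marginals of \<open>G n\<close> are those of the quantized coupling pushed
    through K, so they become the required ones only in the limit.\<close>
  define G where "G = (\<lambda>n. \<gamma> \<bind> Q n)"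
  have G: "G n \<in> borel_prob" for n unfolding G_def by (rule borel_prob_bind[OF g'(1) Q])
  have aeG: "AE z in G n. z \<in> ?T" for n
  proof -
    have "AE z in Q n x. z \<in> ?T" for x
      unfolding Q_def using rT[of n x]
      by (intro AE_coupling_Times[OF kernel_prob kernel_prob \<pi>(1) _ _ S_borel]) (auto intro!: invariant simp: mem_Times_iff)
    then show ?thesis
      unfolding G_def using T_borel by (subst AE_borel_prob_bind[OF g'(1) Q]) auto
  qed
  obtain s \<gamma>' where s: "strict_mono s" and \<gamma>': "\<gamma>' \<in> borel_prob" and ae': "AE z in \<gamma>'. z \<in> ?T"
    and lim: "\<And>f :: 'a \<times> 'a \<Rightarrow> real. continuous_on ?T f \<Longrightarrow> f \<in> borel_measurable borel \<Longrightarrow>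
      (\<lambda>n. \<integral>z. f z \<partial>G (s n)) \<longlonglongrightarrow> (\<integral>z. f z \<partial>\<gamma>')"
    by (rule compact_prob_weak_subsequence[where M=G, OF T G aeG]) blast
  note [measurable_cong] = borel_probD(2)[OF \<gamma>']
  interpret \<gamma>': prob_space \<gamma>' by (rule borel_probD[OF \<gamma>'])
  have rs_lim: "(\<lambda>n. r (s n) z) \<longlonglongrightarrow> z" if "z \<in> ?T" for z
    using LIMSEQ_subseq_LIMSEQ[OF r_lim[OF that] s] by (simp add: comp_def)
  have lim_r: "(\<lambda>n. \<integral>z. h (r (s n) z) \<partial>\<gamma>) \<longlonglongrightarrow> (\<integral>z. h z \<partial>\<gamma>)"
    if h: "continuous_on ?T h" and [measurable]: "h \<in> borel_measurable borel" for h :: "'a \<times> 'a \<Rightarrow> real"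
  proof -
    obtain B where B: "\<And>x. x \<in> ?T \<Longrightarrow> norm (h x) \<le> B"
      by (rule continuous_on_compact_bound[OF T h]) blast
    show ?thesis
    proof (rule integral_dominated_convergence[where w="\<lambda>_. B"])
      show "(\<lambda>z. h (r (s n) z)) \<in> borel_measurable \<gamma>" for n
        using measurable_compose[OF r_meas[of "s n"], of h borel] by simp
      show "AE z in \<gamma>. (\<lambda>n. h (r (s n) z)) \<longlonglongrightarrow> h z"
        using aeT
      proof eventually_elim
        case (elim z)
        show ?case
          by (rule continuous_on_tendsto_compose[OF h rs_lim[OF elim] elim])
             (use rT in auto)
      qed
    qed (use B rT in auto)
  qed
  \<comment> \<open>Stated once for both marginals, p being \<open>fst\<close> or
    \<open>snd\<close>. Integrating f o p against \<open>G n\<close> gives the mean of k at the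
    quantized point; k is continuous on S and the quantized points tend to z, so both sides have
    limits.\<close>
  have marg: "distr \<gamma>' borel p = distr \<gamma> borel p \<bind> K"
    if p: "continuous_on UNIV p" and pT: "\<And>z. z \<in> ?T \<Longrightarrow> p z \<in> S"
      and pK: "\<And>n z. z \<in> ?T \<Longrightarrow> distr (\<pi> n z) borel p = K (p z)" for p
  proof (rule borel_prob_eqI_lipschitz)
    have pm [measurable]: "p \<in> borel_measurable borel" using p by (rule borel_measurable_continuous_onI)
    show "distr \<gamma>' borel p \<in> borel_prob" by (rule borel_prob_distr[OF \<gamma>' pm])
    have gp: "distr \<gamma> borel p \<in> borel_prob" by (rule borel_prob_distr[OF g'(1) pm])
    show "distr \<gamma> borel p \<bind> K \<in> borel_prob" by (rule borel_prob_bind[OF gp kernel])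
    fix f :: "'a \<Rightarrow> real" and L assume L: "L-lipschitz_on UNIV f" and f01: "\<And>x. 0 \<le> f x \<and> f x \<le> 1"
    have cf: "continuous_on UNIV f" using L by (rule lipschitz_on_continuous_on)
    have fm [measurable]: "f \<in> borel_measurable borel" using cf by (rule borel_measurable_continuous_onI)
    have fb: "\<bar>f x\<bar> \<le> 1" for x using f01[of x] by simp
    define k where "k = (\<lambda>w. \<integral>x. f x \<partial>K w)"
    have k [measurable]: "k \<in> borel_measurable borel"
      unfolding k_def by (rule measurable_integral_kernel[OF kernel fm])
    have "(\<lambda>n. \<integral>z. f (p z) \<partial>G (s n)) \<longlonglongrightarrow> (\<integral>z. f (p z) \<partial>\<gamma>')"
      by (intro lim continuous_on_compose2[OF cf] continuous_on_subset[OF p]) auto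
    moreover have "(\<integral>z. f (p z) \<partial>G n) = (\<integral>z. k (p (r n z)) \<partial>\<gamma>)" for n
    proof -
      have "(\<integral>z. f (p z) \<partial>G n) = (\<integral>x. \<integral>z. f (p z) \<partial>Q n x \<partial>\<gamma>)"
        unfolding G_def by (rule integral_borel_prob_bind[OF g'(1) Q, where B=1]) (auto simp: fb)
      also have "(\<lambda>x. \<integral>z. f (p z) \<partial>Q n x) = (\<lambda>x. k (p (r n x)))"
      proof
        fix x
        have "k (p (r n x)) = (\<integral>y. f y \<partial>distr (Q n x) borel p)"
          unfolding k_def Q_def pK[OF rT] ..
        also have "\<dots> = (\<integral>z. f (p z) \<partial>Q n x)"
          using borel_probD(2)[OF Q_prob[of n x]]
          by (intro integral_distr) (auto cong: measurable_cong_sets)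
        finally show "(\<integral>z. f (p z) \<partial>Q n x) = k (p (r n x))" ..
      qed
      finally show ?thesis .
    qed
    moreover have "(\<lambda>n. \<integral>z. k (p (r (s n) z)) \<partial>\<gamma>) \<longlonglongrightarrow> (\<integral>z. k (p z) \<partial>\<gamma>)"
      using lim_r[of "\<lambda>z. k (p z)"] pT
      by (auto intro!: continuous_on_compose2[OF continuous_kernel_integral[OF L f01, folded k_def]] continuous_on_subset[OF p])
    ultimately have "(\<integral>z. f (p z) \<partial>\<gamma>') = (\<integral>z. k (p z) \<partial>\<gamma>)"
      by (intro LIMSEQ_unique[of "\<lambda>n. \<integral>z. f (p z) \<partial>G (s n)"]) simp_all
    moreover have "(\<integral>x. f x \<partial>(distr \<gamma> borel p \<bind> K)) = (\<integral>z. k (p z) \<partial>\<gamma>)"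
      unfolding k_def
      by (subst integral_borel_prob_bind[OF gp kernel fm fb], subst integral_distr)
         (auto simp: k_def[symmetric])
    ultimately show "(\<integral>x. f x \<partial>distr \<gamma>' borel p) = (\<integral>x. f x \<partial>(distr \<gamma> borel p \<bind> K))"
      by (simp add: integral_distr)
  qed
  have "distr \<gamma>' borel fst = M \<bind> K" "distr \<gamma>' borel snd = N \<bind> K"
    unfolding g'(2,3)[symmetric]
    by (rule marg; use \<pi>'(2,3) in \<open>auto intro: continuous_intros\<close>)+
  then have coup: "\<gamma>' \<in> couplings (M \<bind> K) (N \<bind> K)"
    using \<gamma>' couplings_iff[OF borel_prob_bind[OF M kernel] borel_prob_bind[OF N kernel]] by simp
  obtain B where B: "\<And>x. x \<in> ?T \<Longrightarrow> norm (?c x) \<le> B"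
    by (rule continuous_on_compact_bound[OF T continuous_cost]) blast
  have cost_eq: "transport_cost \<delta> = ennreal (\<integral>z. ?c z \<partial>\<delta>)"
    if d: "\<delta> \<in> borel_prob" "AE z in \<delta>. z \<in> ?T" for \<delta>
  proof -
    interpret \<delta>: prob_space \<delta> by (rule borel_probD[OF d(1)])
    note [measurable_cong] = borel_probD(2)[OF d(1)]
    have "integrable \<delta> ?c"
      using d(2) B by (intro \<delta>.integrable_const_bound[of _ B]) (auto elim!: AE_mp)
    then show "transport_cost \<delta> = ennreal (\<integral>z. ?c z \<partial>\<delta>)"
      unfolding transport_cost_eq by (rule nn_integral_eq_integral) simp
  qed
  have "(\<lambda>n. \<integral>z. ?c z \<partial>G (s n)) \<longlonglongrightarrow> (\<integral>z. ?c z \<partial>\<gamma>')"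
    by (intro lim continuous_cost) measurable
  moreover have "(\<lambda>n. (\<integral>z. q\<^sup>2 * ?c (r (s n) z) \<partial>\<gamma>) + e (s n)) \<longlonglongrightarrow> (\<integral>z. q\<^sup>2 * ?c z \<partial>\<gamma>) + 0"
    using LIMSEQ_subseq_LIMSEQ[OF e0 s]
    by (intro tendsto_add lim_r[of "\<lambda>z. q\<^sup>2 * ?c z"] continuous_on_mult continuous_on_const continuous_cost)
       (auto simp: comp_def)
  \<comment> \<open>The cost of the mixture \<open>G n\<close> is the average of the costs of its
    components, each within \<open>e n\<close> of q^2 times the squared distance of the quantized
    pair. Letting n grow, both sides converge because the cost is continuous on the compact
    square.\<close>
  moreover have "(\<integral>z. ?c z \<partial>G n) \<le> (\<integral>z. q\<^sup>2 * ?c (r n z) \<partial>\<gamma>) + e n" for n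
  proof -
    have int: "integrable \<gamma> (\<lambda>z. q\<^sup>2 * ?c (r n z))"
    proof (intro integrable_mult_right \<gamma>.integrable_const_bound[of _ B])
      show "(\<lambda>z. ?c (r n z)) \<in> borel_measurable \<gamma>"
        using measurable_compose[OF r_meas[of n], of ?c borel] by simp
      show "AE z in \<gamma>. norm (?c (r n z)) \<le> B" using B[OF rT] by simp
    qed
    have "ennreal (\<integral>z. ?c z \<partial>G n) = transport_cost (G n)" by (rule cost_eq[OF G aeG, symmetric])
    also have "\<dots> = (\<integral>\<^sup>+ x. transport_cost (Q n x) \<partial>\<gamma>)"
      unfolding G_def transport_cost_eq by (rule nn_integral_borel_prob_bind[OF g'(1) Q]) measurable
    also have "\<dots> \<le> (\<integral>\<^sup>+ x. ennreal (q\<^sup>2 * ?c (r n x) + e n) \<partial>\<gamma>)"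
      unfolding Q_def by (intro nn_integral_mono \<pi>(2)[OF rT])
    also have "\<dots> = ennreal (\<integral>x. q\<^sup>2 * ?c (r n x) + e n \<partial>\<gamma>)"
      using int less_imp_le[OF e[of n]] by (intro nn_integral_eq_integral) auto
    also have "(\<integral>x. q\<^sup>2 * ?c (r n x) + e n \<partial>\<gamma>) = (\<integral>z. q\<^sup>2 * ?c (r n z) \<partial>\<gamma>) + e n"
      using int by (simp add: \<gamma>.prob_space)
    finally show ?thesis
      using less_imp_le[OF e[of n]] by (subst (asm) ennreal_le_iff) (auto intro!: add_nonneg_nonneg)
  qed
  ultimately have "(\<integral>z. ?c z \<partial>\<gamma>') \<le> (\<integral>z. q\<^sup>2 * ?c z \<partial>\<gamma>) + 0"
    by (intro LIMSEQ_le[of "\<lambda>n. \<integral>z. ?c z \<partial>G (s n)" _ "\<lambda>n. (\<integral>z. q\<^sup>2 * ?c (r (s n) z) \<partial>\<gamma>) + e (s n)"]) auto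
  then have "transport_cost \<gamma>' \<le> ennreal (q\<^sup>2) * transport_cost \<gamma>"
    unfolding cost_eq[OF \<gamma>' ae'] cost_eq[OF g'(1) aeT]
    by (simp add: ennreal_mult[symmetric] ennreal_leI)
  with coup that show ?thesis by blast
qed

end

section \<open>Stationary distributions and attached noise\<close>

lemma pair_coupling:
  assumes "prob_space M" "prob_space N"
  shows "M \<Otimes>\<^sub>M N \<in> couplings M N"
proof -
  interpret M: prob_space M by fact
  interpret N: prob_space N by fact
  interpret pair_prob_space M N ..
  have "distr (M \<Otimes>\<^sub>M N) N snd = N"
  proof (rule measure_eqI)
    fix A assume A: "A \<in> sets (distr (M \<Otimes>\<^sub>M N) N snd)"
    then have "snd -` A \<inter> space (M \<Otimes>\<^sub>M N) = space M \<times> A"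
      using sets.sets_into_space[of A N] by (auto simp: space_pair_measure)
    with A show "emeasure (distr (M \<Otimes>\<^sub>M N) N snd) A = emeasure N A"
      by (simp add: emeasure_distr N.emeasure_pair_measure_Times M.emeasure_space_1)
  qed simp
  then show ?thesis
    unfolding couplings_def using N.distr_pair_fst by simp
qed

lemma infnorm_Pair:
  "infnorm (a :: 'a::euclidean_space, b :: 'b::euclidean_space) = max (infnorm a) (infnorm b)"
proof -
  have "(\<lambda>i. \<bar>(a, b) \<bullet> i\<bar>) ` Basis = (\<lambda>i. \<bar>a \<bullet> i\<bar>) ` Basis \<union> (\<lambda>i. \<bar>b \<bullet> i\<bar>) ` Basis"
    by (auto simp: Basis_prod_def image_Un image_image)
  then show ?thesis by (simp add: infnorm_Max Max_Un)
qed

lemma infnorm_real [simp]: "infnorm (x :: real) = \<bar>x\<bar>"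
  by (simp add: infnorm_Max)

context wass_contraction
begin

lemma stationary_exists:
  assumes "S \<noteq> {}" "q < 1"
  obtains \<pi> where "\<pi> \<in> borel_prob" "AE x in \<pi>. x \<in> S" "\<pi> \<bind> K = \<pi>"
proof -
  obtain w where w: "w \<in> S" using assms(1) by blast
  define \<rho> where "\<rho> = (\<lambda>n. ((\<lambda>M. M \<bind> K) ^^ n) (return borel w))"
  have \<rho>_Suc: "\<rho> (Suc n) = \<rho> n \<bind> K" for n by (simp add: \<rho>_def)
  have \<rho>: "\<rho> n \<in> borel_prob \<and> (AE x in \<rho> n. x \<in> S)" for n
  proof (induction n)
    case 0
    have "return borel w \<in> borel_prob" by (simp add: space_prob_algebra prob_space_return)
    moreover have "AE x in return borel w. x \<in> S"
      using w S_borel by (subst AE_return) auto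
    ultimately show ?case unfolding \<rho>_def funpow_0 by simp
  next
    case (Suc n)
    then show ?case unfolding \<rho>_Suc using borel_prob_bind[OF _ kernel] AE_bind_S by blast
  qed
  \<comment> \<open>B bounds the squared distances within S; it is the cost allowed for the first
    coupling, of a Dirac mass with its successor.\<close>
  obtain B where B: "0 \<le> B" "\<And>z. z \<in> S \<times> S \<Longrightarrow> norm ((infnorm (fst z - snd z))\<^sup>2) \<le> B"
    by (rule continuous_on_compact_bound[OF compact_Times[OF compact compact] continuous_cost]) blast
  have "\<exists>\<gamma>\<in>couplings (\<rho> n) (\<rho> (Suc n)). transport_cost \<gamma> \<le> ennreal ((q\<^sup>2) ^ n * B)" for n
  proof (induction n)
    case 0
    let ?\<gamma> = "\<rho> 0 \<Otimes>\<^sub>M \<rho> (Suc 0)"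
    have g: "?\<gamma> \<in> couplings (\<rho> 0) (\<rho> (Suc 0))"
      using \<rho> borel_probD(1) by (intro pair_coupling) blast+
    then have g': "?\<gamma> \<in> borel_prob" using couplings_iff \<rho> by blast
    interpret prob_space ?\<gamma> by (rule borel_probD(1)[OF g'])
    have "AE z in ?\<gamma>. z \<in> S \<times> S"
      using \<rho> by (intro AE_coupling_Times[OF _ _ g _ _ S_borel]) auto
    then have "transport_cost ?\<gamma> \<le> (\<integral>\<^sup>+ z. ennreal B \<partial>?\<gamma>)"
      unfolding transport_cost_eq using B(2) by (intro nn_integral_mono_AE) (auto elim!: AE_mp intro!: ennreal_leI)
    also have "\<dots> = ennreal B" by (simp add: emeasure_space_1)
    finally show ?case using g by (intro bexI[of _ ?\<gamma>]) simp_all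
  next
    case (Suc n)
    then obtain \<gamma> where g: "\<gamma> \<in> couplings (\<rho> n) (\<rho> (Suc n))"
      "transport_cost \<gamma> \<le> ennreal ((q\<^sup>2) ^ n * B)" by blast
    obtain \<gamma>' where g': "\<gamma>' \<in> couplings (\<rho> n \<bind> K) (\<rho> (Suc n) \<bind> K)"
      "transport_cost \<gamma>' \<le> ennreal (q\<^sup>2) * transport_cost \<gamma>"
      using coupling_step[OF _ _ g(1)] \<rho> by blast
    note g'(2)
    also have "ennreal (q\<^sup>2) * transport_cost \<gamma> \<le> ennreal (q\<^sup>2) * ennreal ((q\<^sup>2) ^ n * B)"
      by (intro mult_left_mono g) simp
    also have "\<dots> = ennreal ((q\<^sup>2) ^ Suc n * B)"
      using B(1) by (simp add: ennreal_mult[symmetric] mult.assoc)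
    finally show ?case using g'(1) unfolding \<rho>_Suc by blast
  qed
  then obtain \<Gamma> where \<Gamma>: "\<And>n. \<Gamma> n \<in> couplings (\<rho> n) (\<rho> (Suc n))"
    "\<And>n. transport_cost (\<Gamma> n) \<le> ennreal ((q\<^sup>2) ^ n * B)" by metis
  obtain s \<pi> where s: "strict_mono s" and \<pi>: "\<pi> \<in> borel_prob" "AE x in \<pi>. x \<in> S"
    and lim: "\<And>f :: 'a \<Rightarrow> real. continuous_on S f \<Longrightarrow> f \<in> borel_measurable borel \<Longrightarrow>
      (\<lambda>n. \<integral>x. f x \<partial>\<rho> (s n)) \<longlonglongrightarrow> (\<integral>x. f x \<partial>\<pi>)"
    by (rule compact_prob_weak_subsequence[where M=\<rho>, OF compact]) (use \<rho> in blast)+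
  have "\<pi> \<bind> K = \<pi>"
  proof (rule borel_prob_eqI_lipschitz[OF borel_prob_bind[OF \<pi>(1) kernel] \<pi>(1)])
    fix f :: "'a \<Rightarrow> real" and L assume L: "L-lipschitz_on UNIV f" and f01: "\<And>x. 0 \<le> f x \<and> f x \<le> 1"
    have cf: "continuous_on UNIV f" using L by (rule lipschitz_on_continuous_on)
    have fm: "f \<in> borel_measurable borel" using cf by (rule borel_measurable_continuous_onI)
    have fb: "\<bar>f x\<bar> \<le> 1" for x using f01[of x] by simp
    define \<Lambda> where "\<Lambda> = L * sqrt DIM('a)"
    have diff: "((\<integral>x. f x \<partial>\<rho> n) - (\<integral>x. f x \<partial>\<rho> (Suc n)))\<^sup>2 \<le> \<Lambda>\<^sup>2 * ((q\<^sup>2) ^ n * B)" for n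
      using \<rho> B(1) lipschitz_infnorm[OF L]
      by (intro coupling_integral_diff[OF _ _ \<Gamma>(1) fm fb _ \<Gamma>(2)]) (auto simp: \<Lambda>_def)
    have lim0: "(\<lambda>n. \<Lambda>\<^sup>2 * ((q\<^sup>2) ^ n * B)) \<longlonglongrightarrow> \<Lambda>\<^sup>2 * (0 * B)"
      using q_nonneg assms(2)
      by (intro tendsto_intros LIMSEQ_power_zero) (simp add: abs_square_less_1)
    have "(\<lambda>n. ((\<integral>x. f x \<partial>\<rho> n) - (\<integral>x. f x \<partial>\<rho> (Suc n)))\<^sup>2) \<longlonglongrightarrow> 0"
    proof (rule tendsto_sandwich[OF _ _ tendsto_const])
      show "(\<lambda>n. \<Lambda>\<^sup>2 * ((q\<^sup>2) ^ n * B)) \<longlonglongrightarrow> 0" using lim0 by simp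
    qed (use diff in simp_all)
    from tendsto_real_sqrt[OF this]
    have "(\<lambda>n. (\<integral>x. f x \<partial>\<rho> n) - (\<integral>x. f x \<partial>\<rho> (Suc n))) \<longlonglongrightarrow> 0"
      by (simp add: tendsto_rabs_zero_iff)
    from LIMSEQ_subseq_LIMSEQ[OF this s]
    have "(\<lambda>n. (\<integral>x. f x \<partial>\<rho> (s n)) - (\<integral>x. f x \<partial>\<rho> (Suc (s n)))) \<longlonglongrightarrow> 0"
      by (simp add: comp_def)
    \<comment> \<open>Weak convergence along s says nothing directly about the indices
      \<open>Suc (s n)\<close>. The integral at the next iterate is therefore read as that of the
      function x \<mapsto> \<integral>f dK(x), continuous on S, against the current one.\<close>
    moreover have "(\<integral>x. f x \<partial>\<rho> (Suc n)) = (\<integral>x. \<integral>y. f y \<partial>K x \<partial>\<rho> n)" for n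
      unfolding \<rho>_Suc using \<rho> by (intro integral_borel_prob_bind[OF _ kernel fm fb]) auto
    moreover have "(\<lambda>n. (\<integral>x. f x \<partial>\<rho> (s n)) - (\<integral>x. \<integral>y. f y \<partial>K x \<partial>\<rho> (s n))) \<longlonglongrightarrow>
        (\<integral>x. f x \<partial>\<pi>) - (\<integral>x. \<integral>y. f y \<partial>K x \<partial>\<pi>)"
      using fm
      by (intro tendsto_diff lim continuous_kernel_integral[OF L f01] continuous_on_subset[OF cf]
          measurable_integral_kernel[OF kernel]) auto
    ultimately have "(\<integral>x. f x \<partial>\<pi>) - (\<integral>x. \<integral>y. f y \<partial>K x \<partial>\<pi>) = 0"
      by (intro LIMSEQ_unique[of "\<lambda>n. (\<integral>x. f x \<partial>\<rho> (s n)) - (\<integral>x. \<integral>y. f y \<partial>K x \<partial>\<rho> (s n))"]) simp_all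
    then show "(\<integral>x. f x \<partial>(\<pi> \<bind> K)) = (\<integral>x. f x \<partial>\<pi>)"
      by (subst integral_borel_prob_bind[OF \<pi>(1) kernel fm fb]) simp
  qed
  with \<pi> that show ?thesis by blast
qed

end

section \<open>Independent noise attached to a contractive kernel\<close>

locale noisy_contraction = wass_contraction K S q
  for K :: "('u::euclidean_space \<times> 'v::euclidean_space) \<Rightarrow> ('u \<times> 'v) measure" and S q +
  fixes \<nu> :: "real measure"
  assumes noise: "\<nu> \<in> borel_prob"
begin

text \<open>States are nested as (u, (v, \<eta>)), so adding noise to a pair (u, v) also
  re-associates it; \<open>pr\<close> undoes both.\<close>

definition attach_noise :: "'u \<times> 'v \<Rightarrow> ('u \<times> 'v \<times> real) measure" where
  "attach_noise w = distr \<nu> borel (\<lambda>\<eta>. (fst w, snd w, \<eta>))"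

definition pr :: "'u \<times> 'v \<times> real \<Rightarrow> 'u \<times> 'v" where
  "pr h = (fst h, fst (snd h))"

text \<open>The noise is drawn afresh at each step, so the old noise is forgotten and the kernel
  sees h only through \<open>pr h\<close>.\<close>

definition P :: "'u \<times> 'v \<times> real \<Rightarrow> ('u \<times> 'v \<times> real) measure" where
  "P h = K (pr h) \<bind> attach_noise"

lemma measurable_pr: "pr \<in> borel_measurable borel"
  unfolding pr_def by (intro measurable_Pair_borel) measurable

lemma measurable_noise_kernel:
  fixes f :: "'c::second_countable_topology \<Rightarrow> real \<Rightarrow> 'd::topological_space"
  assumes "(\<lambda>z. f (fst z) (snd z)) \<in> borel_measurable borel"
  shows "(\<lambda>w. distr \<nu> borel (f w)) \<in> borel \<rightarrow>\<^sub>M prob_algebra borel"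
proof (rule measurable_distr_prob_space2[where M=borel])
  show "(\<lambda>w. \<nu>) \<in> borel \<rightarrow>\<^sub>M prob_algebra borel" by (rule measurable_const[OF noise])
  show "(\<lambda>(x, y). f x y) \<in> borel \<Otimes>\<^sub>M borel \<rightarrow>\<^sub>M borel"
    using assms by (simp add: borel_prod case_prod_beta)
qed

lemma attach_noise: "attach_noise \<in> borel \<rightarrow>\<^sub>M prob_algebra borel"
  unfolding attach_noise_def
  by (rule measurable_noise_kernel) (intro borel_measurable_continuous_onI continuous_intros)

lemma attach_noise_section: "(\<lambda>\<eta>. (fst w, snd w, \<eta>)) \<in> borel_measurable \<nu>"
  unfolding measurable_cong_sets[OF borel_probD(2)[OF noise] refl]
  by (intro borel_measurable_continuous_onI continuous_intros)

lemma distr_attach_pr: "distr (attach_noise w) borel pr = return borel w"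
proof -
  interpret prob_space \<nu> by (rule borel_probD(1)[OF noise])
  have "distr (attach_noise w) borel pr = distr \<nu> borel (pr \<circ> (\<lambda>\<eta>. (fst w, snd w, \<eta>)))"
    unfolding attach_noise_def by (rule distr_distr[OF measurable_pr attach_noise_section])
  also have "\<dots> = return borel w" by (simp add: comp_def pr_def)
  finally show ?thesis .
qed

lemma distr_bind_attach_pr:
  assumes "M \<in> borel_prob"
  shows "distr (M \<bind> attach_noise) borel pr = M"
  using borel_probD(2)[OF assms]
  by (simp add: distr_borel_prob_bind[OF assms attach_noise measurable_pr] distr_attach_pr bind_return'')

lemma P: "P \<in> borel \<rightarrow>\<^sub>M prob_algebra borel"
  unfolding P_def
  by (rule measurable_bind_prob_space[OF measurable_compose[OF measurable_pr kernel] attach_noise])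

text \<open>Associativity of bind separates a step into three stages: forget the noise, apply K,
  attach fresh noise. This is the route by which facts about K reach P.\<close>

lemma bind_P:
  assumes M: "M \<in> borel_prob"
  shows "M \<bind> P = distr M borel pr \<bind> K \<bind> attach_noise"
proof -
  note Mp = borel_prob_distr[OF M measurable_pr]
  have "distr M borel pr \<bind> K \<bind> attach_noise = distr M borel pr \<bind> (\<lambda>w. K w \<bind> attach_noise)"
    using borel_probD(2)[OF Mp] kernel attach_noise
    by (intro bind_assoc[where N=borel and R=borel] measurable_prob_algebraD) (auto cong: measurable_cong_sets)
  also have "\<dots> = M \<bind> P"
    unfolding P_def
    by (rule bind_distr_borel_prob[OF M measurable_bind_prob_space[OF kernel attach_noise] measurable_pr])
  finally show ?thesis ..
qed

lemma AE_distr_pr: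
  assumes "M \<in> borel_prob"
  shows "(AE w in distr M borel pr. w \<in> S) \<longleftrightarrow> (AE h in M. pr h \<in> S)"
  using S_borel measurable_pr borel_probD(2)[OF assms]
  by (intro AE_distr_iff) (auto cong: measurable_cong_sets)

lemma AE_bind_P:
  assumes M: "M \<in> borel_prob" and ae: "AE h in M. pr h \<in> S"
  shows "AE h in M \<bind> P. pr h \<in> S"
proof -
  note Mp = borel_prob_distr[OF M measurable_pr]
  have "AE w in distr M borel pr \<bind> K. w \<in> S"
    using ae by (intro AE_bind_S Mp) (simp add: AE_distr_pr M)
  then have "AE w in distr (M \<bind> P) borel pr. w \<in> S"
    unfolding bind_P[OF M] distr_bind_attach_pr[OF borel_prob_bind[OF Mp kernel]] .
  then show ?thesis by (simp add: AE_distr_pr borel_prob_bind[OF M P])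
qed

text \<open>Only the middle stage of a step contributes the factor q^2. Dropping a coordinate cannot
  increase the max-norm, and giving both copies the same noise value leaves their distance
  unchanged.\<close>

lemma joint_coupling_step:
  assumes M: "M \<in> borel_prob" and N: "N \<in> borel_prob" and g: "\<gamma> \<in> couplings M N"
    and aeM: "AE h in M. pr h \<in> S" and aeN: "AE h in N. pr h \<in> S"
  obtains \<gamma>' where "\<gamma>' \<in> couplings (M \<bind> P) (N \<bind> P)"
    "transport_cost \<gamma>' \<le> ennreal (q\<^sup>2) * transport_cost \<gamma>"
proof -
  note [measurable] = measurable_pr
  have g': "\<gamma> \<in> borel_prob" "distr \<gamma> borel fst = M" "distr \<gamma> borel snd = N"
    using g couplings_iff[OF M N] by auto
  note [measurable_cong] = borel_probD(2)[OF g'(1)]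
  note Mp = borel_prob_distr[OF M measurable_pr] and Np = borel_prob_distr[OF N measurable_pr]
  define pp where "pp = (\<lambda>z. (pr (fst z), pr (snd z)))"
  have pp [measurable]: "pp \<in> borel_measurable borel"
    unfolding pp_def by (intro measurable_Pair_borel) measurable
  have "distr (distr \<gamma> borel pp) borel fst = distr M borel pr"
    "distr (distr \<gamma> borel pp) borel snd = distr N borel pr"
    unfolding g'(2,3)[symmetric] by (simp_all add: distr_distr comp_def pp_def[abs_def])
  then have gp: "distr \<gamma> borel pp \<in> couplings (distr M borel pr) (distr N borel pr)"
    using couplings_iff[OF Mp Np] borel_prob_distr[OF g'(1) pp] by simp
  have "transport_cost (distr \<gamma> borel pp) = (\<integral>\<^sup>+ z. ennreal ((infnorm (pr (fst z) - pr (snd z)))\<^sup>2) \<partial>\<gamma>)"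
    unfolding transport_cost_eq by (subst nn_integral_distr) (simp_all add: pp_def)
  also have "\<dots> \<le> transport_cost \<gamma>"
    unfolding transport_cost_eq
  proof (intro nn_integral_mono ennreal_leI power_mono infnorm_pos_le)
    fix z :: "('u \<times> 'v \<times> real) \<times> ('u \<times> 'v \<times> real)"
    show "infnorm (pr (fst z) - pr (snd z)) \<le> infnorm (fst z - snd z)"
      unfolding pr_def by (cases z) (auto simp: infnorm_Pair)
  qed
  finally have cost_pp: "transport_cost (distr \<gamma> borel pp) \<le> transport_cost \<gamma>" .
  have "AE w in distr M borel pr. w \<in> S" "AE w in distr N borel pr. w \<in> S"
    using aeM aeN by (simp_all add: AE_distr_pr M N)
  from coupling_step[OF Mp Np gp this]
  obtain \<delta> where d: "\<delta> \<in> couplings (distr M borel pr \<bind> K) (distr N borel pr \<bind> K)"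
    "transport_cost \<delta> \<le> ennreal (q\<^sup>2) * transport_cost (distr \<gamma> borel pp)" .
  note MK = borel_prob_bind[OF Mp kernel] and NK = borel_prob_bind[OF Np kernel]
  have d': "\<delta> \<in> borel_prob" "distr \<delta> borel fst = distr M borel pr \<bind> K"
      "distr \<delta> borel snd = distr N borel pr \<bind> K"
    using d(1) couplings_iff[OF MK NK] by auto
  define em where "em = (\<lambda>(w :: 'u \<times> 'v) (\<eta> :: real). (fst w, snd w, \<eta>))"
  define E where "E = (\<lambda>z. distr \<nu> borel (\<lambda>\<eta>. (em (fst z) \<eta>, em (snd z) \<eta>)))"
  have E: "E \<in> borel \<rightarrow>\<^sub>M prob_algebra borel"
    unfolding E_def em_def
    by (rule measurable_noise_kernel) (intro borel_measurable_continuous_onI continuous_intros)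
  have em_meas: "(\<lambda>\<eta>. (em x \<eta>, em y \<eta>)) \<in> borel_measurable \<nu>" for x y
    unfolding em_def
    unfolding measurable_cong_sets[OF borel_probD(2)[OF noise] refl]
    by (intro borel_measurable_continuous_onI continuous_intros)
  have "distr (E z) borel fst = attach_noise (fst z)" "distr (E z) borel snd = attach_noise (snd z)" for z
    unfolding E_def attach_noise_def
    using distr_distr[OF measurable_fst_snd_borel(1) em_meas[of "fst z" "snd z"]]
      distr_distr[OF measurable_fst_snd_borel(2) em_meas[of "fst z" "snd z"]]
    by (simp_all add: comp_def em_def)
  then have m: "distr (\<delta> \<bind> E) borel fst = M \<bind> P" "distr (\<delta> \<bind> E) borel snd = N \<bind> P"
    by (simp_all add: distr_borel_prob_bind[OF d'(1) E] bind_P M N d'(2,3)[symmetric]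
        bind_distr_borel_prob[OF d'(1) attach_noise])
  have "transport_cost (\<delta> \<bind> E) = (\<integral>\<^sup>+ z. transport_cost (E z) \<partial>\<delta>)"
    unfolding transport_cost_eq by (rule nn_integral_borel_prob_bind[OF d'(1) E]) measurable
  also have "\<dots> = transport_cost \<delta>"
  proof -
    interpret prob_space \<nu> by (rule borel_probD(1)[OF noise])
    have "transport_cost (E z) = ennreal ((infnorm (fst z - snd z))\<^sup>2)" for z
    proof -
      have "infnorm (em x \<eta> - em y \<eta>) = infnorm (x - y)" for x y \<eta>
        using infnorm_pos_le[of "snd x - snd y"]
        by (cases x; cases y) (simp add: em_def infnorm_Pair)
      then have "transport_cost (E z) = (\<integral>\<^sup>+ \<eta>. ennreal ((infnorm (fst z - snd z))\<^sup>2) \<partial>\<nu>)"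
        unfolding transport_cost_eq E_def by (subst nn_integral_distr[OF em_meas]) simp_all
      then show ?thesis by (simp add: emeasure_space_1)
    qed
    then show ?thesis unfolding transport_cost_eq[of \<delta>] by simp
  qed
  also have "\<dots> \<le> ennreal (q\<^sup>2) * transport_cost \<gamma>"
    using d(2) mult_left_mono[OF cost_pp, of "ennreal (q\<^sup>2)"] by simp
  finally show ?thesis
    using that[of "\<delta> \<bind> E"] m couplings_iff[OF borel_prob_bind[OF M P] borel_prob_bind[OF N P]]
      borel_prob_bind[OF d'(1) E] by simp
qed

lemma kernel_pow_P: "kernel_pow P t \<in> borel \<rightarrow>\<^sub>M prob_algebra borel"
proof (induction t)
  case 0
  have "kernel_pow P 0 = return borel" by (rule ext) simp
  then show ?case by simp
next
  case (Suc t)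
  have "kernel_pow P (Suc t) = (\<lambda>h. P h \<bind> kernel_pow P t)" by (rule ext) simp
  then show ?case using measurable_bind_prob_space[OF P Suc] by simp
qed

text \<open>\<open>kernel_pow\<close> peels off the first step, so the induction replaces M by
  \<open>M \<bind> P\<close> and must leave M and \<gamma> arbitrary; the second marginal stays N by
  stationarity.\<close>

lemma joint_coupling_pow:
  assumes "M \<in> borel_prob" and N: "N \<in> borel_prob" and "\<gamma> \<in> couplings M N"
    and "AE h in M. pr h \<in> S" and aeN: "AE h in N. pr h \<in> S" and inv: "N \<bind> P = N"
  shows "\<exists>\<gamma>'\<in>couplings (M \<bind> kernel_pow P t) N. transport_cost \<gamma>' \<le> ennreal (q\<^sup>2) ^ t * transport_cost \<gamma>"
  using assms(1,3,4)
proof (induction t arbitrary: M \<gamma>)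
  case 0
  have "kernel_pow P 0 = return borel" by (rule ext) simp
  then show ?case using 0 borel_probD(2)[OF 0(1)] by (intro bexI[of _ \<gamma>]) (simp_all add: bind_return'')
next
  case (Suc t)
  obtain \<gamma>1 where g1: "\<gamma>1 \<in> couplings (M \<bind> P) N"
    "transport_cost \<gamma>1 \<le> ennreal (q\<^sup>2) * transport_cost \<gamma>"
    using joint_coupling_step[OF Suc.prems(1) N Suc.prems(2,3) aeN] inv by metis
  obtain \<gamma>' where g': "\<gamma>' \<in> couplings (M \<bind> P \<bind> kernel_pow P t) N"
    "transport_cost \<gamma>' \<le> ennreal (q\<^sup>2) ^ t * transport_cost \<gamma>1"
    using Suc.IH[OF borel_prob_bind[OF Suc.prems(1) P] g1(1) AE_bind_P[OF Suc.prems(1,3)]] by blast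
  have "kernel_pow P (Suc t) = (\<lambda>h. P h \<bind> kernel_pow P t)" by (rule ext) simp
  then have "M \<bind> kernel_pow P (Suc t) = M \<bind> P \<bind> kernel_pow P t"
    using borel_probD(2)[OF Suc.prems(1)] P kernel_pow_P
    by (simp, intro bind_assoc[symmetric, where N=borel and R=borel] measurable_prob_algebraD)
       (auto cong: measurable_cong_sets)
  moreover have "transport_cost \<gamma>' \<le> ennreal (q\<^sup>2) ^ Suc t * transport_cost \<gamma>"
    using order_trans[OF g'(2) mult_left_mono[OF g1(2)]] by (simp add: mult_ac)
  ultimately show ?case using g'(1) by (intro bexI[of _ \<gamma>']) (simp_all only:)
qed

end

section \<open>Geometric ergodicity of driven recursions\<close>

lemma P2_borel_prob: "M \<in> P2 \<Longrightarrow> M \<in> borel_prob"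
  by (simp add: P2_def space_prob_algebra)

text \<open>By (a + b)^2 \<le> 2 (a^2 + b^2), any coupling of two laws in \<open>P2\<close> has
  finite cost; in particular the product coupling can start the iteration.\<close>

lemma transport_cost_second_moment:
  fixes M N :: "'a::euclidean_space measure"
  assumes M: "M \<in> borel_prob" and N: "N \<in> borel_prob" and g: "\<gamma> \<in> couplings M N"
  shows "transport_cost \<gamma> \<le> 2 * (second_moment M + second_moment N)"
proof -
  have g': "\<gamma> \<in> borel_prob" "distr \<gamma> borel fst = M" "distr \<gamma> borel snd = N"
    using g couplings_iff[OF M N] by auto
  note [measurable_cong] = borel_probD(2)[OF g'(1)]
  have [measurable]: "(\<lambda>x :: 'a. infnorm x) \<in> borel_measurable borel"
    by (intro borel_measurable_continuous_onI continuous_intros)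
  have "transport_cost \<gamma> \<le> (\<integral>\<^sup>+ z. 2 * (ennreal ((infnorm (fst z))\<^sup>2) + ennreal ((infnorm (snd z))\<^sup>2)) \<partial>\<gamma>)"
    unfolding transport_cost_eq
  proof (intro nn_integral_mono)
    fix z :: "'a \<times> 'a"
    let ?a = "infnorm (fst z)" and ?b = "infnorm (snd z)"
    have "infnorm (fst z - snd z) \<le> ?a + ?b"
      using infnorm_triangle[of "fst z" "- snd z"] by (simp add: infnorm_neg)
    then have "(infnorm (fst z - snd z))\<^sup>2 \<le> (?a + ?b)\<^sup>2"
      by (intro power_mono infnorm_pos_le)
    also have "\<dots> \<le> 2 * (?a\<^sup>2 + ?b\<^sup>2)"
      using sum_squares_bound[of ?a ?b] by (simp add: power2_sum)
    finally have "ennreal ((infnorm (fst z - snd z))\<^sup>2) \<le> ennreal (2 * (?a\<^sup>2 + ?b\<^sup>2))" by (rule ennreal_leI)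
    also have "\<dots> = 2 * (ennreal (?a\<^sup>2) + ennreal (?b\<^sup>2))"
      by (subst ennreal_mult) simp_all
    finally show "ennreal ((infnorm (fst z - snd z))\<^sup>2) \<le> 2 * (ennreal (?a\<^sup>2) + ennreal (?b\<^sup>2))" .
  qed
  also have "\<dots> = 2 * (second_moment M + second_moment N)"
    unfolding g'(2,3)[symmetric] second_moment_def
    by (simp add: nn_integral_cmult nn_integral_add nn_integral_distr)
  finally show ?thesis .
qed

context noisy_contraction
begin

text \<open>The (u,v)-part is bounded on S and the noise has a finite second moment; the square of a
  maximum is at most the sum of the squares.\<close>

lemma second_moment_attach:
  assumes M: "M \<in> borel_prob" and ae: "AE w in M. w \<in> S" and \<nu>: "\<nu> \<in> P2"
  shows "second_moment (M \<bind> attach_noise) < \<infinity>"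
proof -
  interpret M: prob_space M by (rule borel_probD(1)[OF M])
  interpret \<nu>: prob_space \<nu> by (rule borel_probD(1)[OF noise])
  obtain B where B: "0 \<le> B" "\<And>w. w \<in> S \<Longrightarrow> norm ((infnorm w)\<^sup>2) \<le> B"
    by (rule continuous_on_compact_bound[OF compact, of "\<lambda>w. (infnorm w)\<^sup>2"]) (auto intro!: continuous_intros)
  have "(\<lambda>x. infnorm x) \<in> borel_measurable (borel :: ('u \<times> 'v \<times> real) measure)"
    by (intro borel_measurable_continuous_onI continuous_intros)
  then have m: "(\<lambda>x. ennreal ((infnorm x)\<^sup>2)) \<in> borel_measurable (borel :: ('u \<times> 'v \<times> real) measure)"
    by measurable
  have "second_moment (M \<bind> attach_noise) = (\<integral>\<^sup>+ w. \<integral>\<^sup>+ h. ennreal ((infnorm h)\<^sup>2) \<partial>attach_noise w \<partial>M)"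
    unfolding second_moment_def by (rule nn_integral_borel_prob_bind[OF M attach_noise m])
  also have "\<dots> \<le> (\<integral>\<^sup>+ w. ennreal B + second_moment \<nu> \<partial>M)"
  proof (rule nn_integral_mono_AE, use ae in eventually_elim)
    fix w assume w: "w \<in> S"
    have "(\<integral>\<^sup>+ h. ennreal ((infnorm h)\<^sup>2) \<partial>attach_noise w) = (\<integral>\<^sup>+ \<eta>. ennreal ((infnorm (fst w, snd w, \<eta>))\<^sup>2) \<partial>\<nu>)"
      unfolding attach_noise_def using m by (subst nn_integral_distr[OF attach_noise_section]) simp_all
    also have "\<dots> \<le> (\<integral>\<^sup>+ \<eta>. ennreal B + ennreal ((infnorm \<eta>)\<^sup>2) \<partial>\<nu>)"
    proof (intro nn_integral_mono)
      fix \<eta> :: real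
      have "infnorm (fst w, snd w, \<eta>) = max (infnorm w) \<bar>\<eta>\<bar>"
        by (cases w) (simp add: infnorm_Pair)
      then have "(infnorm (fst w, snd w, \<eta>))\<^sup>2 \<le> (infnorm w)\<^sup>2 + \<eta>\<^sup>2"
        by (simp add: max_def)
      also have "\<dots> \<le> B + \<eta>\<^sup>2" using B(2)[OF w] by simp
      finally show "ennreal ((infnorm (fst w, snd w, \<eta>))\<^sup>2) \<le> ennreal B + ennreal ((infnorm \<eta>)\<^sup>2)"
        using B(1) by (simp add: ennreal_plus[symmetric] ennreal_leI del: ennreal_plus)
    qed
    also have "\<dots> = ennreal B + second_moment \<nu>"
      unfolding second_moment_def using borel_probD(2)[OF noise]
      by (subst nn_integral_add) (auto simp: \<nu>.emeasure_space_1 cong: measurable_cong_sets)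
    finally show "(\<integral>\<^sup>+ h. ennreal ((infnorm h)\<^sup>2) \<partial>attach_noise w) \<le> ennreal B + second_moment \<nu>" .
  qed
  also have "\<dots> < \<infinity>"
    using \<nu> by (simp add: M.emeasure_space_1 P2_def less_top)
  finally show ?thesis .
qed

lemma geometric_ergodicity:
  assumes S: "S \<noteq> {}" and q: "q < 1" and \<nu>: "\<nu> \<in> P2"
    and \<rho>: "\<rho> \<in> P2" and ae: "AE h in \<rho>. pr h \<in> S"
  obtains \<mu> c where "\<mu> \<in> P2" "AE h in \<mu>. pr h \<in> S" "\<mu> \<bind> P = \<mu>" "0 < c"
    "\<And>t. Wass2 (\<rho> \<bind> kernel_pow P t) \<mu> \<le> ennreal (c * q ^ t)"
proof -
  obtain \<pi> where \<pi>: "\<pi> \<in> borel_prob" "AE x in \<pi>. x \<in> S" "\<pi> \<bind> K = \<pi>"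
    using stationary_exists[OF S q] .
  define \<mu> where "\<mu> = \<pi> \<bind> attach_noise"
  have \<mu>: "\<mu> \<in> borel_prob" unfolding \<mu>_def by (rule borel_prob_bind[OF \<pi>(1) attach_noise])
  have \<mu>_pr: "distr \<mu> borel pr = \<pi>" unfolding \<mu>_def by (rule distr_bind_attach_pr[OF \<pi>(1)])
  have \<mu>_S: "AE h in \<mu>. pr h \<in> S" using AE_distr_pr[OF \<mu>] \<pi>(2) unfolding \<mu>_pr by blast
  have inv: "\<mu> \<bind> P = \<mu>" unfolding bind_P[OF \<mu>] \<mu>_pr \<pi>(3) by (simp add: \<mu>_def)
  have fin: "second_moment \<mu> < \<infinity>"
    unfolding \<mu>_def by (rule second_moment_attach[OF \<pi>(1,2) \<nu>])
  have \<mu>P2: "\<mu> \<in> P2" using \<mu> fin by (simp add: P2_def borel_probD)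
  note \<rho>' = P2_borel_prob[OF \<rho>]
  have g: "\<rho> \<Otimes>\<^sub>M \<mu> \<in> couplings \<rho> \<mu>" by (intro pair_coupling borel_probD(1) \<rho>' \<mu>)
  have "2 * (second_moment \<rho> + second_moment \<mu>) < \<infinity>"
    using \<rho> fin by (simp add: P2_def ennreal_mult_less_top)
  with transport_cost_second_moment[OF \<rho>' \<mu> g] have "transport_cost (\<rho> \<Otimes>\<^sub>M \<mu>) < \<infinity>"
    by (rule le_less_trans)
  then obtain r where r: "0 \<le> r" "transport_cost (\<rho> \<Otimes>\<^sub>M \<mu>) = ennreal r"
    by (cases "transport_cost (\<rho> \<Otimes>\<^sub>M \<mu>)") auto
  \<comment> \<open>The summand 1 keeps the constant positive when the initial cost is 0.\<close>
  define c where "c = sqrt r + 1"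
  have c: "0 < c" using r(1) by (simp add: c_def add_nonneg_pos)
  have "r \<le> c\<^sup>2" using r(1) by (simp add: c_def power2_sum)
  have "Wass2 (\<rho> \<bind> kernel_pow P t) \<mu> \<le> ennreal (c * q ^ t)" for t
  proof -
    obtain \<gamma>' where g': "\<gamma>' \<in> couplings (\<rho> \<bind> kernel_pow P t) \<mu>"
      "transport_cost \<gamma>' \<le> ennreal (q\<^sup>2) ^ t * transport_cost (\<rho> \<Otimes>\<^sub>M \<mu>)"
      using joint_coupling_pow[OF \<rho>' \<mu> g ae \<mu>_S inv] by blast
    note g'(2)
    also have "ennreal (q\<^sup>2) ^ t * transport_cost (\<rho> \<Otimes>\<^sub>M \<mu>) = ennreal ((q\<^sup>2) ^ t * r)"
      using r by (simp add: ennreal_power ennreal_mult)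
    also have "\<dots> \<le> ennreal ((c * q ^ t)\<^sup>2)"
      using mult_right_mono[OF \<open>r \<le> c\<^sup>2\<close>, of "(q\<^sup>2) ^ t"] q_nonneg
      by (intro ennreal_leI) (simp add: power_mult_distrib power_mult[symmetric] mult.commute zero_le_even_power)
    finally show ?thesis
      using c q_nonneg by (intro Wass2_leI[OF g'(1)]) auto
  qed
  with that \<mu>P2 \<mu>_S inv c show ?thesis by blast
qed

end

section \<open>Kernels made of a random driver and a deterministic response\<close>

lemma pair_measure_eq_bind_distr:
  fixes M :: "'a::second_countable_topology measure" and N :: "'b::second_countable_topology measure"
  assumes M: "M \<in> borel_prob" and N: "N \<in> borel_prob"
  shows "M \<Otimes>\<^sub>M N = M \<bind> (\<lambda>x. distr N borel (Pair x))"
proof -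
  interpret M: prob_space M by (rule borel_probD(1)[OF M])
  interpret N: prob_space N by (rule borel_probD(1)[OF N])
  interpret pair_prob_space M N ..
  have s: "sets (M \<Otimes>\<^sub>M N) = sets borel"
    using sets_pair_measure_cong[OF borel_probD(2)[OF M] borel_probD(2)[OF N]] unfolding borel_prod .
  have "N \<bind> (\<lambda>y. return (M \<Otimes>\<^sub>M N) (x, y)) = distr N borel (Pair x)" if "x \<in> space M" for x
  proof -
    have "N \<bind> (\<lambda>y. return (M \<Otimes>\<^sub>M N) (x, y)) = distr N (M \<Otimes>\<^sub>M N) (Pair x)"
      using that N.not_empty by (intro bind_return_distr') auto
    also have "\<dots> = distr N borel (Pair x)" using s by (intro distr_cong) auto
    finally show ?thesis .
  qed
  then show ?thesis
    by (subst pair_measure_eq_bind) (rule bind_cong[OF refl])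
qed

text \<open>
  The max-norm of a pair is a maximum; bounding its square by the sum of squares is what produces
  q^2 = L^2 + L_bar^2.
\<close>

lemma Wass2_distr_Pair_le:
  fixes M N :: "'u::euclidean_space measure" and y y' :: "'v::euclidean_space"
  assumes M: "M \<in> borel_prob" and N: "N \<in> borel_prob"
    and W: "Wass2 M N \<le> ennreal a" and a: "0 \<le> a"
    and y: "infnorm (y - y') \<le> b"
  shows "Wass2 (distr M borel (\<lambda>x. (x, y))) (distr N borel (\<lambda>x. (x, y'))) \<le> ennreal (sqrt (a\<^sup>2 + b\<^sup>2))"
proof -
  have b: "0 \<le> b" using y infnorm_pos_le[of "y - y'"] by linarith
  have mP [measurable]: "(\<lambda>x. (x, z)) \<in> borel_measurable borel" for z :: 'v
    by (intro borel_measurable_continuous_onI continuous_intros) 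
  have mPP: "(\<lambda>z. ((fst z, y), (snd z, y'))) \<in> borel_measurable (borel :: ('u \<times> 'u) measure)"
    by (intro borel_measurable_continuous_onI continuous_intros)
  note M' = borel_prob_distr[OF M mP] and N' = borel_prob_distr[OF N mP]
  let ?M = "distr M borel (\<lambda>x. (x, y))" and ?N = "distr N borel (\<lambda>x. (x, y'))"
  have "(INF \<gamma>\<in>couplings ?M ?N. transport_cost \<gamma>) \<le> ennreal (a\<^sup>2 + b\<^sup>2)"
  proof (rule ennreal_le_epsilon)
    fix e :: real assume e: "0 < e"
    obtain \<gamma> where g: "\<gamma> \<in> couplings M N" "transport_cost \<gamma> \<le> ennreal (a\<^sup>2 + e)"
      using Wass2_le_coupling[OF W a e] .
    have g': "\<gamma> \<in> borel_prob" "distr \<gamma> borel fst = M" "distr \<gamma> borel snd = N"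
      using g couplings_iff[OF M N] by auto
    interpret prob_space \<gamma> by (rule borel_probD(1)[OF g'(1)])
    note [measurable_cong] = borel_probD(2)[OF g'(1)]
    \<comment> \<open>The second components are constants, so \<gamma> extends to the pairs in the
      only possible way.\<close>
    define \<delta> where "\<delta> = distr \<gamma> borel (\<lambda>z. ((fst z, y), (snd z, y')))"
    have mPP': "(\<lambda>z. ((fst z, y), (snd z, y'))) \<in> borel_measurable \<gamma>" using mPP by simp
    have "distr \<delta> borel fst = ?M" "distr \<delta> borel snd = ?N"
      unfolding \<delta>_def g'(2,3)[symmetric]
      using distr_distr[OF measurable_fst_snd_borel(1) mPP'] distr_distr[OF measurable_fst_snd_borel(2) mPP']
      by (simp_all add: distr_distr comp_def)
    then have "\<delta> \<in> couplings ?M ?N"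
      using couplings_iff[OF M' N'] borel_prob_distr[OF g'(1) mPP] by (simp add: \<delta>_def)
    moreover have "transport_cost \<delta> \<le> ennreal (a\<^sup>2 + b\<^sup>2) + ennreal e"
    proof -
      have "transport_cost \<delta> = (\<integral>\<^sup>+ z. ennreal ((infnorm ((fst z, y) - (snd z, y')))\<^sup>2) \<partial>\<gamma>)"
        unfolding transport_cost_eq \<delta>_def by (subst nn_integral_distr[OF mPP']) simp_all
      also have "\<dots> \<le> (\<integral>\<^sup>+ z. ennreal ((infnorm (fst z - snd z))\<^sup>2) + ennreal (b\<^sup>2) \<partial>\<gamma>)"
      proof (intro nn_integral_mono)
        fix z :: "'u \<times> 'u"
        have "infnorm ((fst z, y) - (snd z, y')) \<le> max (infnorm (fst z - snd z)) b"
          using y by (auto simp: infnorm_Pair)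
        then have "(infnorm ((fst z, y) - (snd z, y')))\<^sup>2 \<le> (max (infnorm (fst z - snd z)) b)\<^sup>2"
          by (intro power_mono infnorm_pos_le)
        also have "\<dots> \<le> (infnorm (fst z - snd z))\<^sup>2 + b\<^sup>2" by (simp add: max_def)
        finally show "ennreal ((infnorm ((fst z, y) - (snd z, y')))\<^sup>2)
          \<le> ennreal ((infnorm (fst z - snd z))\<^sup>2) + ennreal (b\<^sup>2)"
          by (simp add: ennreal_plus[symmetric] ennreal_leI del: ennreal_plus)
      qed
      also have "\<dots> = transport_cost \<gamma> + ennreal (b\<^sup>2)"
        unfolding transport_cost_eq by (subst nn_integral_add) (auto simp: emeasure_space_1)
      also have "\<dots> \<le> ennreal (a\<^sup>2 + e) + ennreal (b\<^sup>2)" by (intro add_right_mono g)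
      also have "\<dots> = ennreal (a\<^sup>2 + b\<^sup>2) + ennreal e"
        using e by (simp add: ennreal_plus[symmetric] add_ac del: ennreal_plus)
      finally show ?thesis .
    qed
    ultimately show "(INF \<gamma>\<in>couplings ?M ?N. transport_cost \<gamma>) \<le> ennreal (a\<^sup>2 + b\<^sup>2) + ennreal e"
      by (rule INF_lower2)
  qed
  then show ?thesis unfolding Wass2_eq by (subst ennreal_sqrt_le_iff) simp_all
qed

text \<open>Both components of the new pair depend on the old pair only. At distance d the random
  one contributes L d and the deterministic one Lb d, and these add in quadrature to q d.\<close>

lemma driven_recursion_contraction:
  fixes \<kappa> :: "'u::euclidean_space \<Rightarrow> 'u measure" and F :: "'u \<Rightarrow> 'v::euclidean_space \<Rightarrow> 'v"
  assumes \<kappa>: "\<kappa> \<in> borel \<rightarrow>\<^sub>M prob_algebra borel"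
    and F: "(\<lambda>w. F (fst w) (snd w)) \<in> borel_measurable borel"
    and U: "compact U" and V: "compact V"
    and \<kappa>_U: "\<And>u. u \<in> U \<Longrightarrow> AE x in \<kappa> u. x \<in> U"
    and F_V: "\<And>u v. u \<in> U \<Longrightarrow> v \<in> V \<Longrightarrow> F u v \<in> V"
    and \<kappa>_lip: "\<And>u u'. u \<in> U \<Longrightarrow> u' \<in> U \<Longrightarrow> Wass2 (\<kappa> u) (\<kappa> u') \<le> ennreal (L * infnorm (u - u'))"
    and F_lip: "\<And>u v u' v'. u \<in> U \<Longrightarrow> u' \<in> U \<Longrightarrow> v \<in> V \<Longrightarrow> v' \<in> V \<Longrightarrow>
      infnorm (F u v - F u' v') \<le> Lb * infnorm ((u, v) - (u', v'))"
    and L: "0 \<le> L" and Lb: "0 \<le> Lb" and q: "0 \<le> q" "q\<^sup>2 = L\<^sup>2 + Lb\<^sup>2" 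
  shows "wass_contraction (\<lambda>w. distr (\<kappa> (fst w)) borel (\<lambda>u'. (u', F (fst w) (snd w)))) (U \<times> V) q"
proof
  have \<kappa>': "\<kappa> u \<in> borel_prob" for u using measurable_space[OF \<kappa>, of u] by simp
  have mP: "(\<lambda>x :: 'u. (x, z)) \<in> borel_measurable borel" for z :: 'v
    by (intro borel_measurable_continuous_onI continuous_intros)
  show "(\<lambda>w. distr (\<kappa> (fst w)) borel (\<lambda>u'. (u', F (fst w) (snd w)))) \<in> borel \<rightarrow>\<^sub>M prob_algebra borel"
  proof (rule measurable_distr_prob_space2[where M=borel])
    show "(\<lambda>w :: 'u \<times> 'v. \<kappa> (fst w)) \<in> borel \<rightarrow>\<^sub>M prob_algebra borel"
      by (rule measurable_compose[OF measurable_fst_snd_borel(1) \<kappa>])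
    have "(\<lambda>z :: ('u \<times> 'v) \<times> 'u. (snd z, F (fst (fst z)) (snd (fst z)))) \<in> borel_measurable borel"
      by (rule measurable_Pair_borel[OF measurable_fst_snd_borel(2) measurable_compose[OF measurable_fst_snd_borel(1) F]])
    then show "(\<lambda>(w, u' :: 'u). (u', F (fst w) (snd w))) \<in> borel \<Otimes>\<^sub>M borel \<rightarrow>\<^sub>M borel"
      by (simp add: borel_prod case_prod_beta)
  qed
  show "compact (U \<times> V)" using U V by (rule compact_Times)
  have "U \<times> V \<in> sets borel" using compact_Times[OF U V] by (simp add: compact_imp_closed)
  then have "{x \<in> space borel. x \<in> U \<times> V} \<in> sets borel" by (simp only: space_borel UNIV_I simp_thms Collect_mem_eq)
  then show "AE x in distr (\<kappa> (fst w)) borel (\<lambda>u'. (u', F (fst w) (snd w))). x \<in> U \<times> V" if "w \<in> U \<times> V" for w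
    using that \<kappa>_U[of "fst w"] F_V[of "fst w" "snd w"] mP borel_probD(2)[OF \<kappa>']
    by (subst AE_distr_iff) (auto cong: measurable_cong_sets)
  show "0 \<le> q" by fact
  fix w w' assume w: "w \<in> U \<times> V" "w' \<in> U \<times> V"
  let ?d = "infnorm (w - w')"
  have "infnorm (fst w - fst w') \<le> ?d" by (cases w; cases w') (simp add: infnorm_Pair)
  then have "L * infnorm (fst w - fst w') \<le> L * ?d" using L by (rule mult_left_mono)
  then have "Wass2 (\<kappa> (fst w)) (\<kappa> (fst w')) \<le> ennreal (L * ?d)"
    using w by (intro order_trans[OF \<kappa>_lip] ennreal_leI) auto
  moreover have "infnorm (F (fst w) (snd w) - F (fst w') (snd w')) \<le> Lb * ?d"
    using F_lip[of "fst w" "fst w'" "snd w" "snd w'"] w by (simp add: mem_Times_iff)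
  ultimately have "Wass2 (distr (\<kappa> (fst w)) borel (\<lambda>u'. (u', F (fst w) (snd w))))
    (distr (\<kappa> (fst w')) borel (\<lambda>u'. (u', F (fst w') (snd w')))) \<le> ennreal (sqrt ((L * ?d)\<^sup>2 + (Lb * ?d)\<^sup>2))"
    using L infnorm_pos_le[of "w - w'"] by (intro Wass2_distr_Pair_le \<kappa>') auto
  also have "(L * ?d)\<^sup>2 + (Lb * ?d)\<^sup>2 = (q * ?d)\<^sup>2" by (simp add: power_mult_distrib q(2) algebra_simps)
  finally show "Wass2 (distr (\<kappa> (fst w)) borel (\<lambda>u'. (u', F (fst w) (snd w))))
    (distr (\<kappa> (fst w')) borel (\<lambda>u'. (u', F (fst w') (snd w')))) \<le> ennreal (q * ?d)"
    using q(1) infnorm_pos_le[of "w - w'"] by simp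
qed

text \<open>The left side is the form of \<open>joint_kernel\<close>, the right side the
  factorization behind P. A product with a Dirac mass is a push-forward under pairing.\<close>

lemma driven_recursion_noise:
  fixes M :: "'u::euclidean_space measure" and y :: "'v::euclidean_space" and \<nu> :: "real measure"
  assumes M: "M \<in> borel_prob" and \<nu>: "\<nu> \<in> borel_prob"
  shows "M \<Otimes>\<^sub>M (return borel y \<Otimes>\<^sub>M \<nu>) =
    distr M borel (\<lambda>x. (x, y)) \<bind> (\<lambda>w. distr \<nu> borel (\<lambda>\<eta>. (fst w, snd w, \<eta>)))"
proof -
  have r: "return borel y \<in> borel_prob" by (simp add: space_prob_algebra prob_space_return)
  have y\<nu>: "return borel y \<Otimes>\<^sub>M \<nu> = distr \<nu> borel (Pair y)"
    unfolding pair_measure_eq_bind_distr[OF r \<nu>]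
  proof (rule bind_return)
    show "(\<lambda>x :: 'v. distr \<nu> borel (Pair x)) \<in> borel \<rightarrow>\<^sub>M subprob_algebra borel"
      by (intro measurable_prob_algebraD measurable_distr_prob_space2[where M=borel] measurable_const[OF \<nu>])
         (unfold borel_prod, simp)
  qed simp
  have P\<nu>: "Pair a \<in> borel_measurable \<nu>" for a :: 'v
    unfolding measurable_cong_sets[OF borel_probD(2)[OF \<nu>] refl]
    by (intro borel_measurable_continuous_onI continuous_intros)
  have Pv: "Pair a \<in> borel_measurable borel" for a :: 'u
    by (intro borel_measurable_continuous_onI continuous_intros)
  have mP: "(\<lambda>x :: 'u. (x, y)) \<in> borel_measurable borel"
    by (intro borel_measurable_continuous_onI continuous_intros)
  have k: "(\<lambda>w :: 'u \<times> 'v. distr \<nu> borel (\<lambda>\<eta>. (fst w, snd w, \<eta>))) \<in> borel \<rightarrow>\<^sub>M prob_algebra borel"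
  proof (rule measurable_distr_prob_space2[where M=borel])
    show "(\<lambda>w. \<nu>) \<in> borel \<rightarrow>\<^sub>M prob_algebra borel" by (rule measurable_const[OF \<nu>])
    have "(\<lambda>z. (fst (fst z), snd (fst z), snd z)) \<in> borel_measurable (borel :: (('u \<times> 'v) \<times> real) measure)"
      by (intro borel_measurable_continuous_onI continuous_intros)
    then show "(\<lambda>(w :: 'u \<times> 'v, \<eta> :: real). (fst w, snd w, \<eta>)) \<in> borel \<Otimes>\<^sub>M borel \<rightarrow>\<^sub>M borel"
      by (simp add: borel_prod case_prod_beta)
  qed
  have "M \<Otimes>\<^sub>M (return borel y \<Otimes>\<^sub>M \<nu>) = M \<bind> (\<lambda>x. distr (distr \<nu> borel (Pair y)) borel (Pair x))"
    unfolding y\<nu> using P\<nu>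
    by (intro pair_measure_eq_bind_distr M) (simp add: space_prob_algebra borel_probD(1)[OF \<nu>] prob_space.prob_space_distr)
  also have "\<dots> = M \<bind> (\<lambda>x. distr \<nu> borel (\<lambda>\<eta>. (x, y, \<eta>)))"
    by (simp add: distr_distr[OF Pv P\<nu>] comp_def)
  also have "\<dots> = distr M borel (\<lambda>x. (x, y)) \<bind> (\<lambda>w. distr \<nu> borel (\<lambda>\<eta>. (fst w, snd w, \<eta>)))"
    using bind_distr_borel_prob[OF M k mP] by simp
  finally show ?thesis .
qed

section \<open>Box invariance and Lipschitz constant of the recursion map\<close>

lemma infnorm_le_iff: "infnorm x \<le> c \<longleftrightarrow> (\<forall>b\<in>Basis. \<bar>x \<bullet> b\<bar> \<le> c)"
  by (auto simp: infnorm_Max)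

lemma infnorm_vec_le_iff:
  fixes x :: "'a::euclidean_space^'n"
  shows "infnorm x \<le> c \<longleftrightarrow> (\<forall>i. infnorm (x $ i) \<le> c)"
  unfolding infnorm_le_iff by (auto simp: Basis_vec_def inner_axis)

section \<open>Bounds for the derivatives of the sigmoid\<close>

lemma sigmoid_range: "0 < sigmoid y" "sigmoid y < 1"
  unfolding sigmoid_def by (auto simp: field_simps add_pos_pos)

lemma has_field_derivative_sigmoid:
  "(sigmoid has_field_derivative sigmoid y * (1 - sigmoid y)) (at y)"
proof -
  have "1 + exp (- y) \<noteq> 0" using exp_gt_zero[of "- y"] by linarith
  then show ?thesis
    unfolding sigmoid_def
    by (auto intro!: derivative_eq_intros simp: field_simps power2_eq_square)
qed

lemma deriv_sigmoid: "deriv sigmoid = (\<lambda>y. sigmoid y * (1 - sigmoid y))"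
  using has_field_derivative_sigmoid by (intro ext DERIV_imp_deriv)

lemma has_field_derivative_deriv_sigmoid:
  "(deriv sigmoid has_field_derivative sigmoid y * (1 - sigmoid y) * (1 - 2 * sigmoid y)) (at y)"
  unfolding deriv_sigmoid
  by (auto intro!: derivative_eq_intros has_field_derivative_sigmoid simp: algebra_simps)

lemma deriv2_sigmoid: "deriv (deriv sigmoid) = (\<lambda>y. sigmoid y * (1 - sigmoid y) * (1 - 2 * sigmoid y))"
  using has_field_derivative_deriv_sigmoid by (intro ext DERIV_imp_deriv)

lemma has_field_derivative_deriv2_sigmoid:
  "(deriv (deriv sigmoid) has_field_derivative
    sigmoid y * (1 - sigmoid y) * (1 - 6 * (sigmoid y * (1 - sigmoid y)))) (at y)"
  unfolding deriv2_sigmoid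
  by (auto intro!: derivative_eq_intros has_field_derivative_sigmoid simp: algebra_simps)

text \<open>At y = sigmoid(x) the three products are the first three derivatives of the sigmoid. All
  bounds reduce to t = y (1 - y) in [0, 1/4], because (1 - 2 y)^2 = 1 - 4 t.\<close>

lemma unit_interval_product_bounds:
  fixes y :: real
  assumes "0 \<le> y" "y \<le> 1"
  shows "\<bar>y * (1 - y)\<bar> \<le> 1/4" "\<bar>y * (1 - y) * (1 - 2 * y)\<bar> \<le> 1/10"
    "\<bar>y * (1 - y) * (1 - 6 * (y * (1 - y)))\<bar> \<le> 1/8"
proof -
  define t where "t = y * (1 - y)"
  have t0: "0 \<le> t" using assms by (simp add: t_def)
  have sq: "(1 - 2 * y)\<^sup>2 = 1 - 4 * t" by (simp add: t_def power2_eq_square algebra_simps)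
  then have t1: "t \<le> 1/4" using zero_le_power2[of "1 - 2 * y"] by linarith
  show "\<bar>y * (1 - y)\<bar> \<le> 1/4" using t0 t1 by (simp add: t_def[symmetric])
  have "(t * (1 - 2 * y))\<^sup>2 = t\<^sup>2 * (1 - 4 * t)" by (simp add: power_mult_distrib sq)
  also have "\<dots> \<le> 1/108"
  proof -
    \<comment> \<open>The cubic t^2 (1 - 4 t) has its maximum 1/108 at t = 1/6, hence the double
      root there. The constant 1/10 is the square root of 1/108 rounded up.\<close>
    have "1/108 - t\<^sup>2 * (1 - 4 * t) = 4 * (t - 1/6)\<^sup>2 * (t + 1/12)"
      by (simp add: power2_eq_square algebra_simps)
    moreover have "\<dots> \<ge> 0" using t0 by (intro mult_nonneg_nonneg) auto
    ultimately show ?thesis by linarith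
  qed
  also have "\<dots> \<le> (1/10)\<^sup>2" by (simp add: power2_eq_square)
  finally show "\<bar>y * (1 - y) * (1 - 2 * y)\<bar> \<le> 1/10"
    unfolding t_def[symmetric] by (subst (asm) abs_le_square_iff[symmetric]) simp
  have "\<bar>t * (1 - 6 * t)\<bar> \<le> 1/8"
  proof (rule abs_leI)
    have "1/8 - t * (1 - 6 * t) = 6 * (t - 1/12)\<^sup>2 + 1/12" by (simp add: power2_eq_square algebra_simps)
    then show "t * (1 - 6 * t) \<le> 1/8" using zero_le_power2[of "t - 1/12"] by linarith
    \<comment> \<open>The binding side of the estimate: equality holds at t = 1/4, that is y = 1/2,
      and produces the constant 1/8.\<close>
    have "t * (6 * t - 1) \<le> (1/4) * (1/2)"
    proof (cases "6 * t \<le> 1")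
      case True
      then have "t * (6 * t - 1) \<le> 0" using t0 by (simp add: mult_nonneg_nonpos)
      then show ?thesis by simp
    qed (use t0 t1 in \<open>intro mult_mono; auto\<close>)
    then show "- (t * (1 - 6 * t)) \<le> 1/8" by (simp add: algebra_simps)
  qed
  then show "\<bar>y * (1 - y) * (1 - 6 * (y * (1 - y)))\<bar> \<le> 1/8" by (simp add: t_def)
qed

lemma sigmoid_deriv_bounds: "\<bar>deriv sigmoid y\<bar> \<le> 1/4" "\<bar>deriv (deriv sigmoid) y\<bar> \<le> 1/10"
  using unit_interval_product_bounds(1,2)[of "sigmoid y"] less_imp_le[OF sigmoid_range(1)[of y]]
    less_imp_le[OF sigmoid_range(2)[of y]]
  unfolding deriv2_sigmoid unfolding deriv_sigmoid by simp_all

lemma sigmoid_lipschitz: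
  "\<bar>sigmoid a - sigmoid b\<bar> \<le> 1/4 * \<bar>a - b\<bar>"
  "\<bar>deriv sigmoid a - deriv sigmoid b\<bar> \<le> 1/10 * \<bar>a - b\<bar>"
  "\<bar>deriv (deriv sigmoid) a - deriv (deriv sigmoid) b\<bar> \<le> 1/8 * \<bar>a - b\<bar>"
proof -
  have *: "\<bar>f a - f b\<bar> \<le> B * \<bar>a - b\<bar>"
    if "\<And>y. (f has_field_derivative f' y) (at y)" "\<And>y. \<bar>f' y\<bar> \<le> B" for f f' :: "real \<Rightarrow> real" and B
    using field_differentiable_bound[of UNIV f f' B a b] that by simp
  note b = unit_interval_product_bounds[OF less_imp_le less_imp_le, OF sigmoid_range]
  show "\<bar>sigmoid a - sigmoid b\<bar> \<le> 1/4 * \<bar>a - b\<bar>"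
    by (rule *[OF has_field_derivative_sigmoid b(1)])
  show "\<bar>deriv sigmoid a - deriv sigmoid b\<bar> \<le> 1/10 * \<bar>a - b\<bar>"
    by (rule *[OF has_field_derivative_deriv_sigmoid b(2)])
  show "\<bar>deriv (deriv sigmoid) a - deriv (deriv sigmoid) b\<bar> \<le> 1/8 * \<bar>a - b\<bar>"
    by (rule *[OF has_field_derivative_deriv2_sigmoid b(3)])
qed

lemma continuous_on_sigmoid:
  "continuous_on S sigmoid" "continuous_on S (deriv sigmoid)" "continuous_on S (deriv (deriv sigmoid))"
  using has_field_derivative_sigmoid has_field_derivative_deriv_sigmoid has_field_derivative_deriv2_sigmoid
  by (auto intro!: continuous_at_imp_continuous_on DERIV_isCont)

section \<open>Elementary estimates for products and averages\<close>

lemma abs_mult_diff_le: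
  fixes a b a' b' :: real
  assumes "\<bar>a - a'\<bar> \<le> da" "\<bar>b - b'\<bar> \<le> db" "\<bar>b\<bar> \<le> Bb" "\<bar>a'\<bar> \<le> Ba"
  shows "\<bar>a * b - a' * b'\<bar> \<le> da * Bb + Ba * db"
proof -
  have "a * b - a' * b' = (a - a') * b + a' * (b - b')" by (simp add: algebra_simps)
  then have "\<bar>a * b - a' * b'\<bar> \<le> \<bar>a - a'\<bar> * \<bar>b\<bar> + \<bar>a'\<bar> * \<bar>b - b'\<bar>"
    by (metis abs_mult abs_triangle_ineq)
  also have "\<dots> \<le> da * Bb + Ba * db"
    using assms by (intro add_mono mult_mono) auto
  finally show ?thesis .
qed

lemma abs_mean_mult_le:
  fixes c y :: "'n::finite \<Rightarrow> real"
  assumes "\<And>l. \<bar>c l\<bar> \<le> C" "\<And>l. \<bar>y l\<bar> \<le> b"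
  shows "\<bar>1 / real CARD('n) * (\<Sum>l\<in>UNIV. c l * y l)\<bar> \<le> C * b"
proof -
  have "0 \<le> C" using assms(1)[of undefined] by linarith
  then have "\<bar>\<Sum>l\<in>UNIV. c l * y l\<bar> \<le> real CARD('n) * (C * b)"
    by (intro order_trans[OF sum_abs] sum_bounded_above) (auto simp: abs_mult intro!: mult_mono assms)
  then show ?thesis by (simp add: abs_mult field_simps)
qed

lemma abs_mean_mult_diff_le:
  fixes c y y' :: "'n::finite \<Rightarrow> real"
  assumes "\<And>l. \<bar>c l\<bar> \<le> C" "\<And>l. \<bar>y l - y' l\<bar> \<le> b"
  shows "\<bar>1 / real CARD('n) * (\<Sum>l\<in>UNIV. c l * y l) - 1 / real CARD('n) * (\<Sum>l\<in>UNIV. c l * y' l)\<bar> \<le> C * b"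
proof -
  have "1 / real CARD('n) * (\<Sum>l\<in>UNIV. c l * y l) - 1 / real CARD('n) * (\<Sum>l\<in>UNIV. c l * y' l)
    = 1 / real CARD('n) * (\<Sum>l\<in>UNIV. c l * (y l - y' l))"
    by (simp add: sum_subtractf right_diff_distrib)
  then show ?thesis using abs_mean_mult_le[of c C "\<lambda>l. y l - y' l" b] assms by simp
qed

lemma v_boxD:
  fixes s :: "real^'n::finite" and sA :: "real^'n^('n \<times> 'd::finite)"
  assumes "(s, (sA, sW), (sAA, sWA, sWW)) \<in> v_box C C' C''"
  shows "s $ k \<in> {0..1}"
    "\<bar>sA $ \<alpha> $ k\<bar> \<le> C' / (real CARD('d) * (4 - C))"
    "\<bar>sW $ \<alpha>' $ k\<bar> \<le> C' / (real CARD('n) * (4 - C))"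
    "\<bar>sAA $ \<alpha> $ \<beta> $ k\<bar> \<le> a_AA CARD('d) C C' C'' / (1 - C/4)"
    "\<bar>sWA $ \<alpha>' $ \<beta> $ k\<bar> \<le> a_WA CARD('n) CARD('d) C C' / (1 - C/4)"
    "\<bar>sWW $ \<alpha>' $ \<beta>' $ k\<bar> \<le> a_WW CARD('n) C C' C'' / (1 - C/4)"
  using assms unfolding v_box_def mem_Collect_eq prod.case by blast+

text \<open>The network parameter stays fixed, so \<phi> and its derivatives enter as bounded
  coefficients; only the state varies.\<close>

locale activation =
  fixes \<phi> :: "real \<Rightarrow> real" and C C' C'' :: real
  assumes \<phi>0: "\<bar>\<phi> y\<bar> \<le> C" and C4: "C < 4"
    and \<phi>1: "\<bar>deriv \<phi> y\<bar> \<le> C'" and \<phi>2: "\<bar>deriv (deriv \<phi>) y\<bar> \<le> C''"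
begin

lemma C_nonneg: "0 \<le> C" "0 \<le> C'" "0 \<le> C''"
  using \<phi>0[of 0] \<phi>1[of 0] \<phi>2[of 0] by linarith+

lemma M_phi_pos: "0 \<le> M_phi C"
  using C4 C_nonneg by (simp add: M_phi_def)

lemma weighted_abs_le:
  fixes \<beta> :: real
  assumes "0 < n" "\<bar>y\<bar> \<le> b" "\<bar>c\<bar> \<le> B" "0 \<le> \<beta>" "\<beta> \<le> 1"
  shows "\<bar>1 / real n * \<beta> * c * y\<bar> \<le> B * b / real n"
proof -
  have "\<bar>\<beta> * (c * y)\<bar> \<le> 1 * (B * b)"
    unfolding abs_mult using assms by (intro mult_mono) auto
  then show ?thesis using assms(1) by (simp add: abs_mult field_simps)
qed

lemma of_bool_bounds: "0 \<le> (of_bool b :: real)" "(of_bool b :: real) \<le> 1"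
  by auto

text \<open>The factor 2 counts the two averages, one over x and one over s; each has Lipschitz
  constant C for the max-norm.\<close>

lemma preact_diff:
  assumes "\<And>j. \<bar>x $ j - x' $ j\<bar> \<le> \<delta>" "\<And>l. \<bar>s $ l - s' $ l\<bar> \<le> \<delta>"
  shows "\<bar>preact \<phi> \<theta> x s k - preact \<phi> \<theta> x' s' k\<bar> \<le> 2 * C * \<delta>"
proof (cases \<theta>)
  case (fields A W B c)
  have "\<bar>1 / real CARD('a) * (\<Sum>j\<in>UNIV. \<phi> (A $ k $ j) * x $ j) - 1 / real CARD('a) * (\<Sum>j\<in>UNIV. \<phi> (A $ k $ j) * x' $ j)\<bar> \<le> C * \<delta>"
    "\<bar>1 / real CARD('b) * (\<Sum>j\<in>UNIV. \<phi> (W $ k $ j) * s $ j) - 1 / real CARD('b) * (\<Sum>j\<in>UNIV. \<phi> (W $ k $ j) * s' $ j)\<bar> \<le> C * \<delta>"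
    by (intro abs_mean_mult_diff_le \<phi>0 assms)+
  then show ?thesis by (simp add: fields inner_vec_def)
qed

text \<open>The common shape of all p and r quantities: a direct term, in which \<beta> stands for
  the Kronecker deltas, plus a weighted average of the preceding array. The weight 1/N makes the
  second part C-Lipschitz whatever the number of units.\<close>

lemma recursion_diff:
  fixes y y' :: "'n::finite \<Rightarrow> real" and \<beta> :: real
  assumes "\<bar>\<xi> - \<xi>'\<bar> \<le> \<delta>" "\<And>l. \<bar>y l - y' l\<bar> \<le> \<delta>" "\<bar>c\<bar> \<le> B" "0 \<le> \<beta>" "\<beta> \<le> 1" "0 < n"
    and "\<And>l. \<bar>w l\<bar> \<le> C"
  shows "\<bar>(1 / real n * \<beta> * c * \<xi> + 1 / real CARD('n) * (\<Sum>l\<in>UNIV. w l * y l))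
    - (1 / real n * \<beta> * c * \<xi>' + 1 / real CARD('n) * (\<Sum>l\<in>UNIV. w l * y' l))\<bar> \<le> (B / real n + C) * \<delta>"
proof -
  have "\<bar>1 / real n * \<beta> * c * (\<xi> - \<xi>')\<bar> \<le> B * \<delta> / real n"
    using assms by (intro weighted_abs_le)
  then have "\<bar>1 / real n * \<beta> * c * \<xi> - 1 / real n * \<beta> * c * \<xi>'\<bar> \<le> B / real n * \<delta>"
    by (simp add: right_diff_distrib)
  moreover have "\<bar>1 / real CARD('n) * (\<Sum>l\<in>UNIV. w l * y l) - 1 / real CARD('n) * (\<Sum>l\<in>UNIV. w l * y' l)\<bar> \<le> C * \<delta>"
    using assms by (intro abs_mean_mult_diff_le)
  ultimately show ?thesis unfolding distrib_right by linarith
qed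

lemma recursion_bound:
  fixes y :: "'n::finite \<Rightarrow> real" and \<beta> :: real
  assumes "\<bar>\<xi>\<bar> \<le> b" "\<And>l. \<bar>y l\<bar> \<le> R" "\<bar>c\<bar> \<le> B" "0 \<le> \<beta>" "\<beta> \<le> 1" "0 < n"
    and "\<And>l. \<bar>w l\<bar> \<le> C"
  shows "\<bar>1 / real n * \<beta> * c * \<xi> + 1 / real CARD('n) * (\<Sum>l\<in>UNIV. w l * y l)\<bar> \<le> B * b / real n + C * R"
proof -
  have "\<bar>1 / real n * \<beta> * c * \<xi>\<bar> \<le> B * b / real n"
    using assms by (intro weighted_abs_le)
  moreover have "\<bar>1 / real CARD('n) * (\<Sum>l\<in>UNIV. w l * y l)\<bar> \<le> C * R"
    using assms by (intro abs_mean_mult_le)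
  ultimately show ?thesis by linarith
qed

lemma p_A_diff:
  fixes \<theta> :: "('n::finite, 'd::finite) param"
  assumes "\<And>j. \<bar>x $ j - x' $ j\<bar> \<le> \<delta>" "\<And>\<alpha> l. \<bar>y $ \<alpha> $ l - y' $ \<alpha> $ l\<bar> \<le> \<delta>"
  shows "\<bar>p_A \<phi> \<theta> x y \<alpha> k - p_A \<phi> \<theta> x' y' \<alpha> k\<bar> \<le> (C' / real CARD('d) + C) * \<delta>"
  by (cases \<theta>; cases \<alpha>; simp only: p_A.simps)
     (intro recursion_diff assms \<phi>0 \<phi>1 of_bool_bounds zero_less_card_finite)

lemma p_A_bound:
  fixes \<theta> :: "('n::finite, 'd::finite) param"
  assumes "\<And>j. \<bar>x $ j\<bar> \<le> 1" "\<And>\<alpha> l. \<bar>y $ \<alpha> $ l\<bar> \<le> R"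
  shows "\<bar>p_A \<phi> \<theta> x y \<alpha> k\<bar> \<le> C' * 1 / real CARD('d) + C * R"
  by (cases \<theta>; cases \<alpha>; simp only: p_A.simps)
     (intro recursion_bound assms \<phi>0 \<phi>1 of_bool_bounds zero_less_card_finite)

lemma p_W_diff:
  fixes \<theta> :: "('n::finite, 'd::finite) param"
  assumes "\<And>j. \<bar>x $ j - x' $ j\<bar> \<le> \<delta>" "\<And>\<alpha> l. \<bar>y $ \<alpha> $ l - y' $ \<alpha> $ l\<bar> \<le> \<delta>"
  shows "\<bar>p_W \<phi> \<theta> x y \<alpha> k - p_W \<phi> \<theta> x' y' \<alpha> k\<bar> \<le> (C' / real CARD('n) + C) * \<delta>"
  by (cases \<theta>; cases \<alpha>; simp only: p_W.simps)
     (intro recursion_diff assms \<phi>0 \<phi>1 of_bool_bounds zero_less_card_finite)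

lemma p_W_bound:
  fixes \<theta> :: "('n::finite, 'd::finite) param"
  assumes "\<And>j. \<bar>x $ j\<bar> \<le> 1" "\<And>\<alpha> l. \<bar>y $ \<alpha> $ l\<bar> \<le> R"
  shows "\<bar>p_W \<phi> \<theta> x y \<alpha> k\<bar> \<le> C' * 1 / real CARD('n) + C * R"
  by (cases \<theta>; cases \<alpha>; simp only: p_W.simps)
     (intro recursion_bound assms \<phi>0 \<phi>1 of_bool_bounds zero_less_card_finite)

lemma mult_of_bool_bounds:
  "0 \<le> (of_bool b * of_bool b' :: real)" "(of_bool b * of_bool b' :: real) \<le> 1"
  by auto

text \<open>The two Kronecker deltas are bracketed together so as to serve as the single \<beta> of
  \<open>recursion_diff\<close>; the same is done for the WW entries.\<close>

lemma r_AA_diff: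
  fixes \<theta> :: "('n::finite, 'd::finite) param"
  assumes "\<And>j. \<bar>x $ j - x' $ j\<bar> \<le> \<delta>" "\<And>\<alpha> \<beta> l. \<bar>y $ \<alpha> $ \<beta> $ l - y' $ \<alpha> $ \<beta> $ l\<bar> \<le> \<delta>"
  shows "\<bar>r_AA \<phi> \<theta> x y \<alpha> \<beta> k - r_AA \<phi> \<theta> x' y' \<alpha> \<beta> k\<bar> \<le> (C'' / real CARD('d) + C) * \<delta>"
  by (cases \<theta>; cases \<alpha>; cases \<beta>; simp only: r_AA.simps mult.assoc[of "1 / real CARD('d)" "of_bool _" "of_bool _"])
     (intro recursion_diff assms \<phi>0 \<phi>2 mult_of_bool_bounds zero_less_card_finite)

lemma r_AA_bound:
  fixes \<theta> :: "('n::finite, 'd::finite) param"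
  assumes "\<And>j. \<bar>x $ j\<bar> \<le> 1" "\<And>\<alpha> \<beta> l. \<bar>y $ \<alpha> $ \<beta> $ l\<bar> \<le> R"
  shows "\<bar>r_AA \<phi> \<theta> x y \<alpha> \<beta> k\<bar> \<le> C'' * 1 / real CARD('d) + C * R"
  by (cases \<theta>; cases \<alpha>; cases \<beta>; simp only: r_AA.simps mult.assoc[of "1 / real CARD('d)" "of_bool _" "of_bool _"])
     (intro recursion_bound assms \<phi>0 \<phi>2 mult_of_bool_bounds zero_less_card_finite)

lemma r_WW_diff:
  fixes \<theta> :: "('n::finite, 'd::finite) param"
  assumes "\<And>j. \<bar>x $ j - x' $ j\<bar> \<le> \<delta>" "\<And>\<alpha> \<beta> l. \<bar>y $ \<alpha> $ \<beta> $ l - y' $ \<alpha> $ \<beta> $ l\<bar> \<le> \<delta>"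
  shows "\<bar>r_WW \<phi> \<theta> x y \<alpha> \<beta> k - r_WW \<phi> \<theta> x' y' \<alpha> \<beta> k\<bar> \<le> (C'' / real CARD('n) + C) * \<delta>"
  by (cases \<theta>; cases \<alpha>; cases \<beta>; simp only: r_WW.simps mult.assoc[of "1 / real CARD('n)" "of_bool _" "of_bool _"])
     (intro recursion_diff assms \<phi>0 \<phi>2 mult_of_bool_bounds zero_less_card_finite)

lemma r_WW_bound:
  fixes \<theta> :: "('n::finite, 'd::finite) param"
  assumes "\<And>j. \<bar>x $ j\<bar> \<le> 1" "\<And>\<alpha> \<beta> l. \<bar>y $ \<alpha> $ \<beta> $ l\<bar> \<le> R"
  shows "\<bar>r_WW \<phi> \<theta> x y \<alpha> \<beta> k\<bar> \<le> C'' * 1 / real CARD('n) + C * R"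
  by (cases \<theta>; cases \<alpha>; cases \<beta>; simp only: r_WW.simps mult.assoc[of "1 / real CARD('n)" "of_bool _" "of_bool _"])
     (intro recursion_bound assms \<phi>0 \<phi>2 mult_of_bool_bounds zero_less_card_finite)

lemma r_WA_diff:
  fixes \<theta> :: "('n::finite, 'd::finite) param"
  assumes "\<And>\<alpha> j. \<bar>x $ \<alpha> $ j - x' $ \<alpha> $ j\<bar> \<le> \<delta>" "\<And>\<alpha> \<beta> l. \<bar>y $ \<alpha> $ \<beta> $ l - y' $ \<alpha> $ \<beta> $ l\<bar> \<le> \<delta>"
  shows "\<bar>r_WA \<phi> \<theta> x y \<alpha> \<beta> k - r_WA \<phi> \<theta> x' y' \<alpha> \<beta> k\<bar> \<le> (C' / real CARD('n) + C) * \<delta>"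
  by (cases \<theta>; cases \<alpha>; cases \<beta>; simp only: r_WA.simps)
     (intro recursion_diff assms \<phi>0 \<phi>1 of_bool_bounds zero_less_card_finite)

lemma r_WA_bound:
  fixes \<theta> :: "('n::finite, 'd::finite) param"
  assumes "\<And>\<alpha> j. \<bar>x $ \<alpha> $ j\<bar> \<le> b" "\<And>\<alpha> \<beta> l. \<bar>y $ \<alpha> $ \<beta> $ l\<bar> \<le> R"
  shows "\<bar>r_WA \<phi> \<theta> x y \<alpha> \<beta> k\<bar> \<le> C' * b / real CARD('n) + C * R"
  by (cases \<theta>; cases \<alpha>; cases \<beta>; simp only: r_WA.simps)
     (intro recursion_bound assms \<phi>0 \<phi>1 of_bool_bounds zero_less_card_finite)

text \<open>The radii of the box are the fixed points of the affine bounds for one step of the recursion.\<close>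

lemma box_radii:
  fixes N d :: nat
  assumes "0 < N" "0 < d"
  shows "C' * 1 / real d + C * (C' / (real d * (4 - C))) = C' * M_phi C / real d"
    "1/4 * (C' * M_phi C / real d) = C' / (real d * (4 - C))"
    "1/10 * (C' * M_phi C / real d) * (C' * M_phi C / real d)
      + 1/4 * (C'' * 1 / real d + C * (a_AA d C C' C'' / (1 - C/4))) = a_AA d C C' C'' / (1 - C/4)"
    "1/10 * (C' * M_phi C / real N) * (C' * M_phi C / real d)
      + 1/4 * (C' * (C' / (real d * (4 - C))) / real N + C * (a_WA N d C C' / (1 - C/4))) = a_WA N d C C' / (1 - C/4)"
    "1/10 * (C' * M_phi C / real N) * (C' * M_phi C / real N)
      + 1/4 * (C'' * 1 / real N + C * (a_WW N C C' C'' / (1 - C/4))) = a_WW N C C' C'' / (1 - C/4)"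
proof -
  have C: "4 - C \<noteq> 0" "1 - C/4 \<noteq> 0" using C4 by auto
  \<comment> \<open>With b = a + c/4, the number b / (1 - C/4) is the fixed point of R \<mapsto> a +
    (c + C R) / 4.\<close>
  have fp: "a + 1/4 * (c + C * (b / (1 - C/4))) = b / (1 - C/4)" if "b = a + c/4" for a b c
    using C that by (simp add: field_simps)
  \<comment> \<open>\<open>M_phi C\<close> equals 4 / (4 - C), the factor by which feedback of the
    first-order array magnifies the direct term C'/d.\<close>
  show "C' * 1 / real d + C * (C' / (real d * (4 - C))) = C' * M_phi C / real d"
    using C assms by (simp add: M_phi_def field_simps)
  show "1/4 * (C' * M_phi C / real d) = C' / (real d * (4 - C))"
    using C assms by (simp add: M_phi_def field_simps)
  show "1/10 * (C' * M_phi C / real d) * (C' * M_phi C / real d)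
      + 1/4 * (C'' * 1 / real d + C * (a_AA d C C' C'' / (1 - C/4))) = a_AA d C C' C'' / (1 - C/4)"
    by (rule fp) (simp add: a_AA_def power2_eq_square mult_ac)
  show "1/10 * (C' * M_phi C / real N) * (C' * M_phi C / real d)
      + 1/4 * (C' * (C' / (real d * (4 - C))) / real N + C * (a_WA N d C C' / (1 - C/4))) = a_WA N d C C' / (1 - C/4)"
    by (rule fp) (simp add: a_WA_def power2_eq_square mult_ac)
  show "1/10 * (C' * M_phi C / real N) * (C' * M_phi C / real N)
      + 1/4 * (C'' * 1 / real N + C * (a_WW N C C' C'' / (1 - C/4))) = a_WW N C C' C'' / (1 - C/4)"
    by (rule fp) (simp add: a_WW_def power2_eq_square mult_ac)
qed

lemma second_order_bound:
  fixes s t p p' r :: real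
  assumes "\<bar>p\<bar> \<le> Bp" "\<bar>p'\<bar> \<le> Bp'" "\<bar>r\<bar> \<le> Br"
  shows "\<bar>deriv (deriv sigmoid) a * p * p' + deriv sigmoid a * r\<bar> \<le> 1/10 * Bp * Bp' + 1/4 * Br"
proof -
  have "0 \<le> Bp" using assms(1) by linarith
  then have "\<bar>deriv (deriv sigmoid) a * p * p'\<bar> \<le> 1/10 * Bp * Bp'" "\<bar>deriv sigmoid a * r\<bar> \<le> 1/4 * Br"
    unfolding abs_mult by (intro mult_mono sigmoid_deriv_bounds assms; simp)+
  then show ?thesis by linarith
qed

lemma F_map_v_box:
  fixes \<theta> :: "('n::finite, 'd::finite) param" and u :: "('d, 'z::finite) ustate"
  assumes u: "u \<in> u_cube" and v: "v \<in> v_box C C' C''"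
  shows "F_map \<phi> \<theta> u v \<in> v_box C C' C''"
proof -
  obtain x z where u': "u = (x, z)" by (cases u)
  obtain s sA sW sAA sWA sWW where v': "v = (s, (sA, sW), (sAA, sWA, sWW))" by (cases v) auto
  have x: "\<bar>x $ j\<bar> \<le> 1" for j using u by (auto simp: u' u_cube_def abs_le_iff minus_le_iff)
  have s: "\<bar>s $ k\<bar> \<le> 1" for k using v by (auto simp: v' v_box_def)
  have b: "\<bar>sA $ \<alpha> $ k\<bar> \<le> C' / (real CARD('d) * (4 - C))"
    "\<bar>sW $ \<alpha>' $ k\<bar> \<le> C' / (real CARD('n) * (4 - C))"
    "\<bar>sAA $ \<alpha> $ \<beta> $ k\<bar> \<le> a_AA CARD('d) C C' C'' / (1 - C/4)"
    "\<bar>sWA $ \<alpha>' $ \<beta> $ k\<bar> \<le> a_WA CARD('n) CARD('d) C C' / (1 - C/4)"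
    "\<bar>sWW $ \<alpha>' $ \<beta>' $ k\<bar> \<le> a_WW CARD('n) C C' C'' / (1 - C/4)" for \<alpha> \<alpha>' \<beta> \<beta>' k
    using v_boxD[OF v[unfolded v']] by auto
  note rad = box_radii[OF zero_less_card_finite[where 'a='n] zero_less_card_finite[where 'a='d]]
    box_radii(1,2)[OF zero_less_card_finite[where 'a='n] zero_less_card_finite[where 'a='n]]
  have pA: "\<bar>p_A \<phi> \<theta> x sA \<alpha> k\<bar> \<le> C' * M_phi C / real CARD('d)" for \<alpha> k
    using p_A_bound[OF x b(1)] unfolding rad .
  have pW: "\<bar>p_W \<phi> \<theta> s sW \<alpha> k\<bar> \<le> C' * M_phi C / real CARD('n)" for \<alpha> k
    using p_W_bound[OF s b(2)] unfolding rad .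
  have first: "\<bar>deriv sigmoid a * p\<bar> \<le> 1/4 * B" if "\<bar>p\<bar> \<le> B" for a p B
    unfolding abs_mult using that by (intro mult_mono sigmoid_deriv_bounds) auto
  show ?thesis
    unfolding u' v' F_map.simps Let_def v_box_def mem_Collect_eq prod.case vec_lambda_beta
  proof (intro conjI allI)
    fix k :: 'n and \<alpha> \<beta> :: "'n \<times> 'd" and \<alpha>' \<beta>' :: "'n \<times> 'n"
    let ?a = "preact \<phi> \<theta> x s k"
    show "sigmoid ?a \<in> {0..1}" using sigmoid_range[of ?a] by simp
    show "\<bar>deriv sigmoid ?a * p_A \<phi> \<theta> x sA \<alpha> k\<bar> \<le> C' / (real CARD('d) * (4 - C))"
      using first[OF pA] unfolding rad .
    show "\<bar>deriv sigmoid ?a * p_W \<phi> \<theta> s sW \<alpha>' k\<bar> \<le> C' / (real CARD('n) * (4 - C))"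
      using first[OF pW] unfolding rad .
    show "\<bar>deriv (deriv sigmoid) ?a * p_A \<phi> \<theta> x sA \<alpha> k * p_A \<phi> \<theta> x sA \<beta> k
        + deriv sigmoid ?a * r_AA \<phi> \<theta> x sAA \<alpha> \<beta> k\<bar> \<le> a_AA CARD('d) C C' C'' / (1 - C/4)"
      using second_order_bound[OF pA pA r_AA_bound[OF x b(3)]] unfolding rad .
    show "\<bar>deriv (deriv sigmoid) ?a * p_W \<phi> \<theta> s sW \<alpha>' k * p_A \<phi> \<theta> x sA \<beta> k
        + deriv sigmoid ?a * r_WA \<phi> \<theta> sA sWA \<alpha>' \<beta> k\<bar> \<le> a_WA CARD('n) CARD('d) C C' / (1 - C/4)"
      using second_order_bound[OF pW pA r_WA_bound[OF b(1) b(4)]] unfolding rad .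
    show "\<bar>deriv (deriv sigmoid) ?a * p_W \<phi> \<theta> s sW \<alpha>' k * p_W \<phi> \<theta> s sW \<beta>' k
        + deriv sigmoid ?a * r_WW \<phi> \<theta> s sWW \<alpha>' \<beta>' k\<bar> \<le> a_WW CARD('n) C C' C'' / (1 - C/4)"
      using second_order_bound[OF pW pW r_WW_bound[OF s b(5)]] unfolding rad .
  qed
qed

text \<open>With m = min N d, one bound serves the p quantities of both label types, and
  \<open>r_radius\<close> likewise serves all three label pairs. The latter is exactly the bracket
  that \<open>T1\<close> multiplies by C/10.\<close>

definition p_radius :: "nat \<Rightarrow> nat \<Rightarrow> real" where
  "p_radius N d = C' * M_phi C / m_min N d"

definition r_radius :: "nat \<Rightarrow> nat \<Rightarrow> real" where
  "r_radius N d = L2 N d C C' C'' + C / (1 - C/4) *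
     (C'\<^sup>2 * (M_phi C)\<^sup>2 / (10 * (m_min N d)\<^sup>2) + 1/4 * L2 N d C C' C'')"

lemma m_min_bounds:
  assumes "0 < N" "0 < d"
  shows "0 < m_min N d" "m_min N d \<le> real N" "m_min N d \<le> real d"
  using assms by (auto simp: m_min_def)

text \<open>Each left side is a direct term plus C times a box radius. \<open>L2\<close> dominates
  the direct terms, including the mixed one with C'^2, and in the remaining parts N and d are
  lowered to their minimum.\<close>

lemma r_radius_bounds:
  assumes "0 < N" "0 < d"
  shows "C'' * 1 / real d + C * (a_AA d C C' C'' / (1 - C/4)) \<le> r_radius N d"
    "C' * (C' / (real d * (4 - C))) / real N + C * (a_WA N d C C' / (1 - C/4)) \<le> r_radius N d"
    "C'' * 1 / real N + C * (a_WW N C C' C'' / (1 - C/4)) \<le> r_radius N d"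
proof -
  note m = m_min_bounds[OF assms]
  let ?m = "m_min N d"
  define w where "w = C'\<^sup>2 * (M_phi C)\<^sup>2"
  have w: "0 \<le> w" by (simp add: w_def)
  have l2: "C'' / real d \<le> L2 N d C C' C''" "C'' / real N \<le> L2 N d C C' C''"
    "C'\<^sup>2 / (real N * real d * (4 - C)) \<le> L2 N d C C' C''"
    unfolding L2_def using m C_nonneg by (auto intro!: le_max_iff_disj[THEN iffD2] disjI1 divide_left_mono mult_pos_pos)
  have wle: "w / (10 * a * b) \<le> w / (10 * ?m\<^sup>2)" if "?m \<le> a" "?m \<le> b" for a b
  proof (rule divide_left_mono[OF _ w])
    have "?m * ?m \<le> a * b" using that m(1) by (intro mult_mono) auto
    then show "10 * ?m\<^sup>2 \<le> 10 * a * b" by (simp add: power2_eq_square)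
    show "0 < 10 * a * b * (10 * ?m\<^sup>2)" using that m(1) by (intro mult_pos_pos) auto
  qed
  have gen: "t + C * (a / (1 - C/4)) \<le> r_radius N d"
    if "t \<le> L2 N d C C' C''" "a \<le> w / (10 * ?m\<^sup>2) + 1/4 * L2 N d C C' C''" for t a
  proof -
    have "C / (1 - C/4) * a \<le> C / (1 - C/4) * (w / (10 * ?m\<^sup>2) + 1/4 * L2 N d C C' C'')"
      using C4 C_nonneg by (intro mult_left_mono that divide_nonneg_nonneg) auto
    with that(1) show ?thesis unfolding r_radius_def w_def by simp
  qed
  show "C'' * 1 / real d + C * (a_AA d C C' C'' / (1 - C/4)) \<le> r_radius N d"
  proof (rule gen)
    have "a_AA d C C' C'' = w / (10 * real d * real d) + 1/4 * (C'' / real d)"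
      by (simp add: a_AA_def w_def power2_eq_square mult_ac)
    then show "a_AA d C C' C'' \<le> w / (10 * ?m\<^sup>2) + 1/4 * L2 N d C C' C''"
      using wle[OF m(3) m(3)] l2(1) by linarith
  qed (use l2 in simp)
  show "C'' * 1 / real N + C * (a_WW N C C' C'' / (1 - C/4)) \<le> r_radius N d"
  proof (rule gen)
    have "a_WW N C C' C'' = w / (10 * real N * real N) + 1/4 * (C'' / real N)"
      by (simp add: a_WW_def w_def power2_eq_square mult_ac)
    then show "a_WW N C C' C'' \<le> w / (10 * ?m\<^sup>2) + 1/4 * L2 N d C C' C''"
      using wle[OF m(2) m(2)] l2(2) by linarith
  qed (use l2 in simp)
  show "C' * (C' / (real d * (4 - C))) / real N + C * (a_WA N d C C' / (1 - C/4)) \<le> r_radius N d"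
  proof (rule gen)
    have "a_WA N d C C' = w / (10 * real N * real d) + 1/4 * (C'\<^sup>2 / (real N * real d * (4 - C)))"
      by (simp add: a_WA_def w_def mult_ac)
    then show "a_WA N d C C' \<le> w / (10 * ?m\<^sup>2) + 1/4 * L2 N d C C' C''"
      using wle[OF m(2) m(3)] l2(3) by linarith
  qed (use l2(3) in \<open>simp add: power2_eq_square mult_ac\<close>)
qed

lemma L_bar_ge_C: "3 * C / 4 \<le> L_bar N d C C' C''"
  unfolding L_bar_def L0_def by simp

text \<open>The left side is the product rule for \<sigma>'(a) p: variation of \<sigma>' times the
  bound on p, plus the bound on \<sigma>' times the variation of p.\<close>

lemma L_bar_first_order:
  assumes "0 < N" "0 < d"
  shows "1/10 * (2 * C) * p_radius N d + 1/4 * (C' / m_min N d + C) \<le> L_bar N d C C' C''"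
proof -
  define g where "g = C' / m_min N d"
  define k where "k = g * (C * M_phi C)"
  have g: "0 \<le> g" using m_min_bounds(1)[OF assms] C_nonneg by (simp add: g_def)
  have "0 \<le> k" unfolding k_def using g C_nonneg M_phi_pos by simp
  have eq: "1/10 * (2 * C) * p_radius N d = k / 5" by (simp add: p_radius_def k_def g_def mult_ac)
  have "3 * C' / m_min N d * (C * M_phi C / 10 + 1/4) = 3/10 * k + 3/4 * g"
    unfolding k_def g_def by (simp add: algebra_simps add_divide_distrib)
  then have "3/10 * k + 3/4 * g \<le> L_bar N d C C' C''" unfolding L_bar_def L0_def by simp
  \<comment> \<open>Two thirds of the first entry of \<open>L0\<close> plus one third of its second
    entry 3 C / 4 already exceed the left side.\<close>
  then show ?thesis
    using L_bar_ge_C[of N d] g \<open>0 \<le> k\<close> unfolding g_def[symmetric] eq by argo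
qed

text \<open>The left side is the product rule for \<sigma>''(a) p p' + \<sigma>'(a) r. Here D is the
  coefficient of the direct term in r, left variable so that one estimate covers all label
  pairs.\<close>

lemma L_bar_second_order:
  assumes N: "0 < N" "0 < d" and D: "D \<le> C'' / m_min N d + C' / real N"
  shows "(1/8 * (2 * C) * p_radius N d + 1/10 * (C' / m_min N d + C)) * p_radius N d
    + 1/10 * p_radius N d * (C' / m_min N d + C) + (1/10 * (2 * C) * r_radius N d + 1/4 * (D + C)) \<le> L_bar N d C C' C''"
proof -
  note m = m_min_bounds[OF N]
  let ?m = "m_min N d"
  define A1 where "A1 = M_phi C * C'\<^sup>2 / (5 * ?m\<^sup>2)"
  define A2 where "A2 = C * (M_phi C)\<^sup>2 * C'\<^sup>2 / (8 * ?m\<^sup>2)"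
  define A3 where "A3 = C'' / (4 * ?m)"
  define A4 where "A4 = C / 10 * r_radius N d"
  define B1 where "B1 = C * M_phi C * C' / (5 * ?m)"
  define B2 where "B2 = C' / (4 * real N)"
  have T: "T1 N d C C' C'' = A1 + A2 + A3 + A4" "T2 N d C C' = B1 + B2"
    unfolding T1_def T2_def A1_def A2_def A3_def A4_def B1_def B2_def r_radius_def by simp_all
  have nn: "0 \<le> A1" "0 \<le> A3" "0 \<le> B1" "0 \<le> B2"
    unfolding A1_def A3_def B1_def B2_def using m C_nonneg M_phi_pos by simp_all
  have eq1: "(1/8 * (2 * C) * p_radius N d + 1/10 * (C' / ?m + C)) * p_radius N d + 1/10 * p_radius N d * (C' / ?m + C)
      = 2 * A2 + A1 + B1"
    unfolding p_radius_def A1_def A2_def B1_def using m(1) by (simp add: field_simps power2_eq_square)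
  have eq2: "1/10 * (2 * C) * r_radius N d = 2 * A4" by (simp add: A4_def)
  have "1/4 * (D + C) \<le> A3 + B2 + C / 4"
    using D unfolding A3_def B2_def by simp
  moreover have "4 * T1 N d C C' C'' \<le> L1 N d C C' C''" "4 * T2 N d C C' \<le> L1 N d C C' C''" "C \<le> L1 N d C C' C''"
    unfolding L1_def by simp_all
  moreover have "L1 N d C C' C'' \<le> L_bar N d C C' C''" by (simp add: L_bar_def)
  \<comment> \<open>The left side is at most 2 T1 + T2 + C/4, the convex combination with weights
    1/2, 1/4, 1/4 of the entries 4 T1, 4 T2 and C of \<open>L1\<close>.\<close>
  ultimately show ?thesis using nn unfolding T eq1 eq2 by argo
qed

text \<open>In the max-norm the claim splits into one scalar estimate per entry: \<open>d0\<close>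
  for s, \<open>d1\<close> for both first-order arrays and \<open>d2\<close> for the three
  second-order ones. Box membership supplies the bounds on the factors.\<close>

lemma F_map_lipschitz:
  fixes \<theta> :: "('n::finite, 'd::finite) param" and u u' :: "('d, 'z::finite) ustate"
  assumes u: "u \<in> u_cube" "u' \<in> u_cube" and v: "v \<in> v_box C C' C''" "v' \<in> v_box C C' C''"
  shows "infnorm (F_map \<phi> \<theta> u v - F_map \<phi> \<theta> u' v')
    \<le> L_bar CARD('n) CARD('d) C C' C'' * infnorm ((u, v) - (u', v'))"
proof -
  let ?N = "CARD('n)" and ?d = "CARD('d)"
  let ?m = "m_min ?N ?d" and ?L = "L_bar ?N ?d C C' C''" and ?P = "p_radius ?N ?d" and ?R = "r_radius ?N ?d"
  note pos = zero_less_card_finite[where 'a='n] zero_less_card_finite[where 'a='d]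
  note m = m_min_bounds[OF pos]
  obtain x z x' z' where u': "u = (x, z)" "u' = (x', z')" by (cases u; cases u')
  obtain s sA sW sAA sWA sWW where v1: "v = (s, (sA, sW), (sAA, sWA, sWW))" by (cases v) auto
  obtain s' sA' sW' sAA' sWA' sWW' where v2: "v' = (s', (sA', sW'), (sAA', sWA', sWW'))" by (cases v') auto
  define \<delta> where "\<delta> = infnorm ((u, v) - (u', v'))"
  have \<delta>: "0 \<le> \<delta>" by (simp add: \<delta>_def infnorm_pos_le)
  have "infnorm (x - x') \<le> \<delta>" "infnorm (s - s') \<le> \<delta>" "infnorm (sA - sA') \<le> \<delta>" "infnorm (sW - sW') \<le> \<delta>"
    "infnorm (sAA - sAA') \<le> \<delta>" "infnorm (sWA - sWA') \<le> \<delta>" "infnorm (sWW - sWW') \<le> \<delta>"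
    by (simp_all add: \<delta>_def u' v1 v2 infnorm_Pair le_max_iff_disj)
  then have dx: "\<bar>x $ j - x' $ j\<bar> \<le> \<delta>" and ds: "\<bar>s $ k - s' $ k\<bar> \<le> \<delta>"
    and dsA: "\<bar>sA $ \<alpha> $ k - sA' $ \<alpha> $ k\<bar> \<le> \<delta>" and dsW: "\<bar>sW $ \<alpha>' $ k - sW' $ \<alpha>' $ k\<bar> \<le> \<delta>"
    and dsAA: "\<bar>sAA $ \<alpha> $ \<beta> $ k - sAA' $ \<alpha> $ \<beta> $ k\<bar> \<le> \<delta>"
    and dsWA: "\<bar>sWA $ \<alpha>' $ \<beta> $ k - sWA' $ \<alpha>' $ \<beta> $ k\<bar> \<le> \<delta>"
    and dsWW: "\<bar>sWW $ \<alpha>' $ \<beta>' $ k - sWW' $ \<alpha>' $ \<beta>' $ k\<bar> \<le> \<delta>" for j k \<alpha> \<beta> \<alpha>' \<beta>'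
    unfolding infnorm_vec_le_iff infnorm_real vector_minus_component by blast+
  have x: "\<bar>x $ j\<bar> \<le> 1" "\<bar>x' $ j\<bar> \<le> 1" for j using u by (auto simp: u' u_cube_def abs_le_iff minus_le_iff)
  have s: "\<bar>s $ k\<bar> \<le> 1" "\<bar>s' $ k\<bar> \<le> 1" for k using v by (auto simp: v1 v2 v_box_def)
  have b: "\<bar>sA $ \<alpha> $ k\<bar> \<le> C' / (real ?d * (4 - C))" "\<bar>sA' $ \<alpha> $ k\<bar> \<le> C' / (real ?d * (4 - C))"
    "\<bar>sW $ \<alpha>' $ k\<bar> \<le> C' / (real ?N * (4 - C))" "\<bar>sW' $ \<alpha>' $ k\<bar> \<le> C' / (real ?N * (4 - C))"
    "\<bar>sAA $ \<alpha> $ \<beta> $ k\<bar> \<le> a_AA ?d C C' C'' / (1 - C/4)"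
    "\<bar>sWA $ \<alpha>' $ \<beta> $ k\<bar> \<le> a_WA ?N ?d C C' / (1 - C/4)"
    "\<bar>sWW $ \<alpha>' $ \<beta>' $ k\<bar> \<le> a_WW ?N C C' C'' / (1 - C/4)" for \<alpha> \<alpha>' \<beta> \<beta>' k
    using v_boxD[OF v(1)[unfolded v1]] v_boxD[OF v(2)[unfolded v2]] by auto
  let ?a = "preact \<phi> \<theta> x s" and ?a' = "preact \<phi> \<theta> x' s'"
  have da: "\<bar>?a k - ?a' k\<bar> \<le> 2 * C * \<delta>" for k by (rule preact_diff[OF dx ds])
  have Ple: "C' * M_phi C / real ?d \<le> ?P" "C' * M_phi C / real ?N \<le> ?P"
    "C' / real ?d \<le> C' / ?m" "C' / real ?N \<le> C' / ?m" "C'' / real ?d \<le> C'' / ?m" "C'' / real ?N \<le> C'' / ?m"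
    unfolding p_radius_def using m C_nonneg M_phi_pos by (auto intro!: divide_left_mono mult_pos_pos)
  have P0: "0 \<le> ?P" unfolding p_radius_def using m(1) C_nonneg M_phi_pos by simp
  note rA = box_radii(1)[OF pos] and rW = box_radii(1)[OF pos(1) pos(1)]
  have pA: "\<bar>p_A \<phi> \<theta> x sA \<alpha> k\<bar> \<le> ?P" "\<bar>p_A \<phi> \<theta> x' sA' \<alpha> k\<bar> \<le> ?P" for \<alpha> k
    using order_trans[OF p_A_bound[OF x(1) b(1), unfolded rA] Ple(1)]
      order_trans[OF p_A_bound[OF x(2) b(2), unfolded rA] Ple(1)] by blast+
  have pW: "\<bar>p_W \<phi> \<theta> s sW \<alpha> k\<bar> \<le> ?P" "\<bar>p_W \<phi> \<theta> s' sW' \<alpha> k\<bar> \<le> ?P" for \<alpha> k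
    using order_trans[OF p_W_bound[OF s(1) b(3), unfolded rW] Ple(2)]
      order_trans[OF p_W_bound[OF s(2) b(4), unfolded rW] Ple(2)] by blast+
  let ?D = "(C' / ?m + C) * \<delta>"
  have Dle: "(C' / real ?d + C) * \<delta> \<le> ?D" "(C' / real ?N + C) * \<delta> \<le> ?D"
    using Ple \<delta> by (auto intro!: mult_right_mono)
  have dpA: "\<bar>p_A \<phi> \<theta> x sA \<alpha> k - p_A \<phi> \<theta> x' sA' \<alpha> k\<bar> \<le> ?D" for \<alpha> k
    by (rule order_trans[OF p_A_diff[OF dx dsA] Dle(1)])
  have dpW: "\<bar>p_W \<phi> \<theta> s sW \<alpha> k - p_W \<phi> \<theta> s' sW' \<alpha> k\<bar> \<le> ?D" for \<alpha> k
    by (rule order_trans[OF p_W_diff[OF ds dsW] Dle(2)])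
  have d0: "\<bar>sigmoid (?a k) - sigmoid (?a' k)\<bar> \<le> ?L * \<delta>" for k
  proof -
    have "\<bar>sigmoid (?a k) - sigmoid (?a' k)\<bar> \<le> 1/4 * (2 * C * \<delta>)"
      by (rule order_trans[OF sigmoid_lipschitz(1) mult_left_mono[OF da]]) simp
    also have "\<dots> \<le> 3 * C / 4 * \<delta>" using C_nonneg \<delta> by simp
    also have "\<dots> \<le> ?L * \<delta>" by (intro mult_right_mono L_bar_ge_C \<delta>)
    finally show ?thesis .
  qed
  have d\<sigma>1: "\<bar>deriv sigmoid (?a k) - deriv sigmoid (?a' k)\<bar> \<le> 1/10 * (2 * C) * \<delta>" for k
    using order_trans[OF sigmoid_lipschitz(2) mult_left_mono[OF da[of k]]] by (simp add: mult.assoc)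
  have d\<sigma>2: "\<bar>deriv (deriv sigmoid) (?a k) - deriv (deriv sigmoid) (?a' k)\<bar> \<le> 1/8 * (2 * C) * \<delta>" for k
    using order_trans[OF sigmoid_lipschitz(3) mult_left_mono[OF da[of k]]] by (simp add: mult.assoc)
  have d1: "\<bar>deriv sigmoid (?a k) * p - deriv sigmoid (?a' k) * p'\<bar> \<le> ?L * \<delta>"
    if "\<bar>p\<bar> \<le> ?P" "\<bar>p - p'\<bar> \<le> ?D" for p p' k
  proof -
    have "\<bar>deriv sigmoid (?a k) * p - deriv sigmoid (?a' k) * p'\<bar> \<le> 1/10 * (2 * C) * \<delta> * ?P + 1/4 * ?D"
      by (intro abs_mult_diff_le d\<sigma>1 that sigmoid_deriv_bounds)
    also have "\<dots> = (1/10 * (2 * C) * ?P + 1/4 * (C' / ?m + C)) * \<delta>" by (simp add: algebra_simps)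
    also have "\<dots> \<le> ?L * \<delta>" by (intro mult_right_mono L_bar_first_order pos \<delta>)
    finally show ?thesis .
  qed
  \<comment> \<open>Here p and r are the two first-order factors multiplied by \<sigma>'', and t is
    the second-order quantity multiplied by \<sigma>'.\<close>
  have d2: "\<bar>(deriv (deriv sigmoid) (?a k) * p * r + deriv sigmoid (?a k) * t)
      - (deriv (deriv sigmoid) (?a' k) * p' * r' + deriv sigmoid (?a' k) * t')\<bar> \<le> ?L * \<delta>"
    if p: "\<bar>p\<bar> \<le> ?P" "\<bar>p'\<bar> \<le> ?P" "\<bar>p - p'\<bar> \<le> ?D" and r: "\<bar>r\<bar> \<le> ?P" "\<bar>r - r'\<bar> \<le> ?D"
      and t: "\<bar>t\<bar> \<le> ?R" "\<bar>t - t'\<bar> \<le> (D + C) * \<delta>" and D: "D \<le> C'' / ?m + C' / real ?N" for p p' r r' t t' D k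
  proof -
    have "\<bar>deriv (deriv sigmoid) (?a' k) * p'\<bar> \<le> 1/10 * ?P"
      unfolding abs_mult using p P0 by (intro mult_mono sigmoid_deriv_bounds) auto
    then have "\<bar>deriv (deriv sigmoid) (?a k) * p * r - deriv (deriv sigmoid) (?a' k) * p' * r'\<bar>
      \<le> (1/8 * (2 * C) * \<delta> * ?P + 1/10 * ?D) * ?P + 1/10 * ?P * ?D"
      by (intro abs_mult_diff_le d\<sigma>2 p r sigmoid_deriv_bounds)
    moreover have "\<bar>deriv sigmoid (?a k) * t - deriv sigmoid (?a' k) * t'\<bar> \<le> 1/10 * (2 * C) * \<delta> * ?R + 1/4 * ((D + C) * \<delta>)"
      by (intro abs_mult_diff_le d\<sigma>1 t sigmoid_deriv_bounds)
    ultimately have "\<bar>(deriv (deriv sigmoid) (?a k) * p * r + deriv sigmoid (?a k) * t)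
      - (deriv (deriv sigmoid) (?a' k) * p' * r' + deriv sigmoid (?a' k) * t')\<bar>
      \<le> ((1/8 * (2 * C) * \<delta> * ?P + 1/10 * ?D) * ?P + 1/10 * ?P * ?D)
        + (1/10 * (2 * C) * \<delta> * ?R + 1/4 * ((D + C) * \<delta>))" by linarith
    also have "\<dots> = ((1/8 * (2 * C) * ?P + 1/10 * (C' / ?m + C)) * ?P
      + 1/10 * ?P * (C' / ?m + C) + (1/10 * (2 * C) * ?R + 1/4 * (D + C))) * \<delta>"
      by (simp add: algebra_simps)
    also have "\<dots> \<le> ?L * \<delta>" by (intro mult_right_mono L_bar_second_order pos D \<delta>)
    finally show ?thesis .
  qed
  \<comment> \<open>The three values of D that occur, for the pairs AA, WA and WW in this
    order.\<close>
  have D: "C'' / real ?d \<le> C'' / ?m + C' / real ?N" "C' / real ?N \<le> C'' / ?m + C' / real ?N"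
    "C'' / real ?N \<le> C'' / ?m + C' / real ?N"
    using Ple(5,6) C_nonneg m(1) by (auto intro: add_increasing2 add_increasing)
  have "infnorm (F_map \<phi> \<theta> u v - F_map \<phi> \<theta> u' v') \<le> ?L * \<delta>"
    unfolding u' v1 v2 F_map.simps Let_def minus_prod_def fst_conv snd_conv infnorm_Pair max.bounded_iff
      infnorm_vec_le_iff vector_minus_component vec_lambda_beta infnorm_real
  proof (intro conjI allI)
    fix k :: 'n and \<alpha> \<beta> :: "'n \<times> 'd" and \<alpha>' \<beta>' :: "'n \<times> 'n"
    show "\<bar>sigmoid (?a k) - sigmoid (?a' k)\<bar> \<le> ?L * \<delta>" by (rule d0)
    show "\<bar>deriv sigmoid (?a k) * p_A \<phi> \<theta> x sA \<alpha> k - deriv sigmoid (?a' k) * p_A \<phi> \<theta> x' sA' \<alpha> k\<bar> \<le> ?L * \<delta>"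
      by (rule d1[OF pA(1) dpA])
    show "\<bar>deriv sigmoid (?a k) * p_W \<phi> \<theta> s sW \<alpha>' k - deriv sigmoid (?a' k) * p_W \<phi> \<theta> s' sW' \<alpha>' k\<bar> \<le> ?L * \<delta>"
      by (rule d1[OF pW(1) dpW])
    show "\<bar>deriv (deriv sigmoid) (?a k) * p_A \<phi> \<theta> x sA \<alpha> k * p_A \<phi> \<theta> x sA \<beta> k
        + deriv sigmoid (?a k) * r_AA \<phi> \<theta> x sAA \<alpha> \<beta> k
      - (deriv (deriv sigmoid) (?a' k) * p_A \<phi> \<theta> x' sA' \<alpha> k * p_A \<phi> \<theta> x' sA' \<beta> k
        + deriv sigmoid (?a' k) * r_AA \<phi> \<theta> x' sAA' \<alpha> \<beta> k)\<bar> \<le> ?L * \<delta>"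
      by (rule d2[OF pA dpA pA(1) dpA order_trans[OF r_AA_bound[OF x(1) b(5)] r_radius_bounds(1)[OF pos]]
            r_AA_diff[OF dx dsAA] D(1)])
    show "\<bar>deriv (deriv sigmoid) (?a k) * p_W \<phi> \<theta> s sW \<alpha>' k * p_A \<phi> \<theta> x sA \<beta> k
        + deriv sigmoid (?a k) * r_WA \<phi> \<theta> sA sWA \<alpha>' \<beta> k
      - (deriv (deriv sigmoid) (?a' k) * p_W \<phi> \<theta> s' sW' \<alpha>' k * p_A \<phi> \<theta> x' sA' \<beta> k
        + deriv sigmoid (?a' k) * r_WA \<phi> \<theta> sA' sWA' \<alpha>' \<beta> k)\<bar> \<le> ?L * \<delta>"
      by (rule d2[OF pW dpW pA(1) dpA order_trans[OF r_WA_bound[OF b(1) b(6)] r_radius_bounds(2)[OF pos]]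
            r_WA_diff[OF dsA dsWA] D(2)])
    show "\<bar>deriv (deriv sigmoid) (?a k) * p_W \<phi> \<theta> s sW \<alpha>' k * p_W \<phi> \<theta> s sW \<beta>' k
        + deriv sigmoid (?a k) * r_WW \<phi> \<theta> s sWW \<alpha>' \<beta>' k
      - (deriv (deriv sigmoid) (?a' k) * p_W \<phi> \<theta> s' sW' \<alpha>' k * p_W \<phi> \<theta> s' sW' \<beta>' k
        + deriv sigmoid (?a' k) * r_WW \<phi> \<theta> s' sWW' \<alpha>' \<beta>' k)\<bar> \<le> ?L * \<delta>"
      by (rule d2[OF pW dpW pW(1) dpW order_trans[OF r_WW_bound[OF s(1) b(7)] r_radius_bounds(3)[OF pos]]
            r_WW_diff[OF ds dsWW] D(3)])
  qed
  then show ?thesis by (simp add: \<delta>_def)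
qed

end

section \<open>Continuity of the recursion map and compactness of the box\<close>

lemma continuous_on_preact:
  assumes "continuous_on S f" "continuous_on S g"
  shows "continuous_on S (\<lambda>w. preact \<phi> \<theta> (f w) (g w) k)"
  by (cases \<theta>) (auto intro!: continuous_intros assms)

lemma continuous_on_p_A:
  assumes "continuous_on S f" "continuous_on S g"
  shows "continuous_on S (\<lambda>w. p_A \<phi> \<theta> (f w) (g w) \<alpha> k)"
  by (cases \<theta>; cases \<alpha>; simp only: p_A.simps; intro continuous_intros assms)

lemma continuous_on_p_W:
  assumes "continuous_on S f" "continuous_on S g"
  shows "continuous_on S (\<lambda>w. p_W \<phi> \<theta> (f w) (g w) \<alpha> k)"
  by (cases \<theta>; cases \<alpha>; simp only: p_W.simps; intro continuous_intros assms)

lemma continuous_on_r_AA: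
  assumes "continuous_on S f" "continuous_on S g"
  shows "continuous_on S (\<lambda>w. r_AA \<phi> \<theta> (f w) (g w) \<alpha> \<beta> k)"
  by (cases \<theta>; cases \<alpha>; cases \<beta>; simp only: r_AA.simps; intro continuous_intros assms)

lemma continuous_on_r_WA:
  assumes "continuous_on S f" "continuous_on S g"
  shows "continuous_on S (\<lambda>w. r_WA \<phi> \<theta> (f w) (g w) \<alpha> \<beta> k)"
  by (cases \<theta>; cases \<alpha>; cases \<beta>; simp only: r_WA.simps; intro continuous_intros assms)

lemma continuous_on_r_WW:
  assumes "continuous_on S f" "continuous_on S g"
  shows "continuous_on S (\<lambda>w. r_WW \<phi> \<theta> (f w) (g w) \<alpha> \<beta> k)"
  by (cases \<theta>; cases \<alpha>; cases \<beta>; simp only: r_WW.simps; intro continuous_intros assms)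

lemma continuous_on_sigmoid_compose:
  assumes "continuous_on S f"
  shows "continuous_on S (\<lambda>w. sigmoid (f w))" "continuous_on S (\<lambda>w. deriv sigmoid (f w))"
    "continuous_on S (\<lambda>w. deriv (deriv sigmoid) (f w))"
  using continuous_on_compose2[OF continuous_on_sigmoid(1) assms subset_UNIV]
    continuous_on_compose2[OF continuous_on_sigmoid(2) assms subset_UNIV]
    continuous_on_compose2[OF continuous_on_sigmoid(3) assms subset_UNIV] by auto

text \<open>Supplies Borel measurability on the whole space, where the Lipschitz estimate on the box
  says nothing.\<close>

lemma continuous_on_F_map:
  fixes \<theta> :: "('n::finite, 'd::finite) param"
  shows "continuous_on UNIV (\<lambda>w :: ('d, 'z::finite) ustate \<times> ('n, 'd) vstate. F_map \<phi> \<theta> (fst w) (snd w))"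
proof -
  \<comment> \<open>\<open>F_map\<close> is defined by pattern matching; written with projections it
    unfolds for a variable state.\<close>
  have eq: "F_map \<phi> \<theta> u v = F_map \<phi> \<theta> (fst u, snd u) (fst v, (fst (fst (snd v)), snd (fst (snd v))),
      (fst (snd (snd v)), fst (snd (snd (snd v))), snd (snd (snd (snd v)))))" for u :: "('d, 'z) ustate" and v
    by simp
  show ?thesis
    unfolding eq[unfolded F_map.simps Let_def]
    by (intro continuous_on_Pair continuous_on_vec_lambda continuous_on_add continuous_on_mult
        continuous_on_sigmoid_compose continuous_on_preact continuous_on_p_A continuous_on_p_W
        continuous_on_r_AA continuous_on_r_WA continuous_on_r_WW continuous_on_fst continuous_on_snd
        continuous_on_id)
qed

section \<open>Compactness of the cube and of the box\<close>

lemma bounded_infnorm: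
  fixes S :: "'a::euclidean_space set"
  assumes "\<And>x. x \<in> S \<Longrightarrow> infnorm x \<le> B"
  shows "bounded S"
proof -
  have "norm x \<le> sqrt DIM('a) * B" if "x \<in> S" for x
    by (rule order_trans[OF norm_le_infnorm mult_left_mono[OF assms[OF that]]]) simp
  then show ?thesis by (rule boundedI)
qed

lemma compact_u_cube: "compact (u_cube :: ('d::finite, 'z::finite) ustate set)"
proof -
  have "infnorm w \<le> 1" if "w \<in> u_cube" for w :: "('d, 'z) ustate"
    using that by (cases w) (auto simp: u_cube_def infnorm_Pair infnorm_vec_le_iff abs_le_iff minus_le_iff)
  then have "bounded (u_cube :: ('d, 'z) ustate set)" by (rule bounded_infnorm)
  moreover have "u_cube = {w :: ('d, 'z) ustate. (\<forall>j. -1 \<le> fst w $ j \<and> fst w $ j \<le> 1) \<and> (\<forall>j. -1 \<le> snd w $ j \<and> snd w $ j \<le> 1)}"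
    by (auto simp: u_cube_def)
  moreover have "closed \<dots>"
    by (intro closed_Collect_conj closed_Collect_all closed_Collect_le continuous_intros)
  ultimately show ?thesis by (simp add: compact_eq_bounded_closed)
qed

lemma compact_v_box: "compact (v_box C C' C'' :: ('n::finite, 'd::finite) vstate set)"
proof -
  define B where "B = Max {1, C' / (real CARD('d) * (4 - C)), C' / (real CARD('n) * (4 - C)),
    a_AA CARD('d) C C' C'' / (1 - C/4), a_WA CARD('n) CARD('d) C C' / (1 - C/4), a_WW CARD('n) C C' C'' / (1 - C/4)}"
  have B: "1 \<le> B" "C' / (real CARD('d) * (4 - C)) \<le> B" "C' / (real CARD('n) * (4 - C)) \<le> B"
    "a_AA CARD('d) C C' C'' / (1 - C/4) \<le> B" "a_WA CARD('n) CARD('d) C C' / (1 - C/4) \<le> B" "a_WW CARD('n) C C' C'' / (1 - C/4) \<le> B"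
    unfolding B_def by (intro Max_ge; simp)+
  have "infnorm v \<le> B" if v: "v \<in> v_box C C' C''" for v :: "('n, 'd) vstate"
  proof -
    obtain s sA sW sAA sWA sWW where v': "v = (s, (sA, sW), (sAA, sWA, sWW))" by (cases v) auto
    note b = v_boxD[OF v[unfolded v']]
    have "\<bar>s $ k\<bar> \<le> B" for k using b(1)[of k] B(1) by auto
    then show ?thesis
      unfolding v' infnorm_Pair max.bounded_iff infnorm_vec_le_iff infnorm_real
      using order_trans[OF b(2) B(2)] order_trans[OF b(3) B(3)] order_trans[OF b(4) B(4)]
        order_trans[OF b(5) B(5)] order_trans[OF b(6) B(6)] by blast
  qed
  then have "bounded (v_box C C' C'' :: ('n, 'd) vstate set)" by (rule bounded_infnorm)
  moreover have "v_box C C' C'' = {v :: ('n, 'd) vstate.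
       (\<forall>k. 0 \<le> fst v $ k \<and> fst v $ k \<le> 1) \<and>
       (\<forall>\<alpha> k. \<bar>fst (fst (snd v)) $ \<alpha> $ k\<bar> \<le> C' / (real CARD('d) * (4 - C))) \<and>
       (\<forall>\<alpha> k. \<bar>snd (fst (snd v)) $ \<alpha> $ k\<bar> \<le> C' / (real CARD('n) * (4 - C))) \<and>
       (\<forall>\<alpha> \<beta> k. \<bar>fst (snd (snd v)) $ \<alpha> $ \<beta> $ k\<bar> \<le> a_AA CARD('d) C C' C'' / (1 - C/4)) \<and>
       (\<forall>\<alpha> \<beta> k. \<bar>fst (snd (snd (snd v))) $ \<alpha> $ \<beta> $ k\<bar> \<le> a_WA CARD('n) CARD('d) C C' / (1 - C/4)) \<and>
       (\<forall>\<alpha> \<beta> k. \<bar>snd (snd (snd (snd v))) $ \<alpha> $ \<beta> $ k\<bar> \<le> a_WW CARD('n) C C' C'' / (1 - C/4))}"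
    unfolding v_box_def case_prod_beta atLeastAtMost_iff ..
  moreover have "closed \<dots>"
    by (intro closed_Collect_conj closed_Collect_all closed_Collect_le continuous_intros)
  ultimately show ?thesis by (simp only: compact_eq_bounded_closed)
qed

section \<open>Geometric ergodicity of the joint process\<close>

theorem theorem3p11:
  fixes \<phi> :: "real \<Rightarrow> real"
    and C C' C'' L\<^sub>\<kappa> q :: real
    and \<kappa> :: "('d::finite, 'z::finite) ustate \<Rightarrow> ('d, 'z) ustate measure"
    and \<nu> :: "real measure"
    and \<theta> :: "('n::finite, 'd) param"
    and \<rho> :: "('n, 'd, 'z) hstate measure"
  defines "P \<equiv> joint_kernel \<phi> \<theta> \<kappa> \<nu>"
  defines "\<mu>t \<equiv> (\<lambda>t. kernel_adjoint (kernel_pow P t) \<rho>)"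
  assumes phi_smooth: "\<forall>n y. (deriv ^^ n) \<phi> field_differentiable (at y)"
    and phi_bounded: "\<forall>n. bounded (range ((deriv ^^ n) \<phi>))"
    and C: "\<forall>y. \<bar>\<phi> y\<bar> \<le> C" "C < 4"
    and C': "\<forall>y. \<bar>deriv \<phi> y\<bar> \<le> C'"
    and C'': "\<forall>y. \<bar>deriv (deriv \<phi>) y\<bar> \<le> C''"
    and kappa_kernel: "\<kappa> \<in> borel \<rightarrow>\<^sub>M prob_algebra borel"
    and kappa_lipschitz: "\<forall>w w'. Wass2 (\<kappa> w) (\<kappa> w') \<le> ennreal (L\<^sub>\<kappa> * infnorm (w - w'))"
    and kappa_lip_const: "0 \<le> L\<^sub>\<kappa>" "L\<^sub>\<kappa> < 1"
    and kappa_cube: "\<forall>w\<in>u_cube. measure (\<kappa> w) u_cube = 1"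
    and nu: "\<nu> \<in> P2"
    and rho: "\<rho> \<in> P2" "measure \<rho> (state_space C C' C'') = 1"
    and q: "0 \<le> q" "q\<^sup>2 = L\<^sub>\<kappa>\<^sup>2 + (L_bar CARD('n) CARD('d) C C' C'')\<^sup>2" "q\<^sup>2 < 1"
  shows "\<exists>\<mu> :: ('n, 'd, 'z) hstate measure.
           \<mu> \<in> P2 \<and> measure \<mu> (state_space C C' C'') = 1 \<and>
           kernel_adjoint P \<mu> = \<mu> \<and>
           (\<exists>K > 0. \<forall>t. Wass2 (\<mu>t t) \<mu> \<le> ennreal (K * q ^ t)) \<and>
           (\<lambda>t. Wass2 (\<mu>t t) \<mu>) \<longlonglongrightarrow> 0"
proof -
  interpret activation \<phi> C C' C''
    using C C' C'' by unfold_locales auto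
  let ?U = "u_cube :: ('d, 'z) ustate set" and ?V = "v_box C C' C'' :: ('n, 'd) vstate set"
  let ?F = "F_map \<phi> \<theta> :: ('d, 'z) ustate \<Rightarrow> ('n, 'd) vstate \<Rightarrow> ('n, 'd) vstate"
  \<comment> \<open>The joint kernel without its noise coordinate: u moves at random, v moves by F
    evaluated at the old pair.\<close>
  define K where "K = (\<lambda>w. distr (\<kappa> (fst w)) borel (\<lambda>u'. (u', ?F (fst w) (snd w))))"
  have \<kappa>: "\<kappa> u \<in> borel_prob" for u using measurable_space[OF kappa_kernel, of u] by simp
  have q1: "q < 1" using q(1,3) by (simp add: abs_square_less_1)
  interpret wass_contraction K "?U \<times> ?V" q
    unfolding K_def
  proof (rule driven_recursion_contraction[OF kappa_kernel, where L="L\<^sub>\<kappa>" and Lb="L_bar CARD('n) CARD('d) C C' C''"])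
    show "(\<lambda>w. ?F (fst w) (snd w)) \<in> borel_measurable borel"
      by (rule borel_measurable_continuous_onI[OF continuous_on_F_map])
    show "AE x in \<kappa> u. x \<in> ?U" if "u \<in> ?U" for u
      using kappa_cube that by (intro prob_space.AE_prob_1[OF borel_probD(1)[OF \<kappa>]]) auto
    show "0 \<le> L_bar CARD('n) CARD('d) C C' C''"
      using L_bar_ge_C[of "CARD('n)" "CARD('d)"] C_nonneg(1) by linarith
    show "\<And>u v u' v'. u \<in> ?U \<Longrightarrow> u' \<in> ?U \<Longrightarrow> v \<in> ?V \<Longrightarrow> v' \<in> ?V \<Longrightarrow>
      infnorm (?F u v - ?F u' v') \<le> L_bar CARD('n) CARD('d) C C' C'' * infnorm ((u, v) - (u', v'))"
      by (rule F_map_lipschitz)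
  qed (assumption | rule compact_u_cube compact_v_box F_map_v_box kappa_lipschitz[rule_format] kappa_lip_const q)+
  interpret N: noisy_contraction K "?U \<times> ?V" q \<nu>
    by unfold_locales (rule P2_borel_prob[OF nu])
  \<comment> \<open>Identifies the threefold product kernel with the noise-attached version of K, so
    that ergodicity of the latter applies.\<close>
  have P: "P = N.P"
  proof
    fix h :: "('n, 'd, 'z) hstate"
    show "P h = N.P h"
      unfolding P_def N.P_def N.pr_def N.attach_noise_def joint_kernel_def
      by (cases h) (simp add: K_def driven_recursion_noise[OF \<kappa> N.noise])
  qed
  have pr: "N.pr h \<in> ?U \<times> ?V \<longleftrightarrow> h \<in> state_space C C' C''" for h
    by (cases h) (auto simp: N.pr_def state_space_def)
  have st: "state_space C C' C'' \<in> sets (borel :: ('n, 'd, 'z) hstate measure)"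
    unfolding state_space_def
    by (intro borel_closed closed_Times compact_imp_closed compact_u_cube compact_v_box closed_UNIV)
  have ae: "measure M (state_space C C' C'') = 1 \<longleftrightarrow> (AE h in M. N.pr h \<in> ?U \<times> ?V)"
    if "M \<in> borel_prob" for M
    unfolding pr using st borel_probD[OF that] by (intro prob_space.AE_in_set_eq_1[symmetric]) auto
  have ae_\<rho>: "AE h in \<rho>. N.pr h \<in> ?U \<times> ?V"
    using rho ae P2_borel_prob by blast
  \<comment> \<open>No point of the box has to be exhibited: a probability measure is carried by
    it.\<close>
  have "?U \<times> ?V \<noteq> {}"
  proof
    assume empty: "?U \<times> ?V = {}"
    have "AE h in \<rho>. False" using ae_\<rho> unfolding empty by simp
    then show False using prob_space.AE_False[OF borel_probD(1)[OF P2_borel_prob[OF rho(1)]]] by simp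
  qed
  from N.geometric_ergodicity[OF this q1 nu rho(1) ae_\<rho>]
  obtain \<mu> c where \<mu>: "\<mu> \<in> P2" "AE h in \<mu>. N.pr h \<in> ?U \<times> ?V" "\<mu> \<bind> N.P = \<mu>" "0 < c"
    and conv: "\<And>t. Wass2 (\<rho> \<bind> kernel_pow N.P t) \<mu> \<le> ennreal (c * q ^ t)" by blast
  have lim: "(\<lambda>t. ennreal (c * q ^ t)) \<longlonglongrightarrow> ennreal (c * 0)"
    using q(1) q1 by (intro tendsto_ennrealI tendsto_mult tendsto_const LIMSEQ_power_zero) auto
  have "(\<lambda>t. Wass2 (\<rho> \<bind> kernel_pow N.P t) \<mu>) \<longlonglongrightarrow> 0"
  proof (rule tendsto_sandwich[OF _ _ tendsto_const])
    show "(\<lambda>t. ennreal (c * q ^ t)) \<longlonglongrightarrow> 0" using lim by simp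
  qed (use conv in simp_all)
  then show ?thesis
    unfolding \<mu>t_def P kernel_adjoint_def using \<mu> conv ae[OF P2_borel_prob[OF \<mu>(1)]] by blast
qed

end
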